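(* Let $B\subset\mathbb R^3$ be a ball of radius $R$, let $\nu\in\mathbb R$ satisfy $\psi_n'(\nu R)\neq0$ for all integers $n\ge0$, let $k,m\ge0$ be integers, and let $\mathbf f\in\mathbf A^{2k}(B)\oplus\mathbf W^m(B)$. Then the solution $\mathbf w\in\mathbf L_2(B)$ of the problem $$\nabla\mathrm{div}\,\mathbf w+\lambda\mathbf w=\mathbf f\ \text{ in }B,\qquad\gamma(\mathbf n\cdot\mathbf w)=0\ \text{(if this trace exists)},\qquad\lambda=\nu^2,$$ exists, is unique and belongs to the class $\mathbf A^{2(k+1)}(B)\oplus\mathbf W^m(B)$.
   Context: $\psi_n(z)=(-z)^n\left(\frac{d}{z\,dz}\right)^n\left(\frac{\sin z}{z}\right)$, extended by continuity to $z=0$; $\psi_n'$ is its derivative. $\mathbf n$ is the unit normal on $\partial B$, $\gamma$ the boundary trace; $\mathbf L_2(B)$ is the real Hilbert space of square integrable vector fields with inner product $(\cdot,\cdot)$. $\mathcal A=\{\nabla h:h\in H^1(B)\}$ and $\mathbf V^0$ is its orthogonal complement in $\mathbf L_2(B)$; $\mathbf f_{\mathcal A}$, $\mathbf f_{\mathbf V}$ denote the orthogonal projections. $\{\mathbf q_j\}$ is an orthonormal basis of $\mathcal A$ with $\mathbf q_j\in\mathbf C^\infty(\overline B)$, $-\nabla\mathrm{div}\,\mathbf q_j=\nu_j^2\mathbf q_j$, $\gamma(\mathbf n\cdot\mathbf q_j)=0$, $0<\nu_1^2\le\nu_2^2\le\dots$. For $k\ge0$, $\mathbf A^{2k}(B)=\{\mathbf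 f\in\mathcal A:\sum_j\nu_j^{4k}(\mathbf f,\mathbf q_j)^2<\infty\}$; for $m\ge1$, $\mathbf W^m(B)=\{\mathbf f\in\mathbf V^0,\ \mathrm{rot}\,\mathbf f\in\mathbf V^0,\dots,\mathrm{rot}^m\mathbf f\in\mathbf V^0\}$, $\mathbf W^0=\mathbf V^0$. $\mathcal N_d$ with domain $\mathbf A^2$ is $\mathcal N_d\mathbf f=-\sum_j\nu_j^2(\mathbf f,\mathbf q_j)\mathbf q_j$, the self-adjoint extension of $\nabla\mathrm{div}$. The problem is understood via $\mathcal N_d$, i.e. as the pair of projected equations $(\mathcal N_d+\lambda I)\mathbf w_{\mathcal A}=\mathbf f_{\mathcal A}$ (with $\mathbf w_{\mathcal A}\in\mathbf A^2$) and $\lambda\mathbf w_{\mathbf V}=\mathbf f_{\mathbf V}$. *)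

theory Defs
  imports "HOL-Analysis.Analysis"
begin

(* Elements of L_2(B) are represented by functions on the whole space; only their values on B
   matter, and equality in L_2(B) is equality almost everywhere in B. *)

type_synonym sfield = "real^3 \<Rightarrow> real"
type_synonym vfield = "real^3 \<Rightarrow> real^3"

section \<open>The functions $\psi_n$\<close>

definition psi_raw :: "nat \<Rightarrow> real \<Rightarrow> real" where
  "psi_raw n z = (- z) ^ n * (((\<lambda>g t. deriv g t / t) ^^ n) (\<lambda>t. sin t / t)) z"

definition psi :: "nat \<Rightarrow> real \<Rightarrow> real" where
  "psi n z = (if z = 0 then Lim (at 0) (psi_raw n) else psi_raw n z)"

section \<open>Classical differential operators and smoothness\<close>

definition pderiv_at :: "3 \<Rightarrow> (real^3 \<Rightarrow> 'b::real_normed_vector) \<Rightarrow> real^3 \<Rightarrow> 'b" where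
  "pderiv_at i f x = frechet_derivative f (at x) (axis i 1)"

definition grad :: "sfield \<Rightarrow> vfield" where
  "grad h x = (\<chi> i. pderiv_at i h x)"

definition divergence :: "vfield \<Rightarrow> sfield" where
  "divergence f x = (\<Sum>i\<in>UNIV. pderiv_at i f x $ i)"

definition rot :: "vfield \<Rightarrow> vfield" where
  "rot f x = vector
     [pderiv_at 2 f x $ 3 - pderiv_at 3 f x $ 2,
      pderiv_at 3 f x $ 1 - pderiv_at 1 f x $ 3,
      pderiv_at 1 f x $ 2 - pderiv_at 2 f x $ 1]"

(* C^k on an open set U. *)
primrec Ck_on :: "nat \<Rightarrow> (real^3) set \<Rightarrow> (real^3 \<Rightarrow> 'b::real_normed_vector) \<Rightarrow> bool" where
  "Ck_on 0 U f \<longleftrightarrow> continuous_on U f"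
| "Ck_on (Suc k) U f \<longleftrightarrow> continuous_on U f \<and> f differentiable_on U \<and> (\<forall>i. Ck_on k U (pderiv_at i f))"

(* C^k on an open set U with all derivatives up to order k extending continuously to the closure. *)
primrec Ck_closure :: "nat \<Rightarrow> (real^3) set \<Rightarrow> (real^3 \<Rightarrow> 'b::real_normed_vector) \<Rightarrow> bool" where
  "Ck_closure 0 U f \<longleftrightarrow> (\<exists>g. continuous_on (closure U) g \<and> (\<forall>x\<in>U. g x = f x))"
| "Ck_closure (Suc k) U f \<longleftrightarrow>
     (\<exists>g. continuous_on (closure U) g \<and> (\<forall>x\<in>U. g x = f x)) \<and>
     f differentiable_on U \<and> (\<forall>i. Ck_closure k U (pderiv_at i f))"

(* The first conjunct makes the values of f itself on the boundary its boundary trace. *)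
definition smooth_closure :: "(real^3) set \<Rightarrow> (real^3 \<Rightarrow> 'b::real_normed_vector) \<Rightarrow> bool" where
  "smooth_closure U f \<longleftrightarrow> continuous_on (closure U) f \<and> (\<forall>k. Ck_closure k U f)"

definition test_functions :: "(real^3) set \<Rightarrow> (real^3 \<Rightarrow> 'b::real_normed_vector) set" where
  "test_functions U =
     {\<phi>. (\<forall>k. Ck_on k UNIV \<phi>) \<and> (\<exists>K. compact K \<and> K \<subseteq> U \<and> (\<forall>x. x \<notin> K \<longrightarrow> \<phi> x = 0))}"

section \<open>Square integrable fields\<close>

definition L2 :: "(real^3) set \<Rightarrow> (real^3 \<Rightarrow> 'b::euclidean_space) set" where
  "L2 B = {f. f \<in> borel_measurable (lebesgue_on B) \<and>
              integrable (lebesgue_on B) (\<lambda>x. (norm (f x))\<^sup>2)}"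

definition L2_inner :: "(real^3) set \<Rightarrow> vfield \<Rightarrow> vfield \<Rightarrow> real" where
  "L2_inner B f g = (LINT x|lebesgue_on B. f x \<bullet> g x)"

definition L2_norm :: "(real^3) set \<Rightarrow> vfield \<Rightarrow> real" where
  "L2_norm B f = sqrt (L2_inner B f f)"

definition eq_ae :: "(real^3) set \<Rightarrow> vfield \<Rightarrow> vfield \<Rightarrow> bool" where
  "eq_ae B f g \<longleftrightarrow> (AE x in lebesgue_on B. f x = g x)"

definition L2_sums :: "(real^3) set \<Rightarrow> (nat \<Rightarrow> vfield) \<Rightarrow> vfield \<Rightarrow> bool" where
  "L2_sums B F g \<longleftrightarrow>
     g \<in> L2 B \<and> (\<lambda>n. L2_norm B (\<lambda>x. g x - (\<Sum>j<n. F j x))) \<longlonglongrightarrow> 0"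

(* Determined up to equality almost everywhere in B, if S is a closed subspace of L_2(B). *)
definition orth_proj :: "(real^3) set \<Rightarrow> vfield set \<Rightarrow> vfield \<Rightarrow> vfield" where
  "orth_proj B S f = (SOME g. g \<in> S \<and> (\<forall>u\<in>S. L2_inner B (\<lambda>x. f x - g x) u = 0))"

section \<open>Potential fields, their orthogonal complement, and the classes $W^m$\<close>

definition weak_grad :: "(real^3) set \<Rightarrow> sfield \<Rightarrow> vfield \<Rightarrow> bool" where
  "weak_grad B h g \<longleftrightarrow>
     (\<forall>\<phi>\<in>test_functions B. \<forall>i.
        (LINT x|lebesgue_on B. h x * pderiv_at i \<phi> x) = - (LINT x|lebesgue_on B. g x $ i * \<phi> x))"

definition H1 :: "(real^3) set \<Rightarrow> sfield set" where
  "H1 B = {h \<in> L2 B. \<exists>g\<in>L2 B. weak_grad B h g}"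

definition A_space :: "(real^3) set \<Rightarrow> vfield set" where
  "A_space B = {g \<in> L2 B. \<exists>h\<in>H1 B. weak_grad B h g}"

definition V0 :: "(real^3) set \<Rightarrow> vfield set" where
  "V0 B = {f \<in> L2 B. \<forall>g\<in>A_space B. L2_inner B f g = 0}"

definition weak_rot :: "(real^3) set \<Rightarrow> vfield \<Rightarrow> vfield \<Rightarrow> bool" where
  "weak_rot B f g \<longleftrightarrow> (\<forall>\<phi>\<in>test_functions B. L2_inner B f (rot \<phi>) = L2_inner B g \<phi>)"

primrec W_space :: "(real^3) set \<Rightarrow> nat \<Rightarrow> vfield set" where
  "W_space B 0 = V0 B"
| "W_space B (Suc m) = {f \<in> V0 B. \<exists>g\<in>W_space B m. weak_rot B f g}"

section \<open>The eigenfields of the gradient of divergence\<close>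

(* (x - c) / R is the outward unit normal at a boundary point x of the ball. *)
definition graddiv_eigenbasis :: "real^3 \<Rightarrow> real \<Rightarrow> (nat \<Rightarrow> vfield) \<Rightarrow> (nat \<Rightarrow> real) \<Rightarrow> bool" where
  "graddiv_eigenbasis c R q \<nu> \<longleftrightarrow>
     (\<forall>j. q j \<in> A_space (ball c R)) \<and>
     (\<forall>i j. L2_inner (ball c R) (q i) (q j) = (if i = j then 1 else 0)) \<and>
     (\<forall>f\<in>A_space (ball c R).
        L2_sums (ball c R) (\<lambda>j x. L2_inner (ball c R) f (q j) *\<^sub>R q j x) f) \<and>
     (\<forall>j. smooth_closure (ball c R) (q j)) \<and>
     (\<forall>j. \<forall>x\<in>ball c R. - grad (divergence (q j)) x = (\<nu> j)\<^sup>2 *\<^sub>R q j x) \<and>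
     (\<forall>j. \<forall>x\<in>sphere c R. ((x - c) /\<^sub>R R) \<bullet> q j x = 0) \<and>
     0 < (\<nu> 0)\<^sup>2 \<and> (\<forall>j. (\<nu> j)\<^sup>2 \<le> (\<nu> (Suc j))\<^sup>2)"

(* A_pow B q \<nu> k is the class A^{2k}(B). *)
definition A_pow ::
  "(real^3) set \<Rightarrow> (nat \<Rightarrow> vfield) \<Rightarrow> (nat \<Rightarrow> real) \<Rightarrow> nat \<Rightarrow> vfield set" where
  "A_pow B q \<nu> k = {f \<in> A_space B. summable (\<lambda>j. \<nu> j ^ (4 * k) * (L2_inner B f (q j))\<^sup>2)}"

(* Meaningful, up to equality almost everywhere in B, for f in the domain A^2(B). *)
definition N_d :: "(real^3) set \<Rightarrow> (nat \<Rightarrow> vfield) \<Rightarrow> (nat \<Rightarrow> real) \<Rightarrow> vfield \<Rightarrow> vfield" where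
  "N_d B q \<nu> f =
     (SOME g. L2_sums B (\<lambda>j x. - ((\<nu> j)\<^sup>2 * L2_inner B f (q j)) *\<^sub>R q j x) g)"

definition direct_sum :: "(real^3) set \<Rightarrow> vfield set \<Rightarrow> vfield set \<Rightarrow> vfield set" where
  "direct_sum B S T = {f \<in> L2 B. \<exists>a\<in>S. \<exists>v\<in>T. eq_ae B f (\<lambda>x. a x + v x)}"

(* Solutions w in L_2(B) of  grad div w + \<lambda> w = f,  n . w = 0 on the boundary.  The boundary
   condition is carried by the domain A^2(B) of N_d. *)
definition graddiv_solution ::
  "(real^3) set \<Rightarrow> (nat \<Rightarrow> vfield) \<Rightarrow> (nat \<Rightarrow> real) \<Rightarrow> real \<Rightarrow> vfield \<Rightarrow> vfield \<Rightarrow> bool" where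
  "graddiv_solution B q \<nu> lam f w \<longleftrightarrow>
     w \<in> L2 B \<and>
     orth_proj B (A_space B) w \<in> A_pow B q \<nu> 1 \<and>
     eq_ae B (\<lambda>x. N_d B q \<nu> (orth_proj B (A_space B) w) x + lam *\<^sub>R orth_proj B (A_space B) w x)
             (orth_proj B (A_space B) f) \<and>
     eq_ae B (\<lambda>x. lam *\<^sub>R orth_proj B (V0 B) w x) (orth_proj B (V0 B) f)"

end

(* Expanding in the eigenbasis, the equation on the potential part becomes
   (lam - nu_j^2) (w, q_j) = (f, q_j), while on the solenoidal part it is division by lam.  So
   everything rests on two facts about the spectrum: no nu_j^2 equals lam = nu^2, and the nu_j^2 do
   not accumulate.

   If nu_j^2 = lam, then g = div q_j solves the Helmholtz equation with Neumann boundary condition.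
   For a solid harmonic h of degree n, the equation (Laplacian + lam) v = h(x) |x|^(2j) has a solution
   v = h(x) phi(|x|^2), where phi is a polynomial plus a multiple of the entire function underlying
   psi_n; since psi_n'(nu R) is not zero, the multiple can be chosen such that the normal derivative
   of v vanishes on the sphere.  By Green's formula g is orthogonal to h(x) |x|^(2j).  These functions
   span all polynomials, so g = 0 and q_j = 0.

   For the second fact, let g_1, ..., g_N be orthonormal with |grad g_j|^2 <= L.  Comparing g_j(x) with
   g_j((1 - t) x + t y), averaged over x and y, changes it little for small t, whereas by Bessel's
   inequality the averages over y have a total square norm bounded by t^(-3).  Hence N <= 8 t^(-3).

   Green's formula comes from the divergence theorem for fields tangential to the sphere, which needs
   no surface integral: the cutoffs 1 - (|x - c| / R)^(2n) vanish on the sphere and tend to 1. *)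

theory Submission
  imports Defs
begin

section \<open>The Hilbert space of square integrable functions\<close>

text \<open>The hypotheses only make the squares of \<open>\<nu>s j\<close> nondecreasing. If they
  increased to \<open>lam\<close>, the divisors lam - nu_j^2 would have no positive lower bound;
  this is the reason for the compactness argument. It is applied to div q_j / nu_j, which Green's
  formula makes orthonormal, with gradient -nu_j q_j of norm |nu_j|. Finiteness below every level
  then bounds both 1 / (lam - nu_j^2)^2 and nu_j^4 / (lam - nu_j^2)^2: the first bound makes the
  solution square integrable, the second is the gain from A^(2k) to A^(2(k+1)). The projections and
  \<open>N_d\<close> are picked by choice, so each has to be shown to exist. The obstacle is that
  the potential fields, defined through weak gradients, must contain the sum of every square
  summable series in the q_j; the explicit potentials -div q_j / nu_j^2 give this without a Poincare
  inequality. The case nu = 0, where division by lam fails, is excluded by the hypothesis at n = 0,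
  since psi_0'(0) = 0.\<close>

definition ip :: "(real^3) set \<Rightarrow> (real^3 \<Rightarrow> 'b::euclidean_space) \<Rightarrow> (real^3 \<Rightarrow> 'b) \<Rightarrow> real" where
  "ip B f g = (LINT x|lebesgue_on B. f x \<bullet> g x)"

text \<open>\<open>ip\<close> also pairs scalar functions, so that potentials and divergences share
  one Hilbert space theory with the fields; on fields it is \<open>L2_inner\<close>.\<close>

lemma L2_inner_eq_ip: "L2_inner = ip"
  by (simp add: fun_eq_iff L2_inner_def ip_def)

lemma L2_measurable: "f \<in> L2 B \<Longrightarrow> f \<in> borel_measurable (lebesgue_on B)"
  and L2_integrable: "f \<in> L2 B \<Longrightarrow> integrable (lebesgue_on B) (\<lambda>x. (norm (f x))\<^sup>2)"
  by (auto simp: L2_def)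

lemma L2I:
  assumes "f \<in> borel_measurable (lebesgue_on B)"
    and "integrable (lebesgue_on B) w" and "\<And>x. (norm (f x))\<^sup>2 \<le> w x"
  shows "f \<in> L2 B"
  unfolding L2_def
  using assms by (auto intro!: Bochner_Integration.integrable_bound[OF assms(2)] AE_I2 order.trans[OF _ abs_ge_self])

lemma norm_add_square_le:
  fixes a b :: "'b::real_normed_vector"
  shows "(norm (a + b))\<^sup>2 \<le> 2 * (norm a)\<^sup>2 + 2 * (norm b)\<^sup>2"
proof -
  have "(norm (a + b))\<^sup>2 \<le> (norm a + norm b)\<^sup>2"
    by (simp add: norm_triangle_ineq power_mono)
  also have "\<dots> \<le> 2 * (norm a)\<^sup>2 + 2 * (norm b)\<^sup>2"
    using sum_squares_bound[of "norm a" "norm b"] by (simp add: power2_sum)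
  finally show ?thesis .
qed

lemma L2_add:
  assumes "f \<in> L2 B" "g \<in> L2 B"
  shows "(\<lambda>x. f x + g x) \<in> L2 B"
proof (rule L2I)
  show "(\<lambda>x. f x + g x) \<in> borel_measurable (lebesgue_on B)"
    using assms by (intro borel_measurable_add L2_measurable)
  show "integrable (lebesgue_on B) (\<lambda>x. 2 * (norm (f x))\<^sup>2 + 2 * (norm (g x))\<^sup>2)"
    using assms by (intro Bochner_Integration.integrable_add integrable_mult_right L2_integrable)
qed (rule norm_add_square_le)

lemma L2_scale: "f \<in> L2 B \<Longrightarrow> (\<lambda>x. c *\<^sub>R f x) \<in> L2 B"
  by (rule L2I[where w="\<lambda>x. c\<^sup>2 * (norm (f x))\<^sup>2"])
    (auto simp: power_mult_distrib dest: L2_measurable L2_integrable)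

lemma L2_diff: "f \<in> L2 B \<Longrightarrow> g \<in> L2 B \<Longrightarrow> (\<lambda>x. f x - g x) \<in> L2 B"
  using L2_add[of f B "\<lambda>x. (-1) *\<^sub>R g x"] L2_scale[of g B "-1"] by simp

lemma L2_zero: "(\<lambda>x. 0) \<in> L2 B"
  by (simp add: L2_def)

lemma L2_sum: "(\<And>j. j \<in> I \<Longrightarrow> F j \<in> L2 B) \<Longrightarrow> (\<lambda>x. \<Sum>j\<in>I. F j x) \<in> L2 B"
  by (induction I rule: infinite_finite_induct) (auto intro: L2_zero L2_add)

lemma L2_inner_integrable:
  assumes "f \<in> L2 B" "g \<in> L2 B"
  shows "integrable (lebesgue_on B) (\<lambda>x. f x \<bullet> g x)"
proof (rule Bochner_Integration.integrable_bound)
  show "integrable (lebesgue_on B) (\<lambda>x. (norm (f x))\<^sup>2 + (norm (g x))\<^sup>2)"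
    using assms by (auto dest: L2_integrable)
  show "(\<lambda>x. f x \<bullet> g x) \<in> borel_measurable (lebesgue_on B)"
    using assms by (auto dest!: L2_measurable intro: borel_measurable_inner)
  have "\<bar>a \<bullet> b\<bar> \<le> (norm a)\<^sup>2 + (norm b)\<^sup>2" for a b :: 'a
    using Cauchy_Schwarz_ineq2[of a b] sum_squares_bound[of "norm a" "norm b"]
      mult_nonneg_nonneg[of "norm a" "norm b"] by linarith
  then show "AE x in lebesgue_on B. norm (f x \<bullet> g x) \<le> norm ((norm (f x))\<^sup>2 + (norm (g x))\<^sup>2)"
    by (intro AE_I2) (auto intro: order.trans[OF _ abs_ge_self])
qed

lemma ip_commute: "ip B f g = ip B g f"
  by (simp add: ip_def inner_commute)

lemma ip_add_left: "f \<in> L2 B \<Longrightarrow> g \<in> L2 B \<Longrightarrow> u \<in> L2 B \<Longrightarrow>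
    ip B (\<lambda>x. f x + g x) u = ip B f u + ip B g u"
  by (simp add: ip_def inner_add_left L2_inner_integrable)

lemma ip_diff_left: "f \<in> L2 B \<Longrightarrow> g \<in> L2 B \<Longrightarrow> u \<in> L2 B \<Longrightarrow>
    ip B (\<lambda>x. f x - g x) u = ip B f u - ip B g u"
  by (simp add: ip_def inner_diff_left L2_inner_integrable)

lemma ip_scale_left: "ip B (\<lambda>x. c *\<^sub>R f x) u = c * ip B f u"
  by (simp add: ip_def)

lemma ip_sum_left:
  "(\<And>j. j \<in> I \<Longrightarrow> F j \<in> L2 B) \<Longrightarrow> u \<in> L2 B \<Longrightarrow> ip B (\<lambda>x. \<Sum>j\<in>I. F j x) u = (\<Sum>j\<in>I. ip B (F j) u)"
  by (simp add: ip_def inner_sum_left L2_inner_integrable)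

lemma ip_diff_right: "f \<in> L2 B \<Longrightarrow> g \<in> L2 B \<Longrightarrow> u \<in> L2 B \<Longrightarrow>
    ip B u (\<lambda>x. f x - g x) = ip B u f - ip B u g"
  by (simp add: ip_def inner_diff_right L2_inner_integrable)

lemma ip_scale_right: "ip B u (\<lambda>x. c *\<^sub>R f x) = c * ip B u f"
  by (simp add: ip_def)

lemma ip_sum_right:
  "(\<And>j. j \<in> I \<Longrightarrow> F j \<in> L2 B) \<Longrightarrow> u \<in> L2 B \<Longrightarrow> ip B u (\<lambda>x. \<Sum>j\<in>I. F j x) = (\<Sum>j\<in>I. ip B u (F j))"
  by (simp add: ip_def inner_sum_right L2_inner_integrable)

lemma ip_nonneg: "ip B f f \<ge> 0"
  by (simp add: ip_def)

lemma ip_eq_0_AE: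
  assumes "f \<in> L2 B" "ip B f f = 0"
  shows "AE x in lebesgue_on B. f x = 0"
proof -
  have "AE x in lebesgue_on B. f x \<bullet> f x = 0"
    using integral_nonneg_eq_0_iff_AE[of "lebesgue_on B" "\<lambda>x. f x \<bullet> f x"] assms
    by (simp add: ip_def L2_inner_integrable)
  then show ?thesis by simp
qed

lemma ip_cong_AE:
  assumes "f \<in> L2 B" "f' \<in> L2 B" "u \<in> L2 B" "AE x in lebesgue_on B. f x = f' x"
  shows "ip B f u = ip B f' u"
  unfolding ip_def
  by (rule integral_cong_AE)
    (use assms in \<open>auto dest!: L2_measurable intro: borel_measurable_inner\<close>)

lemma ip_Cauchy_Schwarz:
  assumes "f \<in> L2 B" "g \<in> L2 B"
  shows "(ip B f g)\<^sup>2 \<le> ip B f f * ip B g g"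
proof -
  have *: "0 \<le> ip B f f - 2 * t * ip B f g + t\<^sup>2 * ip B g g" for t
  proof -
    have "0 \<le> ip B (\<lambda>x. f x - t *\<^sub>R g x) (\<lambda>x. f x - t *\<^sub>R g x)" by (rule ip_nonneg)
    also have "\<dots> = ip B f f - 2 * t * ip B f g + t\<^sup>2 * ip B g g"
      using assms by (simp add: ip_diff_left ip_diff_right L2_scale L2_diff ip_scale_left
          ip_scale_right ip_commute[of B g f] algebra_simps power2_eq_square)
    finally show ?thesis .
  qed
  show ?thesis
  proof (cases "ip B g g = 0")
    case True
    have "ip B f g = 0"
    proof (rule ccontr)
      assume n: "ip B f g \<noteq> 0"
      \<comment> \<open>For \<open>ip B g g = 0\<close> the quadratic in t is affine, and a nonzero
        slope would give it the value -1 at this t.\<close>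
      have "0 \<le> ip B f f - 2 * ((ip B f f + 1) / (2 * ip B f g)) * ip B f g"
        using *[of "(ip B f f + 1) / (2 * ip B f g)"] True by simp
      then show False using n by (simp add: field_simps)
    qed
    then show ?thesis using True by simp
  next
    case False
    then have p: "ip B g g > 0" using ip_nonneg[of B g] by simp
    \<comment> \<open>This t is the minimiser of the quadratic.\<close>
    have "0 \<le> ip B f f - 2 * (ip B f g / ip B g g) * ip B f g + (ip B f g / ip B g g)\<^sup>2 * ip B g g"
      by (rule *)
    also have "\<dots> = ip B f f - (ip B f g)\<^sup>2 / ip B g g"
      using p by (simp add: field_simps power2_eq_square)
    finally show ?thesis using p by (simp add: field_simps)
  qed
qed

lemma ip_tendsto:
  assumes "\<And>n. f n \<in> L2 B" "g \<in> L2 B" "u \<in> L2 B"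
    and "(\<lambda>n. ip B (\<lambda>x. g x - f n x) (\<lambda>x. g x - f n x)) \<longlonglongrightarrow> 0"
  shows "(\<lambda>n. ip B (f n) u) \<longlonglongrightarrow> ip B g u"
proof -
  have "(\<lambda>n. (ip B g u - ip B (f n) u)\<^sup>2) \<longlonglongrightarrow> 0"
  proof (rule tendsto_sandwich[of "\<lambda>_. 0"])
    show "(\<lambda>n. ip B (\<lambda>x. g x - f n x) (\<lambda>x. g x - f n x) * ip B u u) \<longlonglongrightarrow> 0"
      using tendsto_mult_left_zero[OF assms(4)] by simp
    show "\<forall>\<^sub>F n in sequentially. (ip B g u - ip B (f n) u)\<^sup>2
        \<le> ip B (\<lambda>x. g x - f n x) (\<lambda>x. g x - f n x) * ip B u u"
    proof (intro always_eventually allI)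
      fix n
      show "(ip B g u - ip B (f n) u)\<^sup>2 \<le> ip B (\<lambda>x. g x - f n x) (\<lambda>x. g x - f n x) * ip B u u"
        using ip_Cauchy_Schwarz[of "\<lambda>x. g x - f n x" B u] assms(1-3)
        by (simp add: L2_diff ip_diff_left)
    qed
  qed auto
  then have "(\<lambda>n. ip B g u - ip B (f n) u) \<longlonglongrightarrow> 0" by simp
  from tendsto_diff[OF tendsto_const[of "ip B g u"] this] show ?thesis by simp
qed

section \<open>Completeness and orthogonal series\<close>

text \<open>On a set of finite measure a Cauchy sequence in L^2 is Cauchy in L^1, so a subsequence
  converges almost everywhere; Fatou's lemma turns the pointwise limit into a limit in L^2 of the
  whole sequence.\<close>

lemma L2_complete:
  fixes s :: "nat \<Rightarrow> real^3 \<Rightarrow> 'b::euclidean_space"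
  assumes B: "B \<in> lmeasurable" and s: "\<And>n. s n \<in> L2 B"
    and cauchy: "\<And>e. e > 0 \<Longrightarrow> \<exists>N. \<forall>i\<ge>N. \<forall>j\<ge>N. ip B (\<lambda>x. s i x - s j x) (\<lambda>x. s i x - s j x) < e"
  obtains g where "g \<in> L2 B" "(\<lambda>n. ip B (\<lambda>x. g x - s n x) (\<lambda>x. g x - s n x)) \<longlonglongrightarrow> 0"
proof -
  let ?M = "lebesgue_on B"
  interpret finite_measure ?M
    using B by (simp add: finite_measure_lebesgue_on)
  have int1: "integrable ?M f" if "f \<in> L2 B" for f :: "real^3 \<Rightarrow> 'b"
  proof (rule Bochner_Integration.integrable_bound[of _ "\<lambda>x. 1 + (norm (f x))\<^sup>2"])
    show "integrable ?M (\<lambda>x. 1 + (norm (f x))\<^sup>2)"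
      using L2_integrable[OF that] by simp
    show "f \<in> borel_measurable ?M" using L2_measurable[OF that] .
    have "t \<le> 1 + t\<^sup>2" for t :: real using zero_le_power2[of "t - 1 / 2"] by (simp add: power2_eq_square algebra_simps del: zero_le_power2 zero_le_square)
    then show "AE x in ?M. norm (f x) \<le> norm (1 + (norm (f x))\<^sup>2)"
      by (intro AE_I2) (auto intro: order.trans[OF _ abs_ge_self])
  qed
  obtain r where r: "strict_mono r" "AE x in ?M. Cauchy (\<lambda>i. s (r i) x)"
  proof (rule cauchy_L1_AE_cauchy_subseq[of ?M s])
    show "integrable ?M (s n)" for n using int1[OF s] .
    fix e :: real assume e: "e > 0"
    \<comment> \<open>Adding 1 keeps the divisor positive when B is a null set.\<close>
    define K where "K = measure ?M (space ?M) + 1"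
    have K: "K > 0" by (simp add: K_def add_nonneg_pos)
    obtain N where N: "\<forall>i\<ge>N. \<forall>j\<ge>N. ip B (\<lambda>x. s i x - s j x) (\<lambda>x. s i x - s j x) < e\<^sup>2 / K"
      using cauchy[of "e\<^sup>2 / K"] e K by auto
    show "\<exists>N. \<forall>i\<ge>N. \<forall>j\<ge>N. LINT x|?M. norm (s i x - s j x) < e"
    proof (intro exI[of _ N] allI impI)
      fix i j assume ij: "i \<ge> N" "j \<ge> N"
      \<comment> \<open>Cauchy-Schwarz against the constant 1 bounds the L^1 norm of d by its L^2
        norm.\<close>
      define d where "d = (\<lambda>x. norm (s i x - s j x))"
      have dd: "(\<lambda>x. s i x - s j x) \<in> L2 B" by (intro L2_diff s)
      have dL: "d \<in> L2 B"
        using L2_measurable[OF dd] L2_integrable[OF dd]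
        by (auto simp: L2_def d_def)
      have oL: "(\<lambda>x. 1::real) \<in> L2 B" by (simp add: L2_def)
      have "(LINT x|?M. d x)\<^sup>2 = (ip B d (\<lambda>x. 1))\<^sup>2" by (simp add: ip_def)
      also have "\<dots> \<le> ip B d d * ip B (\<lambda>x. 1::real) (\<lambda>x. 1)"
        by (rule ip_Cauchy_Schwarz[OF dL oL])
      also have "ip B d d = ip B (\<lambda>x. s i x - s j x) (\<lambda>x. s i x - s j x)"
        by (simp add: ip_def d_def dot_square_norm power2_eq_square)
      also have "ip B (\<lambda>x. 1::real) (\<lambda>x. 1) = measure ?M (space ?M)"
        by (simp add: ip_def)
      also have "ip B (\<lambda>x. s i x - s j x) (\<lambda>x. s i x - s j x) * measure ?M (space ?M)
          \<le> ip B (\<lambda>x. s i x - s j x) (\<lambda>x. s i x - s j x) * K"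
        by (intro mult_left_mono ip_nonneg) (simp add: K_def)
      also have "\<dots> < e\<^sup>2 / K * K"
        using N ij K by (intro mult_strict_right_mono) auto
      finally have "(LINT x|?M. d x)\<^sup>2 < e\<^sup>2" using K by simp
      then show "(LINT x|?M. norm (s i x - s j x)) < e"
        using e by (simp add: d_def power_less_imp_less_base)
    qed
  qed blast
  define g where "g = (\<lambda>x. lim (\<lambda>i. s (r i) x))"
  have lim: "AE x in ?M. (\<lambda>i. s (r i) x) \<longlonglongrightarrow> g x"
    using r(2) by eventually_elim (simp add: g_def Cauchy_convergent_iff convergent_LIMSEQ_iff)
  have gm[measurable]: "g \<in> borel_measurable ?M"
    unfolding g_def using L2_measurable[OF s] by (intro borel_measurable_lim_metric)
  have sm[measurable]: "s n \<in> borel_measurable ?M" for n using L2_measurable[OF s] .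
  have fatou: "(\<integral>\<^sup>+x. ennreal ((norm (g x - s n x))\<^sup>2) \<partial>?M) \<le> ennreal e"
    if "\<And>j. j \<ge> N \<Longrightarrow> ip B (\<lambda>x. s j x - s n x) (\<lambda>x. s j x - s n x) \<le> e" for n e N
  proof -
    have "(\<integral>\<^sup>+x. ennreal ((norm (g x - s n x))\<^sup>2) \<partial>?M)
        = (\<integral>\<^sup>+x. liminf (\<lambda>i. ennreal ((norm (s (r i) x - s n x))\<^sup>2)) \<partial>?M)"
    proof (rule nn_integral_cong_AE, use lim in eventually_elim)
      fix x assume "(\<lambda>i. s (r i) x) \<longlonglongrightarrow> g x"
      then have "(\<lambda>i. ennreal ((norm (s (r i) x - s n x))\<^sup>2)) \<longlonglongrightarrow> ennreal ((norm (g x - s n x))\<^sup>2)"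
        by (intro tendsto_intros)
      then show "ennreal ((norm (g x - s n x))\<^sup>2) = liminf (\<lambda>i. ennreal ((norm (s (r i) x - s n x))\<^sup>2))"
        by (rule lim_imp_Liminf[OF sequentially_bot, symmetric])
    qed
    also have "\<dots> \<le> liminf (\<lambda>i. \<integral>\<^sup>+x. ennreal ((norm (s (r i) x - s n x))\<^sup>2) \<partial>?M)"
      by (rule nn_integral_liminf) measurable
    also have "\<dots> \<le> liminf (\<lambda>i. ennreal e)"
    proof (rule Liminf_mono)
      show "\<forall>\<^sub>F i in sequentially. (\<integral>\<^sup>+x. ennreal ((norm (s (r i) x - s n x))\<^sup>2) \<partial>?M) \<le> ennreal e"
      proof (rule eventually_sequentiallyI[of N])
        fix i assume "i \<ge> N"
        then have "r i \<ge> N" using seq_suble[OF r(1), of i] by simp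
        then have "ip B (\<lambda>x. s (r i) x - s n x) (\<lambda>x. s (r i) x - s n x) \<le> e" by (rule that)
        then show "(\<integral>\<^sup>+x. ennreal ((norm (s (r i) x - s n x))\<^sup>2) \<partial>?M) \<le> ennreal e"
          using L2_integrable[OF L2_diff[OF s s], of "r i" n]
          by (subst nn_integral_eq_integral) (auto simp: ip_def dot_square_norm intro!: ennreal_leI)
      qed
    qed
    also have "\<dots> = ennreal e" by (simp add: Liminf_const)
    finally show ?thesis .
  qed
  have gL: "g \<in> L2 B"
  proof -
    obtain N where N: "\<forall>i\<ge>N. \<forall>j\<ge>N. ip B (\<lambda>x. s i x - s j x) (\<lambda>x. s i x - s j x) < 1"
      using cauchy[of 1] by auto
    have "(\<integral>\<^sup>+x. ennreal ((norm (g x - s N x))\<^sup>2) \<partial>?M) \<le> ennreal 1"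
      by (rule fatou[of N]) (use N in \<open>auto intro: less_imp_le\<close>)
    then have "(\<integral>\<^sup>+x. ennreal ((norm (g x - s N x))\<^sup>2) \<partial>?M) < \<infinity>"
      using le_less_trans by fastforce
    then have "integrable ?M (\<lambda>x. (norm (g x - s N x))\<^sup>2)"
      by (intro integrableI_bounded) auto
    then have "(\<lambda>x. g x - s N x) \<in> L2 B" by (simp add: L2_def)
    from L2_add[OF this s[of N]] show ?thesis by simp
  qed
  have "(\<lambda>n. ip B (\<lambda>x. g x - s n x) (\<lambda>x. g x - s n x)) \<longlonglongrightarrow> 0"
  proof (rule LIMSEQ_I)
    fix e :: real assume e: "e > 0"
    obtain N where N: "\<forall>i\<ge>N. \<forall>j\<ge>N. ip B (\<lambda>x. s i x - s j x) (\<lambda>x. s i x - s j x) < e / 2"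
      using cauchy[of "e / 2"] e by auto
    have "norm (ip B (\<lambda>x. g x - s n x) (\<lambda>x. g x - s n x) - 0) < e" if n: "n \<ge> N" for n
    proof -
      have "(\<integral>\<^sup>+x. ennreal ((norm (g x - s n x))\<^sup>2) \<partial>?M) \<le> ennreal (e / 2)"
        by (rule fatou[of N]) (use N n in \<open>auto intro: less_imp_le\<close>)
      then have "ip B (\<lambda>x. g x - s n x) (\<lambda>x. g x - s n x) \<le> e / 2"
        using L2_integrable[OF L2_diff[OF gL s], of n] e
        by (subst (asm) nn_integral_eq_integral) (auto simp: ip_def dot_square_norm)
      then show ?thesis using e ip_nonneg[of B "\<lambda>x. g x - s n x"] by simp
    qed
    then show "\<exists>no. \<forall>n\<ge>no. norm (ip B (\<lambda>x. g x - s n x) (\<lambda>x. g x - s n x) - 0) < e" by blast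
  qed
  with gL show thesis by (rule that)
qed

lemma ip_orthogonal_sum:
  assumes e: "\<And>j. e j \<in> L2 B" and orth: "\<And>i j. i \<noteq> j \<Longrightarrow> ip B (e i) (e j) = 0" and I: "finite I"
  shows "ip B (\<lambda>x. \<Sum>j\<in>I. c j *\<^sub>R e j x) (\<lambda>x. \<Sum>j\<in>I. c j *\<^sub>R e j x) = (\<Sum>j\<in>I. (c j)\<^sup>2 * ip B (e j) (e j))"
proof -
  have "ip B (\<lambda>x. \<Sum>j\<in>I. c j *\<^sub>R e j x) (\<lambda>x. \<Sum>j\<in>I. c j *\<^sub>R e j x)
      = (\<Sum>i\<in>I. \<Sum>j\<in>I. c i * (c j * ip B (e i) (e j)))"
    by (simp add: ip_sum_left ip_sum_right L2_sum L2_scale e ip_scale_left ip_scale_right)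
       (simp add: sum_distrib_left sum_distrib_right mult.assoc mult.left_commute)
  also have "\<dots> = (\<Sum>i\<in>I. \<Sum>j\<in>I. if i = j then (c i)\<^sup>2 * ip B (e i) (e i) else 0)"
    by (intro sum.cong refl) (auto simp: orth power2_eq_square)
  also have "\<dots> = (\<Sum>j\<in>I. (c j)\<^sup>2 * ip B (e j) (e j))"
    using I by simp
  finally show ?thesis .
qed

text \<open>Orthogonality with bounded norms is enough, because differences of partial sums are
  controlled by blocks of the coefficient series. The fields are normalised, but their potentials,
  to which this applies as well, are only orthogonal.\<close>

lemma Riesz_Fischer:
  fixes e :: "nat \<Rightarrow> real^3 \<Rightarrow> 'b::euclidean_space"
  assumes B: "B \<in> lmeasurable" and e: "\<And>j. e j \<in> L2 B"
    and orth: "\<And>i j. i \<noteq> j \<Longrightarrow> ip B (e i) (e j) = 0"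
    and bd: "\<And>j. ip B (e j) (e j) \<le> K" and c: "summable (\<lambda>j. (c j)\<^sup>2)"
  obtains g where "g \<in> L2 B"
    "(\<lambda>n. ip B (\<lambda>x. g x - (\<Sum>j<n. c j *\<^sub>R e j x)) (\<lambda>x. g x - (\<Sum>j<n. c j *\<^sub>R e j x))) \<longlonglongrightarrow> 0"
proof (rule L2_complete[OF B, of "\<lambda>n x. \<Sum>j<n. c j *\<^sub>R e j x"])
  show "(\<lambda>x. \<Sum>j<n. c j *\<^sub>R e j x) \<in> L2 B" for n by (intro L2_sum L2_scale e)
  fix eps :: real assume eps: "eps > 0"
  have sb: "summable (\<lambda>j. (c j)\<^sup>2 * ip B (e j) (e j))"
  proof (rule summable_comparison_test'[of "\<lambda>j. (c j)\<^sup>2 * K" 0])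
    show "summable (\<lambda>j. (c j)\<^sup>2 * K)" using c by (rule summable_mult2)
    show "norm ((c n)\<^sup>2 * ip B (e n) (e n)) \<le> (c n)\<^sup>2 * K" for n
      by (simp add: bd ip_nonneg mult_left_mono)
  qed
  obtain N where N: "\<And>m n. m \<ge> N \<Longrightarrow> norm (\<Sum>j=m..<n. (c j)\<^sup>2 * ip B (e j) (e j)) < eps"
    using sb[unfolded summable_Cauchy] eps by blast
  have le: "ip B (\<lambda>x. (\<Sum>k<j. c k *\<^sub>R e k x) - (\<Sum>k<i. c k *\<^sub>R e k x))
             (\<lambda>x. (\<Sum>k<j. c k *\<^sub>R e k x) - (\<Sum>k<i. c k *\<^sub>R e k x)) < eps"
    if "i \<ge> N" "i \<le> j" for i j
  proof -
    have "(\<Sum>k<j. c k *\<^sub>R e k x) - (\<Sum>k<i. c k *\<^sub>R e k x) = (\<Sum>k=i..<j. c k *\<^sub>R e k x)" for x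
      using sum_diff_nat_ivl[of 0 i j "\<lambda>k. c k *\<^sub>R e k x"] that by (simp add: atLeast0LessThan)
    then show ?thesis
      using N[OF that(1), of j] by (simp add: ip_orthogonal_sum[OF e orth])
  qed
  have sym: "ip B (\<lambda>x. u x - v x) (\<lambda>x. u x - v x) = ip B (\<lambda>x. v x - u x) (\<lambda>x. v x - u x)"
    for u v :: "real^3 \<Rightarrow> 'b"
    by (simp add: ip_def dot_square_norm norm_minus_commute)
  show "\<exists>N. \<forall>i\<ge>N. \<forall>j\<ge>N. ip B (\<lambda>x. (\<Sum>j<i. c j *\<^sub>R e j x) - (\<Sum>ja<j. c ja *\<^sub>R e ja x))
                (\<lambda>x. (\<Sum>j<i. c j *\<^sub>R e j x) - (\<Sum>ja<j. c ja *\<^sub>R e ja x)) < eps"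
  proof (intro exI[of _ N] allI impI)
    fix i j assume "i \<ge> N" "j \<ge> N"
    then show "ip B (\<lambda>x. (\<Sum>j<i. c j *\<^sub>R e j x) - (\<Sum>ja<j. c ja *\<^sub>R e ja x))
                (\<lambda>x. (\<Sum>j<i. c j *\<^sub>R e j x) - (\<Sum>ja<j. c ja *\<^sub>R e ja x)) < eps"
      using le[of i j] le[of j i] by (cases "i \<le> j") (simp_all add: sym[of "\<lambda>x. \<Sum>k<i. c k *\<^sub>R e k x"])
  qed
qed (use that in blast)

lemma Bessel:
  assumes e: "\<And>j. j \<in> I \<Longrightarrow> e j \<in> L2 B" and u: "u \<in> L2 B" and I: "finite I"
    and orth: "\<And>i j. i \<in> I \<Longrightarrow> j \<in> I \<Longrightarrow> ip B (e i) (e j) = (if i = j then 1 else 0)"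
  shows "(\<Sum>j\<in>I. (ip B u (e j))\<^sup>2) \<le> ip B u u"
proof -
  define p where "p = (\<lambda>x. \<Sum>j\<in>I. ip B u (e j) *\<^sub>R e j x)"
  have pL: "p \<in> L2 B" unfolding p_def by (intro L2_sum L2_scale e)
  have pe: "ip B p (e i) = ip B u (e i)" if "i \<in> I" for i
  proof -
    have "ip B p (e i) = (\<Sum>j\<in>I. ip B u (e j) * ip B (e j) (e i))"
      unfolding p_def by (subst ip_sum_left) (auto intro: L2_scale e that simp: ip_scale_left)
    also have "\<dots> = (\<Sum>j\<in>I. if j = i then ip B u (e j) else 0)"
      by (intro sum.cong refl) (simp add: orth that)
    finally show ?thesis using I that by simp
  qed
  have up: "ip B u p = (\<Sum>j\<in>I. (ip B u (e j))\<^sup>2)"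
    unfolding p_def by (subst ip_sum_right) (auto intro: L2_scale e u simp: ip_scale_right power2_eq_square)
  have "ip B p p = (\<Sum>j\<in>I. ip B u (e j) * ip B p (e j))"
    by (subst (2) p_def, subst ip_sum_right) (auto intro: L2_scale e pL simp: ip_scale_right)
  also have "\<dots> = (\<Sum>j\<in>I. (ip B u (e j))\<^sup>2)"
    by (intro sum.cong refl) (simp add: pe power2_eq_square)
  finally have pp: "ip B p p = (\<Sum>j\<in>I. (ip B u (e j))\<^sup>2)" .
  have "0 \<le> ip B (\<lambda>x. u x - p x) (\<lambda>x. u x - p x)" by (rule ip_nonneg)
  also have "\<dots> = ip B u u - (\<Sum>j\<in>I. (ip B u (e j))\<^sup>2)"
    using u pL up pp by (simp add: ip_diff_left ip_diff_right L2_diff ip_commute[of B p u])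
  finally show ?thesis by simp
qed

section \<open>The divergence theorem on a ball\<close>

text \<open>Continuous differentiability up to the boundary, with the gradient as an argument.
  Differentiability is asked for only inside; continuity of G on the closed ball extends the
  gradient to the sphere. Divergences are then traces of families of such gradients.\<close>

definition C1 :: "real^3 \<Rightarrow> real \<Rightarrow> (real^3 \<Rightarrow> real) \<Rightarrow> (real^3 \<Rightarrow> real^3) \<Rightarrow> bool" where
  "C1 c R f G \<longleftrightarrow> continuous_on (cball c R) f \<and> continuous_on (cball c R) G \<and>
     (\<forall>x\<in>ball c R. (f has_derivative (\<lambda>h. G x \<bullet> h)) (at x))"

lemma C1_mult:
  assumes "C1 c R f F" "C1 c R g G"
  shows "C1 c R (\<lambda>x. f x * g x) (\<lambda>x. f x *\<^sub>R G x + g x *\<^sub>R F x)"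
  using assms unfolding C1_def
  by (auto intro!: continuous_intros derivative_eq_intros simp: inner_add_left algebra_simps)

lemma C1_scale: "C1 c R f F \<Longrightarrow> C1 c R (\<lambda>x. a * f x) (\<lambda>x. a *\<^sub>R F x)"
  unfolding C1_def by (auto intro!: continuous_intros derivative_eq_intros)

lemma C1_component: "C1 c R (\<lambda>x. (x - a) $ i) (\<lambda>x. axis i 1)"
  unfolding C1_def
  by (auto intro!: continuous_intros derivative_eq_intros bounded_linear_imp_has_derivative
      bounded_linear_vec_nth simp: inner_axis')

lemma integrable_ball_continuous:
  fixes f :: "real^3 \<Rightarrow> 'b::euclidean_space"
  assumes "continuous_on (cball c R) f"
  shows "integrable (lebesgue_on (ball c R)) f"
proof -
  interpret finite_measure "lebesgue_on (ball c R)"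
    by (simp add: finite_measure_lebesgue_on)
  have "compact (f ` cball c R)" using assms by (intro compact_continuous_image) auto
  then obtain M where M: "\<And>x. x \<in> cball c R \<Longrightarrow> norm (f x) \<le> M"
    using compact_imp_bounded bounded_iff by (metis imageI)
  show ?thesis
  proof (rule integrable_const_bound[of _ M])
    show "AE x in lebesgue_on (ball c R). norm (f x) \<le> M"
      by (intro AE_I2) (use M in auto)
    show "f \<in> borel_measurable (lebesgue_on (ball c R))"
      by (rule continuous_imp_measurable_on_sets_lebesgue)
         (use assms ball_subset_cball continuous_on_subset in blast, simp)
  qed
qed

lemma L2_ball_continuous:
  fixes f :: "real^3 \<Rightarrow> 'b::euclidean_space"
  assumes "continuous_on (cball c R) f"
  shows "f \<in> L2 (ball c R)"
  unfolding L2_def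
  using integrable_ball_continuous[OF assms]
  by (auto intro!: integrable_ball_continuous continuous_intros assms)

text \<open>The mean value inequality applies on the open ball, which is convex; continuity carries
  the bound to the closed ball.\<close>

lemma C1_lipschitz:
  assumes "C1 c R f G" and L: "\<And>x. x \<in> cball c R \<Longrightarrow> norm (G x) \<le> L" and R: "R > 0" and "L \<ge> 0"
  shows "L-lipschitz_on (cball c R) f"
proof -
  have "L-lipschitz_on (ball c R) f"
  proof (rule lipschitz_onI)
    fix x y assume xy: "x \<in> ball c R" "y \<in> ball c R"
    have "norm (f x - f y) \<le> L * norm (x - y)"
    proof (rule differentiable_bound[of "ball c R" f "\<lambda>x h. G x \<bullet> h"])
      show "(f has_derivative (\<lambda>h. G z \<bullet> h)) (at z within ball c R)" if "z \<in> ball c R" for z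
        using assms(1) that by (auto simp: C1_def intro: has_derivative_at_withinI)
      show "onorm (\<lambda>h. G z \<bullet> h) \<le> L" if "z \<in> ball c R" for z
      proof (rule onorm_le)
        fix h
        have "norm (G z \<bullet> h) \<le> norm (G z) * norm h" by (simp add: Cauchy_Schwarz_ineq2)
        also have "\<dots> \<le> L * norm h" using L[of z] that by (intro mult_right_mono) auto
        finally show "norm (G z \<bullet> h) \<le> L * norm h" .
      qed
    qed (use xy in auto)
    then show "dist (f x) (f y) \<le> L * dist x y" by (simp add: dist_norm)
  qed (use assms in simp)
  then have "L-lipschitz_on (closure (ball c R)) f"
    by (rule lipschitz_on_closure) (use assms(1) R in \<open>simp add: C1_def\<close>)
  then show ?thesis using R by simp
qed

text \<open>The integral of a difference quotient of the extension of \<^term>\<open>f\<close> by zero vanishes by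
  translation invariance; the extension is Lipschitz, so the limit may be taken under the integral.\<close>

lemma integral_gradient_zero_boundary:
  fixes a :: "real^3"
  assumes f: "C1 c R f G" and R: "R > 0" and z: "\<And>x. x \<in> sphere c R \<Longrightarrow> f x = 0"
  shows "(LINT x|lebesgue_on (ball c R). G x \<bullet> a) = 0"
proof -
  have cf: "continuous_on (cball c R) f" and cG: "continuous_on (cball c R) G"
    and d: "\<And>x. x \<in> ball c R \<Longrightarrow> (f has_derivative (\<lambda>h. G x \<bullet> h)) (at x)"
    using f by (auto simp: C1_def)
  have "compact (G ` cball c R)" using cG by (intro compact_continuous_image) auto
  then obtain L0 where L0: "\<And>x. x \<in> cball c R \<Longrightarrow> norm (G x) \<le> L0"
    using compact_imp_bounded bounded_iff by (metis imageI)
  define L where "L = max L0 0"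
  have L: "L \<ge> 0" "\<And>x. x \<in> cball c R \<Longrightarrow> norm (G x) \<le> L"
    using L0 by (auto simp: L_def intro: max.coboundedI1)
  have lip: "L-lipschitz_on (cball c R) f"
    using C1_lipschitz[OF f L(2) R L(1)] by simp
  define E where "E = (\<lambda>x. if x \<in> cball c R then f x else 0)"
  have E1: "\<bar>E x - E y\<bar> \<le> L * norm (x - y)" if x: "x \<in> cball c R" for x y
  proof (cases "y \<in> cball c R")
    case True
    then show ?thesis
      using lipschitz_onD[OF lip x True] x by (simp add: E_def dist_norm)
  next
    case False
    \<comment> \<open>The segment from x to the outer point y meets the sphere in some w, where f
      vanishes, and |x - w| \<le> |x - y|.\<close>
    have "closed_segment x y \<inter> frontier (cball c R) \<noteq> {}"
      by (rule connected_Int_frontier) (use x False in auto)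
    then obtain w where w: "w \<in> closed_segment x y" "w \<in> sphere c R"
      by (metis Int_iff ex_in_conv frontier_cball)
    have "\<bar>E x - E y\<bar> = \<bar>f x - f w\<bar>" using x False z[OF w(2)] by (simp add: E_def)
    also have "\<dots> \<le> L * norm (x - w)"
      using lipschitz_onD[OF lip x, of w] w(2) by (simp add: dist_norm)
    also have "\<dots> \<le> L * norm (x - y)"
      using segment_bound1[OF w(1)] L(1) by (intro mult_left_mono) (auto simp: norm_minus_commute)
    finally show ?thesis .
  qed
  have E2: "\<bar>E x - E y\<bar> \<le> L * norm (x - y)" for x y
  proof (cases "x \<in> cball c R")
    case False
    show ?thesis
    proof (cases "y \<in> cball c R")
      case True
      from E1[OF this, of x] show ?thesis by (simp add: norm_minus_commute abs_minus_commute)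
    qed (use False L(1) in \<open>simp add: E_def\<close>)
  qed (rule E1)
  have "L-lipschitz_on UNIV E"
    by (rule lipschitz_onI) (use E2 L(1) in \<open>auto simp: dist_norm\<close>)
  then have contE: "continuous_on UNIV E" by (rule lipschitz_on_continuous_on)
  have mE[measurable]: "E \<in> borel_measurable borel"
    using contE by (rule borel_measurable_continuous_onI)
  have intE: "integrable lborel E"
  proof -
    have "integrable lborel (\<lambda>x. indicator (cball c R) x *\<^sub>R E x)"
      using borel_integrable_compact[of "cball c R" E] contE
      by (auto simp: continuous_on_subset)
    also have "(\<lambda>x. indicator (cball c R) x *\<^sub>R E x) = E"
      by (auto simp: E_def fun_eq_iff indicator_def)
    finally show ?thesis .
  qed
  have mG: "(\<lambda>x. indicator (ball c R) x *\<^sub>R (G x \<bullet> a)) \<in> borel_measurable lborel"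
  proof -
    have "continuous_on (ball c R) (\<lambda>x. G x \<bullet> a)"
      using continuous_on_subset[OF cG ball_subset_cball] by (intro continuous_intros)
    then show ?thesis
      using borel_measurable_continuous_on_indicator[of "ball c R" "\<lambda>x. G x \<bullet> a"] by simp
  qed
  define u where "u = (\<lambda>n x. (E (inverse (real (Suc n)) *\<^sub>R a + x) - E x) * real (Suc n))"
  have u0: "(LINT x|lborel. u n x) = 0" for n
  proof -
    let ?b = "inverse (real (Suc n)) *\<^sub>R a"
    have i: "integrable lborel (\<lambda>x. E (?b + x))"
      using intE integrable_distr_eq[of "(+) ?b" lborel borel E]
      by (simp add: lborel_distr_plus)
    have "(LINT x|lborel. E (?b + x)) = (LINT x|lborel. E x)"
      using integral_distr[of "(+) ?b" lborel borel E] by (simp add: lborel_distr_plus)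
    then show ?thesis unfolding u_def using i intE by simp
  qed
  have lim: "(\<lambda>n. LINT x|lborel. u n x) \<longlonglongrightarrow> (LINT x|lborel. indicator (ball c R) x *\<^sub>R (G x \<bullet> a))"
  \<comment> \<open>The Lipschitz bound gives |u n| \<le> L |a|. The shifts have length at most |a|,
    so \<open>u n\<close> vanishes outside the ball of radius R + |a|.\<close>
  proof (rule integral_dominated_convergence[where w="\<lambda>x. indicator (cball c (R + norm a)) x *\<^sub>R (L * norm a)"])
    show "(\<lambda>x. indicator (ball c R) x *\<^sub>R (G x \<bullet> a)) \<in> borel_measurable lborel" by (rule mG)
    show "u n \<in> borel_measurable lborel" for n unfolding u_def by measurable
    show "integrable lborel (\<lambda>x. indicator (cball c (R + norm a)) x *\<^sub>R (L * norm a))"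
      using borel_integrable_compact[of "cball c (R + norm a)" "\<lambda>_. L * norm a"] by simp
    have "sphere c R \<in> null_sets lborel"
      using negligible_sphere[of c R] by (auto simp: negligible_iff_null_sets null_sets_completion_iff)
    then show "AE x in lborel. (\<lambda>n. u n x) \<longlonglongrightarrow> indicator (ball c R) x *\<^sub>R (G x \<bullet> a)"
    proof (rule AE_mp[OF AE_not_in], intro AE_I2 impI)
      fix x assume x: "x \<notin> sphere c R"
      have t0: "(\<lambda>n. inverse (real (Suc n))) \<longlonglongrightarrow> 0" by (rule LIMSEQ_inverse_real_of_nat)
      have path: "(\<lambda>n. inverse (real (Suc n)) *\<^sub>R a + x) \<longlonglongrightarrow> x"
        using tendsto_add[OF tendsto_scaleR[OF t0 tendsto_const[of a]] tendsto_const[of x]] by simp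
      show "(\<lambda>n. u n x) \<longlonglongrightarrow> indicator (ball c R) x *\<^sub>R (G x \<bullet> a)"
      proof (cases "x \<in> ball c R")
        case True
        have "((\<lambda>t. f (x + t *\<^sub>R a)) has_derivative (\<lambda>t. G x \<bullet> (t *\<^sub>R a))) (at 0)"
        proof (rule has_derivative_compose[where g=f and f="\<lambda>t. x + t *\<^sub>R a", simplified])
          show "(f has_derivative (\<lambda>h. G x \<bullet> h)) (at (x + 0 *\<^sub>R a))" using d[OF True] by simp
        qed (auto intro!: derivative_eq_intros)
        then have "((\<lambda>t. f (x + t *\<^sub>R a)) has_real_derivative (G x \<bullet> a)) (at 0)"
          by (simp add: has_field_derivative_def mult_commute_abs)
        then have D: "((\<lambda>t. (f (x + t *\<^sub>R a) - f x) / t) \<longlongrightarrow> G x \<bullet> a) (at 0)"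
          by (simp add: DERIV_def)
        have "((\<lambda>n. (f (x + inverse (real (Suc n)) *\<^sub>R a) - f x) / inverse (real (Suc n))) \<longlonglongrightarrow> G x \<bullet> a)"
          by (rule filterlim_compose[OF D])
             (use t0 in \<open>auto simp: filterlim_at simp del: of_nat_Suc\<close>)
        moreover have "\<forall>\<^sub>F n in sequentially. (f (x + inverse (real (Suc n)) *\<^sub>R a) - f x) / inverse (real (Suc n)) = u n x"
        proof -
          have "\<forall>\<^sub>F n in sequentially. inverse (real (Suc n)) *\<^sub>R a + x \<in> ball c R"
            by (rule topological_tendstoD[OF path open_ball True])
          then show ?thesis
          proof eventually_elim
            case (elim n)
            then show ?case using True
              unfolding u_def E_def by (simp add: add.commute divide_inverse del: of_nat_Suc)
          qed
        qed
        ultimately show ?thesis using True by (auto elim: Lim_transform_eventually)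
      next
        case False
        then have xo: "x \<in> - cball c R" using x by auto
        have "\<forall>\<^sub>F n in sequentially. inverse (real (Suc n)) *\<^sub>R a + x \<in> - cball c R"
          using path xo by (intro topological_tendstoD) auto
        then have "\<forall>\<^sub>F n in sequentially. 0 = u n x"
          by eventually_elim (use xo in \<open>auto simp: u_def E_def\<close>)
        then show ?thesis using False by (auto intro: Lim_transform_eventually[OF tendsto_const])
      qed
    qed
    show "AE x in lborel. norm (u n x) \<le> indicator (cball c (R + norm a)) x *\<^sub>R (L * norm a)" for n
    proof (intro AE_I2)
      fix x
      let ?b = "inverse (real (Suc n)) *\<^sub>R a"
      have nb: "norm ?b \<le> norm a"
        by (simp add: mult_left_le_one_le inverse_le_1_iff del: of_nat_Suc)
      show "norm (u n x) \<le> indicator (cball c (R + norm a)) x *\<^sub>R (L * norm a)"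
      proof (cases "x \<in> cball c (R + norm a)")
        case True
        have "norm (u n x) \<le> L * norm ?b * real (Suc n)"
          using E2[of "?b + x" x] unfolding u_def
          by (simp add: abs_mult mult_right_mono del: of_nat_Suc norm_scaleR)
        also have "\<dots> = L * norm a" by (simp add: field_simps)
        finally show ?thesis using True by simp
      next
        case False
        have "dist c x \<le> dist c (?b + x) + norm ?b"
          using dist_triangle[of c x "?b + x"] by (simp add: dist_norm)
        moreover have "dist c x > R + norm a" using False by simp
        ultimately have "dist c x > R" "dist c (?b + x) > R" using nb norm_ge_zero[of a] by linarith+
        then show ?thesis using False by (simp add: u_def E_def)
      qed
    qed
  qed
  have "(LINT x|lborel. indicator (ball c R) x *\<^sub>R (G x \<bullet> a)) = 0"
    using LIMSEQ_unique[OF lim] u0 by simp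
  moreover have "(LINT x|lebesgue_on (ball c R). G x \<bullet> a) = (LINT x|lborel. indicator (ball c R) x *\<^sub>R (G x \<bullet> a))"
  proof -
    show ?thesis using mG by (simp add: integral_restrict_space integral_completion)
  qed
  ultimately show ?thesis by simp
qed

lemma C1_cutoff:
  assumes R: "R > 0"
  shows "C1 c R (\<lambda>x. 1 - ((x - c) \<bullet> (x - c) / R\<^sup>2) ^ Suc k)
           (\<lambda>x. - (2 * real (Suc k) / R\<^sup>2 * ((x - c) \<bullet> (x - c) / R\<^sup>2) ^ k) *\<^sub>R (x - c))"
proof -
  have "((\<lambda>x. 1 - ((x - c) \<bullet> (x - c) / R\<^sup>2) ^ Suc k) has_derivative
      (\<lambda>h. - (2 * real (Suc k) / R\<^sup>2 * ((x - c) \<bullet> (x - c) / R\<^sup>2) ^ k) *\<^sub>R (x - c) \<bullet> h)) (at x)" for x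
  proof -
    have 1: "((\<lambda>x. (x - c) \<bullet> (x - c) / R\<^sup>2) has_derivative (\<lambda>h. 2 * ((x - c) \<bullet> h) / R\<^sup>2)) (at x)"
      using R by (auto intro!: derivative_eq_intros simp: inner_commute fun_eq_iff power2_eq_square power4_eq_xxxx)
    show ?thesis
      by (rule derivative_eq_intros 1 refl)+ (simp add: fun_eq_iff divide_inverse mult_ac)
  qed
  moreover have "R\<^sup>2 \<noteq> 0" using R by simp
  ultimately show ?thesis
    unfolding C1_def by (intro conjI ballI continuous_intros) (assumption | rule refl)+
qed

text \<open>This is div (u X) = u div X + grad u . X at a point, where \<open>G i\<close> is the
  gradient of the i-th component of X and -w y is the gradient of u.\<close>

lemma trace_product_rule:
  fixes G :: "'n::finite \<Rightarrow> real^'n"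
  shows "(\<Sum>i\<in>UNIV. (u *\<^sub>R G i + X $ i *\<^sub>R (- w *\<^sub>R y)) \<bullet> axis i 1) = u * (\<Sum>i\<in>UNIV. G i $ i) - w * (y \<bullet> X)"
proof -
  have "(\<Sum>i\<in>UNIV. (u *\<^sub>R G i + X $ i *\<^sub>R (- w *\<^sub>R y)) \<bullet> axis i 1) = (\<Sum>i\<in>UNIV. u * G i $ i - w * (y $ i * X $ i))"
    by (simp add: inner_axis mult_ac)
  then show ?thesis by (simp add: sum_subtractf sum_distrib_left inner_vec_def)
qed

text \<open>The cutoff u vanishes on the sphere, so each partial derivative of u X_i has integral
  zero. Summed over i, the term with grad u becomes the right side: the radial component of X
  against a weight that grows near the sphere.\<close>

lemma cutoff_identity:
  assumes R: "R > 0" and X: "\<And>i. C1 c R (\<lambda>x. X x $ i) (G i)"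
  shows "(LINT x|lebesgue_on (ball c R). (1 - ((x - c) \<bullet> (x - c) / R\<^sup>2) ^ Suc k) * (\<Sum>i\<in>UNIV. G i x $ i))
       = (LINT x|lebesgue_on (ball c R). 2 * real (Suc k) / R\<^sup>2 * ((x - c) \<bullet> (x - c) / R\<^sup>2) ^ k * ((x - c) \<bullet> X x))"
    (is "(LINT x|?M. ?u x * ?d x) = (LINT x|?M. ?w x * _ x)")
proof -
  have cG: "continuous_on (cball c R) (G i)" and cX: "continuous_on (cball c R) (\<lambda>x. X x $ i)" for i
    using X[of i] by (auto simp: C1_def)
  have cX': "continuous_on (cball c R) X"
    using cX by (subst continuous_on_componentwise)
      (auto simp: Basis_vec_def inner_axis)
  have 0: "(LINT x|?M. (?u x *\<^sub>R G i x + X x $ i *\<^sub>R (- ?w x *\<^sub>R (x - c))) \<bullet> axis i 1) = 0" for i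
  proof (rule integral_gradient_zero_boundary[OF C1_mult[OF C1_cutoff[OF R] X] R])
    fix x assume "x \<in> sphere c R"
    then have "(x - c) \<bullet> (x - c) = R\<^sup>2"
      by (simp add: dot_square_norm dist_norm norm_minus_commute)
    then show "?u x * X x $ i = 0" using R by simp
  qed
  have ci: "integrable ?M (\<lambda>x. (?u x *\<^sub>R G i x + X x $ i *\<^sub>R (- ?w x *\<^sub>R (x - c))) \<bullet> axis i 1)" for i
    by (intro integrable_ball_continuous continuous_intros cG cX) (use R in simp_all)
  have "0 = (\<Sum>i\<in>UNIV. (LINT x|?M. (?u x *\<^sub>R G i x + X x $ i *\<^sub>R (- ?w x *\<^sub>R (x - c))) \<bullet> axis i 1))"
    by (simp only: 0 sum.neutral_const)
  also have "\<dots> = (LINT x|?M. (\<Sum>i\<in>UNIV. (?u x *\<^sub>R G i x + X x $ i *\<^sub>R (- ?w x *\<^sub>R (x - c))) \<bullet> axis i 1))"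
    by (rule Bochner_Integration.integral_sum[symmetric]) (rule ci)
  also have "\<dots> = (LINT x|?M. ?u x * ?d x - ?w x * ((x - c) \<bullet> X x))"
    by (simp only: trace_product_rule)
  also have "\<dots> = (LINT x|?M. ?u x * ?d x) - (LINT x|?M. ?w x * ((x - c) \<bullet> X x))"
    by (intro Bochner_Integration.integral_diff integrable_ball_continuous continuous_intros cG cX')
       (use R in simp_all)
  finally show ?thesis by simp
qed

text \<open>Since r \<le> 1, n r^n is at most the geometric sum 1 + r + ... + r^(n-1), and that sum
  times 1 - r is 1 - r^n. The constant bound serves as a dominating function for the mass away from
  the sphere.\<close>

lemma weight_bounds:
  fixes r :: real
  assumes "0 \<le> r" "r \<le> 1"
  shows "real n * r ^ n * (1 - r) \<le> 1"
proof -
  have "real n * r ^ n = (\<Sum>i<n. r ^ n)" by simp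
  also have "\<dots> \<le> (\<Sum>i<n. r ^ i)" using assms by (intro sum_mono power_decreasing) auto
  finally have "real n * r ^ n * (1 - r) \<le> (\<Sum>i<n. r ^ i) * (1 - r)"
    using assms by (intro mult_right_mono) auto
  also have "\<dots> = 1 - r ^ n" by (simp add: one_diff_power_eq mult.commute)
  also have "\<dots> \<le> 1" using assms by simp
  finally show ?thesis .
qed

text \<open>On the compact set where |Y| \<ge> e, which avoids the sphere, the function 1 - |x -
  c|^2 / R^2 has a positive minimum, so a large multiple of it dominates |Y| there.\<close>

lemma continuous_small_at_sphere:
  assumes Y: "continuous_on (cball c R) (Y :: real^3 \<Rightarrow> real)" and z: "\<And>x. x \<in> sphere c R \<Longrightarrow> Y x = 0"
    and R: "R > 0" and e: "e > 0"
  obtains C where "C \<ge> 0" "\<And>x. x \<in> cball c R \<Longrightarrow> \<bar>Y x\<bar> \<le> e + C * (1 - (x - c) \<bullet> (x - c) / R\<^sup>2)"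
proof -
  define K where "K = {x \<in> cball c R. e \<le> \<bar>Y x\<bar>}"
  define t where "t = (\<lambda>x. 1 - (x - c) \<bullet> (x - c) / R\<^sup>2)"
  have ct: "continuous_on S t" for S
    unfolding t_def by (intro continuous_intros) (use R in simp)
  have t_nonneg: "t x \<ge> 0" if "x \<in> cball c R" for x
  proof -
    have "(norm (x - c))\<^sup>2 \<le> R\<^sup>2" using that by (intro power_mono) (auto simp: dist_norm norm_minus_commute)
    then show ?thesis using R by (simp add: t_def dot_square_norm)
  qed
  have "closed K"
  proof -
    have "K = cball c R \<inter> (\<lambda>x. \<bar>Y x\<bar>) -` {e..}" by (auto simp: K_def)
    then show ?thesis
      using continuous_closed_preimage[of "cball c R" "\<lambda>x. \<bar>Y x\<bar>" "{e..}"] Y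
      by (simp add: continuous_on_rabs)
  qed
  then have K: "compact K"
    using compact_Int_closed[of "cball c R" K] by (simp add: K_def Int_def conj_ac)
  show thesis
  proof (cases "K = {}")
    case True
    then have "\<bar>Y x\<bar> \<le> e + 0 * t x" if "x \<in> cball c R" for x
      using that by (force simp: K_def)
    then show thesis unfolding t_def using that[of 0] by simp
  next
    case False
    obtain x0 where x0: "x0 \<in> K" "\<And>x. x \<in> K \<Longrightarrow> t x0 \<le> t x"
      using continuous_attains_inf[OF K False ct] by blast
    have "(norm (x0 - c))\<^sup>2 < R\<^sup>2"
    proof -
      have "x0 \<notin> sphere c R" using z[of x0] x0(1) e by (auto simp: K_def)
      then have "norm (x0 - c) < R" using x0(1) by (auto simp: K_def dist_norm norm_minus_commute)
      then show ?thesis by (intro power_strict_mono) auto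
    qed
    then have t0: "t x0 > 0" using R by (simp add: t_def dot_square_norm)
    have "compact (Y ` cball c R)" using Y by (intro compact_continuous_image) auto
    then obtain M where M: "\<And>x. x \<in> cball c R \<Longrightarrow> \<bar>Y x\<bar> \<le> M"
      using compact_imp_bounded bounded_iff by (metis imageI real_norm_def)
    have M0: "M \<ge> 0" using M[of c] R by simp
    show thesis
    proof (rule that[of "M / t x0"])
      show "0 \<le> M / t x0" using M0 t0 by simp
      fix x assume x: "x \<in> cball c R"
      have "\<bar>Y x\<bar> \<le> e + M / t x0 * t x"
      proof (cases "x \<in> K")
        case True
        have "\<bar>Y x\<bar> \<le> M * 1" using M[OF x] by simp
        also have "\<dots> \<le> M * (t x / t x0)" using x0(2)[OF True] t0 M0 by (intro mult_left_mono) auto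
        finally show ?thesis using e by simp
      next
        case False
        then show ?thesis using x M0 t0 t_nonneg[OF x] by (simp add: K_def add_increasing2)
      qed
      then show "\<bar>Y x\<bar> \<le> e + M / t x0 * (1 - (x - c) \<bullet> (x - c) / R\<^sup>2)" by (simp add: t_def)
    qed
  qed
qed

text \<open>The weights \<^term>\<open>real n * \<rho> ^ n\<close> with \<open>\<rho> = |x - c|\<^sup>2 / R\<^sup>2\<close> have bounded mass, which concentrates at the
  sphere.  The bound on the mass is the cutoff identity for the field \<open>x - c\<close>.\<close>

theorem divergence_theorem_tangential:
  assumes R: "R > 0" and X: "\<And>i. C1 c R (\<lambda>x. X x $ i) (G i)"
    and tang: "\<And>x. x \<in> sphere c R \<Longrightarrow> (x - c) \<bullet> X x = 0"
  shows "(LINT x|lebesgue_on (ball c R). (\<Sum>i\<in>UNIV. G i x $ i)) = 0"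
proof -
  let ?M = "lebesgue_on (ball c R)"
  interpret finite_measure ?M by (simp add: finite_measure_lebesgue_on)
  define r where "r = (\<lambda>x. (x - c) \<bullet> (x - c) / R\<^sup>2)"
  define d where "d = (\<lambda>x. \<Sum>i\<in>UNIV. G i x $ i)"
  define Y where "Y = (\<lambda>x. (x - c) \<bullet> X x)"
  have cG: "continuous_on (cball c R) (G i)" and cX: "continuous_on (cball c R) (\<lambda>x. X x $ i)" for i
    using X[of i] by (auto simp: C1_def)
  have cX': "continuous_on (cball c R) X"
    using cX by (subst continuous_on_componentwise) (auto simp: Basis_vec_def inner_axis)
  have cr: "continuous_on S r" for S
    unfolding r_def by (intro continuous_intros) (use R in simp)
  have cY: "continuous_on (cball c R) Y" unfolding Y_def by (intro continuous_intros cX')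
  have cd: "continuous_on (cball c R) d" unfolding d_def by (intro continuous_intros cG)
  have r01: "0 \<le> r x" "r x < 1" if "x \<in> ball c R" for x
  proof -
    have "norm (x - c) < R" using that by (auto simp: dist_norm norm_minus_commute)
    then have "(norm (x - c))\<^sup>2 < R\<^sup>2" by (intro power_strict_mono) auto
    then show "0 \<le> r x" "r x < 1" using R by (simp_all add: r_def dot_square_norm)
  qed
  have int: "integrable ?M f" if "continuous_on (cball c R) f" for f :: "real^3 \<Rightarrow> real"
    using integrable_ball_continuous[OF that] .
  have id: "(LINT x|?M. (1 - r x ^ Suc k) * d x) = (LINT x|?M. 2 * real (Suc k) / R\<^sup>2 * r x ^ k * Y x)" for k
    using cutoff_identity[OF R X, of k] by (simp only: r_def d_def Y_def)
  have mass: "(LINT x|?M. real n * r x ^ n) \<le> 3 / 2 * measure ?M (space ?M)" for n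
  proof (cases n)
    case 0
    then show ?thesis by simp
  next
    case (Suc k)
    \<comment> \<open>The field x - c has divergence 3, so the left side of its cutoff identity is
      at most three times the volume, while the right side is twice the mass.\<close>
    have tr: "(\<Sum>i\<in>(UNIV::3 set). axis i 1 $ i) = (3::real)" by (simp add: axis_def)
    have "(LINT x|?M. (1 - r x ^ Suc k) * 3)
        = (LINT x|?M. 2 * real (Suc k) / R\<^sup>2 * r x ^ k * ((x - c) \<bullet> (x - c)))"
      using cutoff_identity[OF R C1_component[of c R c], of k]
      by (simp only: r_def tr)
    also have "\<dots> = (LINT x|?M. 2 * (real n * r x ^ n))"
      using R by (intro Bochner_Integration.integral_cong refl) (simp add: Suc r_def)
    also have "\<dots> = 2 * (LINT x|?M. real n * r x ^ n)" by simp
    finally have "2 * (LINT x|?M. real n * r x ^ n) = (LINT x|?M. (1 - r x ^ Suc k) * 3)" ..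
    also have "\<dots> \<le> (LINT x|?M. 3)"
      by (intro integral_mono int continuous_intros cr) (use r01 in \<open>simp\<close>)
    finally show ?thesis by simp
  qed
  \<comment> \<open>Cutoff exponents start at 2, so the weight on the other side has exponent n =
    Suc k \<ge> 1; this permits 2 (n + 1) \<le> 4 n below.\<close>
  have lhs: "(\<lambda>k. LINT x|?M. (1 - r x ^ Suc (Suc k)) * d x) \<longlonglongrightarrow> (LINT x|?M. d x)"
  proof (rule integral_dominated_convergence[where w="\<lambda>x. \<bar>d x\<bar>"])
    show "AE x in ?M. (\<lambda>k. (1 - r x ^ Suc (Suc k)) * d x) \<longlonglongrightarrow> d x"
    proof (intro AE_I2)
      fix x assume "x \<in> space ?M"
      then have x: "x \<in> ball c R" by simp
      have "(\<lambda>n. r x ^ n) \<longlonglongrightarrow> 0" using r01[OF x] by (intro LIMSEQ_realpow_zero) auto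
      then have "(\<lambda>k. r x ^ Suc (Suc k)) \<longlonglongrightarrow> 0" using LIMSEQ_ignore_initial_segment[of "\<lambda>n. r x ^ n" 0 2]
        by (simp add: numeral_2_eq_2 del: power_Suc)
      then have "(\<lambda>k. (1 - r x ^ Suc (Suc k)) * d x) \<longlonglongrightarrow> (1 - 0) * d x" by (intro tendsto_intros)
      then show "(\<lambda>k. (1 - r x ^ Suc (Suc k)) * d x) \<longlonglongrightarrow> d x" by simp
    qed
    show "AE x in ?M. norm ((1 - r x ^ Suc (Suc k)) * d x) \<le> \<bar>d x\<bar>" for k
    proof (intro AE_I2)
      fix x assume "x \<in> space ?M"
      then have x: "x \<in> ball c R" by simp
      have "0 \<le> r x ^ Suc (Suc k)" "r x ^ Suc (Suc k) \<le> 1"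
        using r01[OF x] by (auto intro: power_le_one simp del: power_Suc)
      then have "\<bar>1 - r x ^ Suc (Suc k)\<bar> \<le> 1" by linarith
      then show "norm ((1 - r x ^ Suc (Suc k)) * d x) \<le> \<bar>d x\<bar>"
        by (simp add: abs_mult mult_left_le_one_le del: power_Suc)
    qed
  qed (intro borel_measurable_integrable int continuous_intros cr cd)+
  have w0: "(\<lambda>n. LINT x|?M. real n * r x ^ n * (1 - r x)) \<longlonglongrightarrow> (LINT x|?M. 0)"
  proof (rule integral_dominated_convergence[where w="\<lambda>x. 1"])
    show "AE x in ?M. (\<lambda>n. real n * r x ^ n * (1 - r x)) \<longlonglongrightarrow> 0"
    proof (intro AE_I2 tendsto_mult_left_zero)
      fix x assume "x \<in> space ?M"
      then show "(\<lambda>n. real n * r x ^ n) \<longlonglongrightarrow> 0"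
        using r01[of x] by (intro powser_times_n_limit_0) auto
    qed
    show "AE x in ?M. norm (real n * r x ^ n * (1 - r x)) \<le> 1" for n
      by (intro AE_I2) (use r01 weight_bounds[of "r _" n] in \<open>simp add: abs_mult less_imp_le\<close>)
  qed (intro borel_measurable_integrable int continuous_intros cr | simp)+
  have rhs: "(\<lambda>k. LINT x|?M. 2 * real (Suc (Suc k)) / R\<^sup>2 * r x ^ Suc k * Y x) \<longlonglongrightarrow> 0"
  proof (rule LIMSEQ_I)
    fix eps :: real assume eps: "eps > 0"
    define m where "m = measure ?M (space ?M)"
    have m0: "m \<ge> 0" by (simp add: m_def)
    \<comment> \<open>With the mass bounded by 3 m / 2, the part with e stays below eps R^2 / 8,
      which the factor 4 / R^2 turns into half of eps; m + 1 avoids a zero divisor.\<close>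
    define e where "e = eps * R\<^sup>2 / (12 * (m + 1))"
    have e: "e > 0" using eps R m0 by (simp add: e_def)
    \<comment> \<open>The constant e is paired with the mass bound, and the term with 1 - r with
      \<open>w0\<close>, by which it tends to 0.\<close>
    obtain C where C: "C \<ge> 0" "\<And>x. x \<in> cball c R \<Longrightarrow> \<bar>Y x\<bar> \<le> e + C * (1 - r x)"
      using continuous_small_at_sphere[OF cY _ R e] tang unfolding Y_def r_def by blast
    have "(\<lambda>n. C * (LINT x|?M. real n * r x ^ n * (1 - r x))) \<longlonglongrightarrow> 0" (is "?s \<longlonglongrightarrow> 0")
      using w0 by (auto intro: tendsto_mult_right_zero)
    then obtain N where N: "\<And>n. n \<ge> N \<Longrightarrow> \<bar>C * (LINT x|?M. real n * r x ^ n * (1 - r x))\<bar> < eps * R\<^sup>2 / 8"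
using LIMSEQ_D[OF \<open>?s \<longlonglongrightarrow> 0\<close>, of "eps * R\<^sup>2 / 8"] eps R by (auto simp: zero_less_mult_iff)
    have "norm ((LINT x|?M. 2 * real (Suc (Suc k)) / R\<^sup>2 * r x ^ Suc k * Y x) - 0) < eps" if k: "k \<ge> N" for k
    proof -
      let ?n = "Suc k"
      have "norm (LINT x|?M. 2 * real (Suc ?n) / R\<^sup>2 * r x ^ ?n * Y x)
          \<le> (LINT x|?M. norm (2 * real (Suc ?n) / R\<^sup>2 * r x ^ ?n * Y x))"
        by (rule integral_norm_bound)
      also have "\<dots> \<le> (LINT x|?M. 4 / R\<^sup>2 * (e * (real ?n * r x ^ ?n) + C * (real ?n * r x ^ ?n * (1 - r x))))"
      proof (intro integral_mono int continuous_intros cr cY)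
        fix x assume "x \<in> space ?M"
        then have x: "x \<in> ball c R" by simp
        have "norm (2 * real (Suc ?n) / R\<^sup>2 * r x ^ ?n * Y x) = 2 * real (Suc ?n) / R\<^sup>2 * r x ^ ?n * \<bar>Y x\<bar>"
          using r01[OF x] by (simp add: abs_mult del: of_nat_Suc power_Suc)
        also have "\<dots> \<le> (4 * real ?n) / R\<^sup>2 * r x ^ ?n * (e + C * (1 - r x))"
        proof -
          have "2 * real (Suc ?n) \<le> 4 * real ?n" by simp
          then have "2 * real (Suc ?n) / R\<^sup>2 * r x ^ ?n \<le> (4 * real ?n) / R\<^sup>2 * r x ^ ?n"
            using r01[OF x] by (intro mult_right_mono divide_right_mono) auto
          then show ?thesis
            by (rule mult_mono) (use C(2)[of x] x r01[OF x] in auto)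
        qed
        also have "\<dots> = 4 / R\<^sup>2 * (e * (real ?n * r x ^ ?n) + C * (real ?n * r x ^ ?n * (1 - r x)))"
          by (simp add: divide_inverse algebra_simps del: of_nat_Suc power_Suc)
        finally show "norm (2 * real (Suc ?n) / R\<^sup>2 * r x ^ ?n * Y x)
          \<le> 4 / R\<^sup>2 * (e * (real ?n * r x ^ ?n) + C * (real ?n * r x ^ ?n * (1 - r x)))" .
      qed
      also have "\<dots> = 4 / R\<^sup>2 * (e * (LINT x|?M. real ?n * r x ^ ?n) + C * (LINT x|?M. real ?n * r x ^ ?n * (1 - r x)))"
      proof -
        have "integrable ?M (\<lambda>x. e * (real ?n * r x ^ ?n))" "integrable ?M (\<lambda>x. C * (real ?n * r x ^ ?n * (1 - r x)))"
          by (intro int continuous_intros cr)+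
        then show ?thesis
          by (simp only: integral_mult_right_zero Bochner_Integration.integral_add)
      qed
      also have "\<dots> < 4 / R\<^sup>2 * (eps * R\<^sup>2 / 8 + eps * R\<^sup>2 / 8)"
      proof (intro mult_strict_left_mono add_le_less_mono)
        have "e * (LINT x|?M. real ?n * r x ^ ?n) \<le> e * (3 / 2 * m)"
          using mass[of ?n] e by (intro mult_left_mono) (auto simp: m_def)
        also have "\<dots> \<le> eps * R\<^sup>2 / 8"
          using m0 eps R by (simp add: e_def field_simps)
        finally show "e * (LINT x|?M. real ?n * r x ^ ?n) \<le> eps * R\<^sup>2 / 8" .
        show "C * (LINT x|?M. real ?n * r x ^ ?n * (1 - r x)) < eps * R\<^sup>2 / 8"
          using N[of ?n] k by (simp del: of_nat_Suc power_Suc)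
      qed (use R in simp)
      also have "\<dots> = eps" using R by simp
      finally show ?thesis by simp
    qed
    then show "\<exists>no. \<forall>k\<ge>no. norm ((LINT x|?M. 2 * real (Suc (Suc k)) / R\<^sup>2 * r x ^ Suc k * Y x) - 0) < eps" by blast
  qed
  show ?thesis
    using LIMSEQ_unique[OF lhs] rhs id by (simp only: d_def)
qed

text \<open>The field u X is tangential because X is, and its divergence is u div X + U . X. The sum
  over \<open>G i x $ i\<close> is div X.\<close>

corollary green:
  assumes R: "R > 0" and u: "C1 c R u U" and X: "\<And>i. C1 c R (\<lambda>x. X x $ i) (G i)"
    and tang: "\<And>x. x \<in> sphere c R \<Longrightarrow> (x - c) \<bullet> X x = 0"
  shows "(LINT x|lebesgue_on (ball c R). U x \<bullet> X x) = - (LINT x|lebesgue_on (ball c R). u x * (\<Sum>i\<in>UNIV. G i x $ i))"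
proof -
  let ?M = "lebesgue_on (ball c R)"
  have cG: "continuous_on (cball c R) (G i)" and cX: "continuous_on (cball c R) (\<lambda>x. X x $ i)" for i
    using X[of i] by (auto simp: C1_def)
  have cX': "continuous_on (cball c R) X"
    using cX by (subst continuous_on_componentwise) (auto simp: Basis_vec_def inner_axis)
  have cu: "continuous_on (cball c R) u" "continuous_on (cball c R) U" using u by (auto simp: C1_def)
  have "0 = (LINT x|?M. (\<Sum>i\<in>UNIV. (u x *\<^sub>R G i x + X x $ i *\<^sub>R U x) $ i))"
  proof (rule divergence_theorem_tangential[OF R, where X="\<lambda>x. u x *\<^sub>R X x", symmetric])
    show "C1 c R (\<lambda>x. (u x *\<^sub>R X x) $ i) (\<lambda>x. u x *\<^sub>R G i x + X x $ i *\<^sub>R U x)" for i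
      using C1_mult[OF u X[of i]] by simp
  qed (simp add: tang)
  also have "\<dots> = (LINT x|?M. u x * (\<Sum>i\<in>UNIV. G i x $ i) + U x \<bullet> X x)"
    by (simp add: sum.distrib sum_distrib_left inner_vec_def mult.commute)
  also have "\<dots> = (LINT x|?M. u x * (\<Sum>i\<in>UNIV. G i x $ i)) + (LINT x|?M. U x \<bullet> X x)"
    by (intro Bochner_Integration.integral_add integrable_ball_continuous continuous_intros cG cX' cu)
  finally show ?thesis by simp
qed

section \<open>Orthonormal families with bounded gradients are finite\<close>

text \<open>Extension by zero moves integrals over the ball to \<open>lborel\<close>, where Fubini's
  theorem and affine substitution are at hand.\<close>

lemma integral_ball_lborel:
  fixes f :: "real^3 \<Rightarrow> 'b::euclidean_space"
  assumes "continuous_on (cball c R) f"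
  shows "(\<lambda>x. indicator (ball c R) x *\<^sub>R f x) \<in> borel_measurable borel"
    and "integrable lborel (\<lambda>x. indicator (ball c R) x *\<^sub>R f x)"
    and "(LINT x|lebesgue_on (ball c R). f x) = (LINT x|lborel. indicator (ball c R) x *\<^sub>R f x)"
proof -
  have "continuous_on (ball c R) f" using assms ball_subset_cball continuous_on_subset by blast
  then show m: "(\<lambda>x. indicator (ball c R) x *\<^sub>R f x) \<in> borel_measurable borel"
    by (intro borel_measurable_continuous_on_indicator) auto
  show "integrable lborel (\<lambda>x. indicator (ball c R) x *\<^sub>R f x)"
    using integrable_ball_continuous[OF assms] m
    by (simp add: integrable_restrict_space integrable_completion)
  show "(LINT x|lebesgue_on (ball c R). f x) = (LINT x|lborel. indicator (ball c R) x *\<^sub>R f x)"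
    using m by (simp add: integral_restrict_space integral_completion)
qed

lemma nn_integral_affine:
  fixes F :: "real^3 \<Rightarrow> ennreal"
  assumes [measurable]: "F \<in> borel_measurable borel" and a: "a > 0"
  shows "(\<integral>\<^sup>+x. F x \<partial>lborel) = ennreal (a ^ 3) * (\<integral>\<^sup>+x. F (u + a *\<^sub>R x) \<partial>lborel)"
proof -
  have "(\<integral>\<^sup>+x. F x \<partial>lborel) = (\<integral>\<^sup>+x. F x \<partial>density (distr lborel borel (\<lambda>x. u + a *\<^sub>R x)) (\<lambda>_. ennreal (\<bar>a\<bar> ^ DIM(real^3))))"
    using lborel_affine[of a u] a by simp
  also have "\<dots> = ennreal (a ^ 3) * (\<integral>\<^sup>+x. F (u + a *\<^sub>R x) \<partial>lborel)"
    using a by (simp add: nn_integral_density nn_integral_distr nn_integral_cmult)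
  finally show ?thesis .
qed

lemma lborel_integral_affine:
  fixes F :: "real^3 \<Rightarrow> real"
  assumes [measurable]: "F \<in> borel_measurable borel" and a: "a > 0"
  shows "(LINT x|lborel. F x) = a ^ 3 * (LINT x|lborel. F (u + a *\<^sub>R x))"
proof -
  have "(LINT x|lborel. F x) = (LINT x|density (distr lborel borel (\<lambda>x. u + a *\<^sub>R x)) (\<lambda>_. ennreal (\<bar>a\<bar> ^ DIM(real^3))). F x)"
    using lborel_affine[of a u] a by simp
  also have "\<dots> = a ^ 3 * (LINT x|lborel. F (u + a *\<^sub>R x))"
    using a by (simp add: integral_density integral_distr)
  finally show ?thesis .
qed

text \<open>The difference is the integral of G . (y - x) along the segment from parameter 0 to t.
  Cauchy-Schwarz contributes the factor t, and |y - x| \<le> 2 R contributes 4 R^2.\<close>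

lemma segment_difference_bound:
  assumes g: "C1 c R g G" and x: "x \<in> ball c R" and y: "y \<in> ball c R" and t: "0 \<le> t" "t \<le> 1"
  shows "ennreal ((g x - g ((1 - t) *\<^sub>R x + t *\<^sub>R y))\<^sup>2)
    \<le> ennreal (4 * R\<^sup>2 * t) * (\<integral>\<^sup>+s. indicator {0..t} s *
        ennreal (indicator (ball c R) ((1 - s) *\<^sub>R x + s *\<^sub>R y) * (norm (G ((1 - s) *\<^sub>R x + s *\<^sub>R y)))\<^sup>2) \<partial>lborel)"
proof -
  define p where "p = (\<lambda>s. (1 - s) *\<^sub>R x + s *\<^sub>R y)"
  have pb: "p s \<in> ball c R" if "s \<in> {0..t}" for s
    using convexD[OF convex_ball x y, of "1 - s" s] that t by (simp add: p_def)
  have cG: "continuous_on (ball c R) G"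
    using g ball_subset_cball continuous_on_subset unfolding C1_def by blast
  have cp: "continuous_on S p" for S unfolding p_def by (intro continuous_intros)
  have cGp: "continuous_on {0..t} (\<lambda>s. G (p s))"
    by (rule continuous_on_compose2[OF cG cp]) (use pb in auto)
  define D where "D = (\<lambda>s. indicator {0..t} s *\<^sub>R (G (p s) \<bullet> (y - x)))"
  have Dm[measurable]: "D \<in> borel_measurable borel"
    unfolding D_def by (intro borel_measurable_continuous_on_indicator continuous_intros cGp) auto
  have Di: "integrable lborel D"
    unfolding D_def by (intro borel_integrable_compact continuous_intros cGp) auto
  have "(LINT s|lborel. D s) = g (p t) - g (p 0)"
    unfolding D_def
  proof (rule integral_FTC_Icc)
    fix s assume s: "0 \<le> s" "s \<le> t"
    have "(g has_derivative (\<lambda>h. G (p s) \<bullet> h)) (at (p s))"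
      using g pb[of s] s by (simp add: C1_def)
    moreover have "(p has_derivative (\<lambda>h. h *\<^sub>R (y - x))) (at s within {0..t})"
      unfolding p_def by (auto intro!: derivative_eq_intros simp: algebra_simps)
    ultimately have "((\<lambda>s. g (p s)) has_derivative (\<lambda>h. G (p s) \<bullet> (h *\<^sub>R (y - x)))) (at s within {0..t})"
      by (rule has_derivative_compose[rotated])
    then show "((\<lambda>s. g (p s)) has_vector_derivative (G (p s) \<bullet> (y - x))) (at s within {0..t})"
      by (simp add: has_vector_derivative_def)
  qed (use t in \<open>auto intro!: continuous_intros cGp\<close>)
  then have "ennreal \<bar>g (p t) - g (p 0)\<bar> \<le> (\<integral>\<^sup>+s. ennreal \<bar>D s\<bar> \<partial>lborel)"
    using integral_norm_bound_ennreal[OF Di] by simp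
  also have "\<dots> = (\<integral>\<^sup>+s. indicator {0..t} s * ennreal \<bar>D s\<bar> \<partial>lborel)"
    by (intro nn_integral_cong) (simp add: D_def indicator_def)
  finally have "(ennreal \<bar>g (p t) - g (p 0)\<bar>)\<^sup>2 \<le> (\<integral>\<^sup>+s. indicator {0..t} s * ennreal \<bar>D s\<bar> \<partial>lborel)\<^sup>2"
    by (intro power_mono) auto
  also have "\<dots> \<le> (\<integral>\<^sup>+s. (indicator {0..t} s)\<^sup>2 \<partial>lborel) * (\<integral>\<^sup>+s. (ennreal \<bar>D s\<bar>)\<^sup>2 \<partial>lborel)"
    by (rule Cauchy_Schwarz_nn_integral) measurable
  also have "(\<integral>\<^sup>+s. (indicator {0..t} s)\<^sup>2 \<partial>lborel) = (\<integral>\<^sup>+s. indicator {0..t} s \<partial>(lborel :: real measure))"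
    by (intro nn_integral_cong) (simp add: indicator_def)
  also have "\<dots> = ennreal t" using t by simp
  also have "(\<integral>\<^sup>+s. (ennreal \<bar>D s\<bar>)\<^sup>2 \<partial>lborel) \<le> (\<integral>\<^sup>+s. ennreal (4 * R\<^sup>2) * (indicator {0..t} s *
        ennreal (indicator (ball c R) (p s) * (norm (G (p s)))\<^sup>2)) \<partial>lborel)"
  proof (rule nn_integral_mono)
    fix s :: real
    show "(ennreal \<bar>D s\<bar>)\<^sup>2 \<le> ennreal (4 * R\<^sup>2) * (indicator {0..t} s *
        ennreal (indicator (ball c R) (p s) * (norm (G (p s)))\<^sup>2))"
    proof (cases "s \<in> {0..t}")
      case True
      have "norm (y - x) \<le> 2 * R"
        using x y dist_triangle2[of y x c] by (simp add: dist_norm norm_minus_commute)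
      then have "\<bar>D s\<bar> \<le> norm (G (p s)) * (2 * R)"
        using True Cauchy_Schwarz_ineq2[of "G (p s)" "y - x"]
          mult_left_mono[of "norm (y - x)" "2 * R" "norm (G (p s))"] by (simp add: D_def)
      then have "\<bar>D s\<bar>\<^sup>2 \<le> (norm (G (p s)) * (2 * R))\<^sup>2" by (intro power_mono) auto
      then have "ennreal (\<bar>D s\<bar>\<^sup>2) \<le> ennreal (4 * R\<^sup>2 * (norm (G (p s)))\<^sup>2)"
        by (intro ennreal_leI) (simp add: power_mult_distrib mult_ac)
      then show ?thesis
        using True pb[OF True] by (simp add: ennreal_power ennreal_mult)
    qed (simp add: D_def)
  qed
  also have "\<dots> = ennreal (4 * R\<^sup>2) * (\<integral>\<^sup>+s. (indicator {0..t} s *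
        ennreal (indicator (ball c R) (p s) * (norm (G (p s)))\<^sup>2)) \<partial>lborel)"
  proof (rule nn_integral_cmult)
    have "(\<lambda>x. indicator (ball c R) x *\<^sub>R (norm (G x))\<^sup>2) \<in> borel_measurable borel"
      by (intro borel_measurable_continuous_on_indicator continuous_intros cG) auto
    moreover have "p \<in> borel_measurable borel" by (rule borel_measurable_continuous_onI[OF cp])
    ultimately have "(\<lambda>s. indicator (ball c R) (p s) *\<^sub>R (norm (G (p s)))\<^sup>2) \<in> borel_measurable borel"
      by (rule measurable_compose[rotated])
    then show "(\<lambda>s. indicator {0..t} s * ennreal (indicator (ball c R) (p s) * (norm (G (p s)))\<^sup>2))
        \<in> borel_measurable lborel" by simp
  qed
  also have "(ennreal \<bar>g (p t) - g (p 0)\<bar>)\<^sup>2 = ennreal ((g x - g ((1 - t) *\<^sub>R x + t *\<^sub>R y))\<^sup>2)"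
    by (simp add: p_def ennreal_power power2_commute)
  finally have *: "ennreal ((g x - g ((1 - t) *\<^sub>R x + t *\<^sub>R y))\<^sup>2) \<le> ennreal t * (ennreal (4 * R\<^sup>2) * (\<integral>\<^sup>+s. (indicator {0..t} s *
        ennreal (indicator (ball c R) (p s) * (norm (G (p s)))\<^sup>2)) \<partial>lborel))"
    by (simp add: mult_left_mono)
  have "ennreal (4 * R\<^sup>2 * t) = ennreal t * ennreal (4 * R\<^sup>2)"
    using t by (simp only: ennreal_mult[symmetric] mult.commute) (simp add: ennreal_mult'' mult.commute)
  with * show ?thesis by (simp only: p_def mult.assoc)
qed

text \<open>After integration over x and exchange of the integrals, the substitution x \<mapsto> (1
  - s) x + s y costs a factor (1 - s)^(-3) \<le> 8, as s \<le> 1/2. So 32 = 4 * 8; one factor t is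
  that of the segment bound, the other the length of the interval of s.\<close>

lemma contraction_difference_bound:
  assumes g: "C1 c R g G" and y: "y \<in> ball c R" and t: "0 \<le> t" "t \<le> 1 / 2"
  shows "(\<integral>\<^sup>+x. indicator (ball c R) x * ennreal ((g x - g ((1 - t) *\<^sub>R x + t *\<^sub>R y))\<^sup>2) \<partial>lborel)
    \<le> ennreal (32 * R\<^sup>2 * t\<^sup>2 * ip (ball c R) G G)"
proof -
  define H where "H = (\<lambda>x. ennreal (indicator (ball c R) x * (norm (G x))\<^sup>2))"
  have cG: "continuous_on (cball c R) (\<lambda>x. (norm (G x))\<^sup>2)"
    using g unfolding C1_def by (intro continuous_intros) auto
  have Hm[measurable]: "H \<in> borel_measurable borel"
    unfolding H_def using integral_ball_lborel(1)[OF cG] by simp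
  have HI: "(\<integral>\<^sup>+x. H x \<partial>lborel) = ennreal (ip (ball c R) G G)"
    unfolding H_def ip_def dot_square_norm integral_ball_lborel(3)[OF cG]
    using integral_ball_lborel(2)[OF cG] by (subst nn_integral_eq_integral) auto
  have "(\<integral>\<^sup>+x. indicator (ball c R) x * ennreal ((g x - g ((1 - t) *\<^sub>R x + t *\<^sub>R y))\<^sup>2) \<partial>lborel)
    \<le> (\<integral>\<^sup>+x. ennreal (4 * R\<^sup>2 * t) * (\<integral>\<^sup>+s. indicator {0..t} s * H ((1 - s) *\<^sub>R x + s *\<^sub>R y) \<partial>lborel) \<partial>lborel)"
  proof (rule nn_integral_mono)
    fix x
    show "indicator (ball c R) x * ennreal ((g x - g ((1 - t) *\<^sub>R x + t *\<^sub>R y))\<^sup>2)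
      \<le> ennreal (4 * R\<^sup>2 * t) * (\<integral>\<^sup>+s. indicator {0..t} s * H ((1 - s) *\<^sub>R x + s *\<^sub>R y) \<partial>lborel)"
      using segment_difference_bound[OF g _ y, of x t] t unfolding H_def
      by (cases "x \<in> ball c R") simp_all
  qed
  also have "\<dots> = ennreal (4 * R\<^sup>2 * t) * (\<integral>\<^sup>+x. (\<integral>\<^sup>+s. indicator {0..t} s * H ((1 - s) *\<^sub>R x + s *\<^sub>R y) \<partial>lborel) \<partial>lborel)"
    by (rule nn_integral_cmult) measurable
  also have "(\<integral>\<^sup>+x. (\<integral>\<^sup>+s. indicator {0..t} s * H ((1 - s) *\<^sub>R x + s *\<^sub>R y) \<partial>lborel) \<partial>lborel)
     = (\<integral>\<^sup>+s. (\<integral>\<^sup>+x. indicator {0..t} s * H ((1 - s) *\<^sub>R x + s *\<^sub>R y) \<partial>lborel) \<partial>lborel)"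
    by (rule lborel_pair.Fubini') measurable
  also have "\<dots> \<le> (\<integral>\<^sup>+s. indicator {0..t} s * ennreal (8 * ip (ball c R) G G) \<partial>lborel)"
  proof (rule nn_integral_mono)
    fix s :: real
    show "(\<integral>\<^sup>+x. indicator {0..t} s * H ((1 - s) *\<^sub>R x + s *\<^sub>R y) \<partial>lborel) \<le> indicator {0..t} s * ennreal (8 * ip (ball c R) G G)"
    proof (cases "s \<in> {0..t}")
      case True
      then have s: "1 - s \<ge> 1 / 2" using t by simp
      let ?I = "\<integral>\<^sup>+x. H (s *\<^sub>R y + (1 - s) *\<^sub>R x) \<partial>lborel"
      have "?I = ennreal (8 * (1 / 2) ^ 3) * ?I" by (simp add: power3_eq_cube)
      also have "\<dots> \<le> ennreal (8 * (1 - s) ^ 3) * ?I"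
        by (rule mult_right_mono, rule ennreal_leI, rule mult_left_mono, rule power_mono) (use s in auto)
      also have "\<dots> = ennreal 8 * (ennreal ((1 - s) ^ 3) * ?I)"
        using s by (simp add: ennreal_mult mult.assoc)
      also have "\<dots> = ennreal 8 * (\<integral>\<^sup>+x. H x \<partial>lborel)"
        using nn_integral_affine[OF Hm, of "1 - s" "s *\<^sub>R y"] s by simp
      also have "\<dots> = ennreal (8 * ip (ball c R) G G)"
        by (simp add: HI ennreal_mult ip_nonneg)
      finally show ?thesis using True by (simp add: add.commute)
    qed simp
  qed
  also have "\<dots> = ennreal (8 * ip (ball c R) G G) * ennreal t"
    using t by (subst nn_integral_multc) (auto simp: mult.commute)
  finally have "(\<integral>\<^sup>+x. indicator (ball c R) x * ennreal ((g x - g ((1 - t) *\<^sub>R x + t *\<^sub>R y))\<^sup>2) \<partial>lborel)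
    \<le> ennreal (4 * R\<^sup>2 * t) * (ennreal (8 * ip (ball c R) G G) * ennreal t)"
    by (simp add: mult_left_mono)
  also have "\<dots> = ennreal (4 * R\<^sup>2 * t * (8 * ip (ball c R) G G * t))"
    using t ip_nonneg[of "ball c R" G] by (simp only: ennreal_mult[symmetric] mult_nonneg_nonneg zero_le_power2 zero_le_numeral)
  also have "4 * R\<^sup>2 * t * (8 * ip (ball c R) G G * t) = 32 * R\<^sup>2 * t\<^sup>2 * ip (ball c R) G G"
    by (simp add: power2_eq_square)
  finally show ?thesis .
qed

lemma contraction_in_ball:
  fixes x y c :: "'a::real_normed_vector"
  assumes "x \<in> ball c R" "y \<in> ball c R" "0 \<le> t" "t \<le> 1"
  shows "(1 - t) *\<^sub>R x + t *\<^sub>R y \<in> ball c R"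
  using convexD[OF convex_ball assms(1,2), of "1 - t" t] assms by simp

lemma contraction_in_cball:
  fixes x y c :: "'a::real_normed_vector"
  assumes "x \<in> ball c R" "y \<in> cball c R" "0 \<le> t" "t \<le> 1"
  shows "(1 - t) *\<^sub>R x + t *\<^sub>R y \<in> cball c R"
  using convexD[OF convex_cball _ assms(2), of x "1 - t" t] assms by (simp add: less_imp_le)

lemma contraction_ball_iff:
  fixes u c y :: "'a::real_normed_vector"
  assumes "t > 0"
  shows "u + t *\<^sub>R y \<in> ball (u + t *\<^sub>R c) (t * R) \<longleftrightarrow> y \<in> ball c R"
  using assms by (simp add: dist_norm scaleR_diff_right[symmetric])

lemma contraction_ball_subset:
  fixes x c :: "real^3"
  assumes x: "x \<in> ball c R" and t: "0 < t" "t \<le> 1"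
  shows "ball ((1 - t) *\<^sub>R x + t *\<^sub>R c) (t * R) \<subseteq> ball c R"
proof
  fix v assume v: "v \<in> ball ((1 - t) *\<^sub>R x + t *\<^sub>R c) (t * R)"
  define y where "y = (1 / t) *\<^sub>R (v - (1 - t) *\<^sub>R x)"
  have vy: "v = (1 - t) *\<^sub>R x + t *\<^sub>R y" using t by (simp add: y_def)
  then have "y \<in> ball c R" using v contraction_ball_iff[OF t(1)] by metis
  then show "v \<in> ball c R" using contraction_in_ball[OF x _ _ t(2), of y] t vy by simp
qed

text \<open>The substitution v = (1 - t) x + t y, with Jacobian t^3, maps the ball onto a smaller
  one inside it. For fixed x the integral over y thus becomes a coefficient of an indicator
  function, to which Bessel's inequality applies.\<close>

lemma contraction_average:
  assumes g: "continuous_on (cball c R) g" and x: "x \<in> ball c R" and t: "0 < t" "t \<le> 1"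
  shows "ip (ball c R) g (indicator (ball ((1 - t) *\<^sub>R x + t *\<^sub>R c) (t * R)))
    = t ^ 3 * (LINT y|lebesgue_on (ball c R). g ((1 - t) *\<^sub>R x + t *\<^sub>R y))"
proof -
  define u where "u = (1 - t) *\<^sub>R x"
  define k :: "real^3 \<Rightarrow> real" where "k = indicator (ball (u + t *\<^sub>R c) (t * R))"
  define F where "F = (\<lambda>v. k v * (indicator (ball c R) v *\<^sub>R g v))"
  have Fm: "F \<in> borel_measurable borel"
    unfolding F_def k_def using integral_ball_lborel(1)[OF g] by (intro borel_measurable_times borel_measurable_indicator) auto
  have "continuous_on (cball c R) (\<lambda>y. g (u + t *\<^sub>R y))"
  proof (rule continuous_on_compose2[OF g])
    show "(\<lambda>y. u + t *\<^sub>R y) ` cball c R \<subseteq> cball c R"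
      using contraction_in_cball[OF x] t by (simp add: u_def image_subset_iff del: mem_cball)
  qed (intro continuous_intros)
  then have gu: "(LINT y|lebesgue_on (ball c R). g (u + t *\<^sub>R y)) = (LINT y|lborel. indicator (ball c R) y *\<^sub>R g (u + t *\<^sub>R y))"
    by (rule integral_ball_lborel(3))
  have "ip (ball c R) g k = (LINT x|lebesgue. F x)"
    unfolding ip_def F_def by (subst integral_restrict_space) (auto simp: mult_ac)
  also have "\<dots> = (LINT x|lborel. F x)"
    using Fm by (simp add: integral_completion)
  also have "\<dots> = t ^ 3 * (LINT y|lborel. F (u + t *\<^sub>R y))"
    by (rule lborel_integral_affine[OF Fm t(1)])
  also have "(\<lambda>y. F (u + t *\<^sub>R y)) = (\<lambda>y. indicator (ball c R) y *\<^sub>R g (u + t *\<^sub>R y))"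
  proof
    fix y
    show "F (u + t *\<^sub>R y) = indicator (ball c R) y *\<^sub>R g (u + t *\<^sub>R y)"
      using contraction_ball_iff[OF t(1), of u y c R] contraction_in_ball[OF x, of y t] t
      unfolding F_def k_def indicator_def u_def by (simp del: mem_ball)
  qed
  also note gu[symmetric]
  finally show ?thesis by (simp only: k_def u_def)
qed

lemma measure_contraction_ball:
  fixes c :: "real^3"
  assumes t: "0 < t"
  shows "measure lebesgue (ball (u + t *\<^sub>R c) (t * R)) = t ^ 3 * measure lebesgue (ball c R)"
proof -
  have "(LINT x|lborel. indicator (ball (u + t *\<^sub>R c) (t * R)) x) =
     t ^ 3 * (LINT x|lborel. (indicator (ball (u + t *\<^sub>R c) (t * R)) (u + t *\<^sub>R x) :: real))"
    by (rule lborel_integral_affine[OF _ t]) (intro borel_measurable_indicator, simp)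
  also have "(\<lambda>x. indicator (ball (u + t *\<^sub>R c) (t * R)) (u + t *\<^sub>R x) :: real) = indicator (ball c R)"
    using contraction_ball_iff[OF t, of u _ c R] by (simp add: fun_eq_iff indicator_def del: mem_ball)
  finally show ?thesis by simp
qed

text \<open>With V the volume and N the number of functions, the pointwise estimates integrate to N
  V / 2 \<le> 2 V / t^3 + N V / 4. The first term on the right is Bessel's bound; in the second, V /
  4 per function comes from the condition on t, which makes the mean square change at most 1/4 for
  each y.\<close>

theorem orthonormal_bounded_gradient_card:
  assumes R: "R > 0" and I: "finite I" and g: "\<And>j. j \<in> I \<Longrightarrow> C1 c R (g j) (G j)"
    and orth: "\<And>i j. i \<in> I \<Longrightarrow> j \<in> I \<Longrightarrow> ip (ball c R) (g i) (g j) = (if i = j then 1 else 0)"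
    and bd: "\<And>j. j \<in> I \<Longrightarrow> ip (ball c R) (G j) (G j) \<le> L"
    and t: "0 < t" "t \<le> 1 / 2" "32 * R\<^sup>2 * t\<^sup>2 * L \<le> 1 / 4"
  shows "real (card I) \<le> 8 / t ^ 3"
proof -
  let ?B = "ball c R" let ?M = "lebesgue_on ?B"
  interpret finite_measure ?M by (simp add: finite_measure_lebesgue_on)
  define V where "V = measure lebesgue ?B"
  have V: "V > 0" using R content_ball_pos[of R c] by (simp add: V_def)
  have eV: "emeasure lborel ?B = ennreal V"
    using emeasure_eq_ennreal_measure[of lborel ?B] emeasure_lborel_ball_finite[of c R]
    by (simp add: V_def measure_completion)
  have gc: "continuous_on (cball c R) (g j)" if "j \<in> I" for j
    using g[OF that] by (simp add: C1_def)
  define z where "z = (\<lambda>x y. (1 - t) *\<^sub>R x + t *\<^sub>R (y::real^3))"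
  have zin: "z x y \<in> ?B" if "x \<in> ?B" "y \<in> ?B" for x y
    unfolding z_def using contraction_in_ball[OF that] t by simp
  have cz: "continuous_on (cball c R) (\<lambda>y. g j (z x y))" if "j \<in> I" "x \<in> ?B" for j x
  proof (rule continuous_on_compose2[OF gc[OF that(1)]])
    show "z x ` cball c R \<subseteq> cball c R"
      using contraction_in_cball[OF that(2)] t by (simp add: z_def image_subset_iff del: mem_cball)
  qed (unfold z_def, intro continuous_intros)
  define J where "J = (\<lambda>j. \<integral>\<^sup>+x. \<integral>\<^sup>+y. indicator ?B x * (indicator ?B y * ennreal ((g j x - g j (z x y))\<^sup>2)) \<partial>lborel \<partial>lborel)"
  have meas: "(\<lambda>(x, y). indicator ?B x * (indicator ?B y * ennreal ((g j x - g j (z x y))\<^sup>2)))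
      \<in> borel_measurable (lborel \<Otimes>\<^sub>M lborel)" if j: "j \<in> I" for j
  proof -
    \<comment> \<open>Extension by zero makes the integrand measurable on the whole space; the
      points \<open>z x y\<close> stay in the ball, so nothing changes there.\<close>
    define g' where "g' = (\<lambda>x. indicator ?B x *\<^sub>R g j x)"
    have [measurable]: "g' \<in> borel_measurable borel"
      unfolding g'_def by (rule integral_ball_lborel(1)[OF gc[OF j]])
    have [measurable]: "?B \<in> sets borel" by simp
    have "(\<lambda>(x, y). indicator ?B x * (indicator ?B y * ennreal ((g' x - g' ((1 - t) *\<^sub>R x + t *\<^sub>R y))\<^sup>2)))
      \<in> borel_measurable (lborel \<Otimes>\<^sub>M lborel)" by measurable
    also have "(\<lambda>(x, y). indicator ?B x * (indicator ?B y * ennreal ((g' x - g' ((1 - t) *\<^sub>R x + t *\<^sub>R y))\<^sup>2)))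
        = (\<lambda>(x, y). indicator ?B x * (indicator ?B y * ennreal ((g j x - g j (z x y))\<^sup>2)))"
      using zin by (auto simp: fun_eq_iff g'_def indicator_def z_def simp del: mem_ball)
    finally show ?thesis .
  qed
  have J_le: "J j \<le> ennreal (V / 4)" if j: "j \<in> I" for j
  proof -
    \<comment> \<open>The order of integration is exchanged because the contraction bound is stated
      for a fixed y.\<close>
    have "J j = (\<integral>\<^sup>+y. \<integral>\<^sup>+x. indicator ?B x * (indicator ?B y * ennreal ((g j x - g j (z x y))\<^sup>2)) \<partial>lborel \<partial>lborel)"
      unfolding J_def by (rule lborel_pair.Fubini'[symmetric]) (rule meas[OF j])
    also have "\<dots> \<le> (\<integral>\<^sup>+y. indicator ?B y * ennreal (1 / 4) \<partial>lborel)"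
    proof (rule nn_integral_mono)
      fix y
      show "(\<integral>\<^sup>+x. indicator ?B x * (indicator ?B y * ennreal ((g j x - g j (z x y))\<^sup>2)) \<partial>lborel) \<le> indicator ?B y * ennreal (1 / 4)"
      proof (cases "y \<in> ?B")
        case True
        have "(\<integral>\<^sup>+x. indicator ?B x * ennreal ((g j x - g j (z x y))\<^sup>2) \<partial>lborel) \<le> ennreal (32 * R\<^sup>2 * t\<^sup>2 * ip ?B (G j) (G j))"
          unfolding z_def using contraction_difference_bound[OF g[OF j] True] t by simp
        also have "\<dots> \<le> ennreal (32 * R\<^sup>2 * t\<^sup>2 * L)"
          using bd[OF j] by (intro ennreal_leI mult_left_mono) auto
        also have "\<dots> \<le> ennreal (1 / 4)" using t(3) by (rule ennreal_leI)
        finally show ?thesis using True by simp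
      qed simp
    qed
    also have "\<dots> = ennreal V * ennreal (1 / 4)"
      by (subst nn_integral_multc) (auto simp: eV intro: borel_measurable_indicator)
    also have "\<dots> = ennreal (V / 4)" using V by (simp add: ennreal_mult[symmetric])
    finally show ?thesis .
  qed
  have pointwise: "(\<Sum>j\<in>I. V * (g j x)\<^sup>2 / 2) \<le> 2 / t ^ 3 + (\<Sum>j\<in>I. (LINT y|?M. (g j x - g j (z x y))\<^sup>2))"
    if x: "x \<in> ?B" for x
  proof -
    define k :: "real^3 \<Rightarrow> real" where "k = indicator (ball ((1 - t) *\<^sub>R x + t *\<^sub>R c) (t * R))"
    define b where "b = (\<lambda>j. LINT y|?M. g j (z x y))"
    have ksub: "ball ((1 - t) *\<^sub>R x + t *\<^sub>R c) (t * R) \<subseteq> ?B"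
      using contraction_ball_subset[OF x] t by simp
    have k2: "k v * k v = k v" for v by (simp add: k_def indicator_def)
    have kint: "integrable ?M k"
      unfolding k_def by (rule integrable_real_indicator) (use ksub in \<open>simp_all add: sets_restrict_space_iff less_top[symmetric]\<close>)
    have kL: "k \<in> L2 ?B"
      using kint by (auto simp: L2_def power2_eq_square k2 abs_mult_self_eq)
    have kk: "ip ?B k k = t ^ 3 * V"
    proof -
      have "ip ?B k k = (LINT v|?M. k v)" by (simp add: ip_def k2)
      also have "\<dots> = (LINT v|lebesgue. k v)"
      proof -
        have "(\<lambda>v. indicator ?B v *\<^sub>R k v) = k"
          using ksub by (auto simp: fun_eq_iff k_def indicator_def simp del: mem_ball)
        moreover have "(LINT v|?M. k v) = (LINT v|lebesgue. indicator ?B v *\<^sub>R k v)"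
          by (rule integral_restrict_space) simp
        ultimately show ?thesis by simp
      qed
      also have "\<dots> = t ^ 3 * V"
        unfolding k_def V_def using measure_contraction_ball[OF t(1), of "(1 - t) *\<^sub>R x" c R] by simp
      finally show ?thesis .
    qed
    have bk: "ip ?B k (g j) = t ^ 3 * b j" if "j \<in> I" for j
      unfolding ip_commute[of ?B k]
      unfolding k_def b_def z_def using contraction_average[OF gc[OF that] x] t by simp
    \<comment> \<open>Bessel's inequality for the indicator of the small ball: its square norm is
      t^3 V and its coefficients are t^3 b_j, so the b_j^2 add up to at most V / t^3.\<close>
    have "(\<Sum>j\<in>I. (ip ?B k (g j))\<^sup>2) \<le> ip ?B k k"
      by (rule Bessel[OF L2_ball_continuous[OF gc] kL I orth])
    then have "(\<Sum>j\<in>I. (t ^ 3)\<^sup>2 * (b j)\<^sup>2) \<le> t ^ 3 * V"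
      by (simp add: kk bk power_mult_distrib)
    then have "t ^ 3 * (t ^ 3 * (\<Sum>j\<in>I. (b j)\<^sup>2)) \<le> t ^ 3 * V"
      by (simp add: sum_distrib_left power2_eq_square mult.assoc)
    then have bs: "t ^ 3 * (\<Sum>j\<in>I. (b j)\<^sup>2) \<le> V"
      by (rule mult_left_le_imp_le) (use t in simp)
    have "V * (g j x)\<^sup>2 / 2 \<le> 2 / V * (b j)\<^sup>2 + (LINT y|?M. (g j x - g j (z x y))\<^sup>2)" if j: "j \<in> I" for j
    proof -
      have "V * (g j x)\<^sup>2 - 2 * g j x * b j = (LINT y|?M. (g j x)\<^sup>2 - 2 * g j x * g j (z x y))"
      proof -
        have "integrable ?M (\<lambda>y. 2 * g j x * g j (z x y))"
          by (intro integrable_ball_continuous continuous_intros cz j x)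
        then show ?thesis by (simp add: V_def b_def measure_restrict_space)
      qed
      also have "\<dots> \<le> (LINT y|?M. (g j x - g j (z x y))\<^sup>2)"
        by (intro integral_mono integrable_ball_continuous continuous_intros cz j x)
           (simp add: power2_diff)
      finally have 1: "V * (g j x)\<^sup>2 - 2 * g j x * b j \<le> (LINT y|?M. (g j x - g j (z x y))\<^sup>2)" .
      \<comment> \<open>Completing the square bounds the cross term 2 g b by V g^2 / 2 + 2 b^2 /
        V.\<close>
      have "0 \<le> (V * g j x - 2 * b j)\<^sup>2 / (2 * V)" using V by simp
      also have "\<dots> = V * (g j x)\<^sup>2 / 2 - 2 * g j x * b j + 2 / V * (b j)\<^sup>2"
        using V by (simp add: power2_eq_square field_simps)
      finally show ?thesis using 1 by simp
    qed
    then have "(\<Sum>j\<in>I. V * (g j x)\<^sup>2 / 2) \<le> (\<Sum>j\<in>I. 2 / V * (b j)\<^sup>2 + (LINT y|?M. (g j x - g j (z x y))\<^sup>2))"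
      by (rule sum_mono)
    also have "\<dots> = 2 / V * (\<Sum>j\<in>I. (b j)\<^sup>2) + (\<Sum>j\<in>I. (LINT y|?M. (g j x - g j (z x y))\<^sup>2))"
      by (simp add: sum.distrib sum_distrib_left)
    also have "2 / V * (\<Sum>j\<in>I. (b j)\<^sup>2) \<le> 2 / V * (V / t ^ 3)"
      using bs t V by (intro mult_left_mono) (auto simp: field_simps)
    also have "\<dots> = 2 / t ^ 3" using V by simp
    finally show ?thesis by simp
  qed
  have "ennreal (card I * (V / 2)) = (\<Sum>j\<in>I. ennreal (V / 2) * (\<integral>\<^sup>+x. indicator ?B x * ennreal ((g j x)\<^sup>2) \<partial>lborel))"
  proof -
    have "(\<integral>\<^sup>+x. indicator ?B x * ennreal ((g j x)\<^sup>2) \<partial>lborel) = 1" if j: "j \<in> I" for j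
    proof -
      have c2: "continuous_on (cball c R) (\<lambda>x. (g j x)\<^sup>2)" by (intro continuous_intros gc j)
      have "(\<integral>\<^sup>+x. indicator ?B x * ennreal ((g j x)\<^sup>2) \<partial>lborel) = (\<integral>\<^sup>+x. ennreal (indicator ?B x *\<^sub>R (g j x)\<^sup>2) \<partial>lborel)"
        by (intro nn_integral_cong) (simp add: indicator_def)
      also have "\<dots> = ennreal (LINT x|lborel. indicator ?B x *\<^sub>R (g j x)\<^sup>2)"
        by (rule nn_integral_eq_integral[OF integral_ball_lborel(2)[OF c2]]) simp
      also have "(LINT x|lborel. indicator ?B x *\<^sub>R (g j x)\<^sup>2) = ip ?B (g j) (g j)"
        using integral_ball_lborel(3)[OF c2] by (simp add: ip_def power2_eq_square)
      finally show ?thesis using orth[OF j j] by simp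
    qed
    then show ?thesis using V by (simp add: ennreal_mult[symmetric] ennreal_of_nat_eq_real_of_nat)
  qed
  also have "\<dots> = (\<integral>\<^sup>+x. (\<Sum>j\<in>I. ennreal (V / 2) * (indicator ?B x * ennreal ((g j x)\<^sup>2))) \<partial>lborel)"
  proof -
    have m: "(\<lambda>x. indicator ?B x * ennreal ((g j x)\<^sup>2)) \<in> borel_measurable lborel" if j: "j \<in> I" for j
    proof -
      have "(\<lambda>x. indicator ?B x *\<^sub>R (g j x)\<^sup>2) \<in> borel_measurable borel"
        by (intro integral_ball_lborel(1) continuous_intros gc j)
      then have "(\<lambda>x. ennreal (indicator ?B x *\<^sub>R (g j x)\<^sup>2)) \<in> borel_measurable borel" by simp
      also have "(\<lambda>x. ennreal (indicator ?B x *\<^sub>R (g j x)\<^sup>2)) = (\<lambda>x. indicator ?B x * ennreal ((g j x)\<^sup>2))"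
        by (simp add: fun_eq_iff indicator_def)
      finally show ?thesis by simp
    qed
    then show ?thesis
      by (subst nn_integral_sum) (auto simp: nn_integral_cmult intro!: sum.cong)
  qed
  also have "\<dots> \<le> (\<integral>\<^sup>+x. indicator ?B x * ennreal (2 / t ^ 3)
       + (\<Sum>j\<in>I. \<integral>\<^sup>+y. indicator ?B x * (indicator ?B y * ennreal ((g j x - g j (z x y))\<^sup>2)) \<partial>lborel) \<partial>lborel)"
  proof (rule nn_integral_mono)
    fix x
    show "(\<Sum>j\<in>I. ennreal (V / 2) * (indicator ?B x * ennreal ((g j x)\<^sup>2))) \<le> indicator ?B x * ennreal (2 / t ^ 3)
       + (\<Sum>j\<in>I. \<integral>\<^sup>+y. indicator ?B x * (indicator ?B y * ennreal ((g j x - g j (z x y))\<^sup>2)) \<partial>lborel)"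
    proof (cases "x \<in> ?B")
      case True
      have I2: "(\<integral>\<^sup>+y. indicator ?B y * ennreal ((g j x - g j (z x y))\<^sup>2) \<partial>lborel)
         = ennreal (LINT y|?M. (g j x - g j (z x y))\<^sup>2)" if j: "j \<in> I" for j
      proof -
        have c2: "continuous_on (cball c R) (\<lambda>y. (g j x - g j (z x y))\<^sup>2)"
          by (intro continuous_intros cz j True)
        have "(\<integral>\<^sup>+y. indicator ?B y * ennreal ((g j x - g j (z x y))\<^sup>2) \<partial>lborel)
          = (\<integral>\<^sup>+y. ennreal (indicator ?B y *\<^sub>R (g j x - g j (z x y))\<^sup>2) \<partial>lborel)"
          by (intro nn_integral_cong) (simp add: indicator_def)
        also have "\<dots> = ennreal (LINT y|lborel. indicator ?B y *\<^sub>R (g j x - g j (z x y))\<^sup>2)"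
          by (rule nn_integral_eq_integral[OF integral_ball_lborel(2)[OF c2]]) simp
        finally show ?thesis by (simp only: integral_ball_lborel(3)[OF c2])
      qed
      have "(\<Sum>j\<in>I. ennreal (V / 2) * (indicator ?B x * ennreal ((g j x)\<^sup>2))) = ennreal (\<Sum>j\<in>I. V * (g j x)\<^sup>2 / 2)"
      proof -
        have "ennreal (V / 2) * (indicator ?B x * ennreal ((g j x)\<^sup>2)) = ennreal (V * (g j x)\<^sup>2 / 2)" for j
          using True V by (simp add: ennreal_mult[symmetric])
        then show ?thesis using V by (simp add: sum_ennreal)
      qed
      also have "\<dots> \<le> ennreal (2 / t ^ 3 + (\<Sum>j\<in>I. (LINT y|?M. (g j x - g j (z x y))\<^sup>2)))"
        by (rule ennreal_leI[OF pointwise[OF True]])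
      also have "\<dots> = ennreal (2 / t ^ 3) + (\<Sum>j\<in>I. ennreal (LINT y|?M. (g j x - g j (z x y))\<^sup>2))"
        using t by (simp add: sum_nonneg sum_ennreal)
      finally show ?thesis using True I2 by simp
    qed simp
  qed
  also have "\<dots> = ennreal V * ennreal (2 / t ^ 3) + (\<Sum>j\<in>I. J j)"
  proof -
    have m: "(\<lambda>x. \<integral>\<^sup>+y. indicator ?B x * (indicator ?B y * ennreal ((g j x - g j (z x y))\<^sup>2)) \<partial>lborel) \<in> borel_measurable lborel"
      if "j \<in> I" for j
      using lborel.borel_measurable_nn_integral_fst[OF meas[OF that]] by simp
    have "(\<integral>\<^sup>+x. indicator ?B x * ennreal (2 / t ^ 3) \<partial>lborel) = ennreal V * ennreal (2 / t ^ 3)"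
      by (subst nn_integral_multc) (auto simp: eV intro: borel_measurable_indicator)
    then show ?thesis
      using m by (subst nn_integral_add) (auto simp: nn_integral_sum J_def intro!: borel_measurable_sum borel_measurable_times_ennreal borel_measurable_indicator)
  qed
  also have "\<dots> \<le> ennreal V * ennreal (2 / t ^ 3) + (\<Sum>j\<in>I. ennreal (V / 4))"
    by (intro add_left_mono sum_mono J_le)
  also have "\<dots> = ennreal (V * (2 / t ^ 3) + card I * (V / 4))"
    using V t by (simp add: ennreal_mult[symmetric] ennreal_of_nat_eq_real_of_nat)
  finally have "card I * (V / 2) \<le> V * (2 / t ^ 3) + card I * (V / 4)"
    using V t by (subst (asm) ennreal_le_iff) auto
  then have "V * real (card I) \<le> V * (8 / t ^ 3)" by (simp add: field_simps)
  then show ?thesis using V by (rule mult_left_le_imp_le)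
qed

section \<open>The radial functions and $\psi_n$\<close>

text \<open>These are the coefficients of sin z / z as a power series in s = z^2.\<close>

definition bessel_coeff :: "nat \<Rightarrow> real" where
  "bessel_coeff k = (- 1) ^ k / fact (2 * k + 1)"

text \<open>The n-th derivative in s of sin z / z, where s = z^2. As d / (z dz) = 2 d/ds, it equals
  psi_n up to the factor (-2 z)^n; in s it is entire, without a singularity at the centre of the
  ball.\<close>

definition bessel_entire :: "nat \<Rightarrow> real \<Rightarrow> real" where
  "bessel_entire n s = (\<Sum>k. (diffs ^^ n) bessel_coeff k * s ^ k)"

lemma summable_bessel_coeff: "summable (\<lambda>k. bessel_coeff k * s ^ k)"
proof (rule summable_comparison_test')
  show "summable (\<lambda>k. inverse (fact k) * \<bar>s\<bar> ^ k)" by (rule summable_exp)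
  show "norm (bessel_coeff k * s ^ k) \<le> inverse (fact k) * \<bar>s\<bar> ^ k" if "k \<ge> 0" for k
  proof -
    have "(fact k :: real) \<le> fact (2 * k + 1)" by (rule fact_mono) simp
    then have "inverse (fact (2 * k + 1) :: real) \<le> inverse (fact k)" by (intro le_imp_inverse_le) auto
    moreover have "norm (bessel_coeff k * s ^ k) = inverse (fact (2 * k + 1)) * \<bar>s\<bar> ^ k"
      by (simp add: bessel_coeff_def abs_mult power_abs divide_inverse del: fact_Suc)
    ultimately show ?thesis by (simp add: mult_right_mono del: fact_Suc)
  qed
qed

lemma summable_bessel_entire: "summable (\<lambda>k. (diffs ^^ n) bessel_coeff k * s ^ k)"
  by (induction n arbitrary: s) (auto intro: summable_bessel_coeff termdiff_converges_all)

lemma DERIV_bessel_entire: "(bessel_entire n has_real_derivative bessel_entire (Suc n) s) (at s)"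
  unfolding bessel_entire_def
  using termdiffs_strong_converges_everywhere[OF summable_bessel_entire, of n s] by simp

lemma DERIV_bessel_entire_compose:
  assumes "(g has_real_derivative g') (at x)"
  shows "((\<lambda>x. bessel_entire n (g x)) has_real_derivative bessel_entire (Suc n) (g x) * g') (at x)"
  by (rule DERIV_chain2[where f="bessel_entire n" and g=g, OF DERIV_bessel_entire assms])

lemma continuous_on_bessel_entire: "continuous_on S (bessel_entire n)"
  by (meson DERIV_bessel_entire DERIV_isCont continuous_at_imp_continuous_on)

lemma bessel_entire_sin: "z * bessel_entire 0 (z\<^sup>2) = sin z"
proof -
  have "(\<lambda>k. z * (bessel_coeff k * (z\<^sup>2) ^ k)) sums (z * bessel_entire 0 (z\<^sup>2))"
    unfolding bessel_entire_def using summable_bessel_entire[of 0 "z\<^sup>2"]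
    by (intro sums_mult) (simp add: summable_sums)
  moreover have "(\<lambda>k. (- 1) ^ k / fact (2 * k + 1) * z ^ (2 * k + 1)) sums sin z"
    by (rule sin_paired)
  moreover have "z * (bessel_coeff k * (z\<^sup>2) ^ k) = (- 1) ^ k / fact (2 * k + 1) * z ^ (2 * k + 1)" for k
    by (simp add: bessel_coeff_def power_mult)
  ultimately show ?thesis using sums_unique2 by fastforce
qed

text \<open>For n = 0 this is the recursion of the coefficients. Differentiating the equation for n
  gives the one for n + 1, since the derivative of 4 s raises the coefficient 6 + 4 n by 4.\<close>

lemma bessel_entire_ode:
  "4 * s * bessel_entire (n + 2) s + (6 + 4 * real n) * bessel_entire (n + 1) s + bessel_entire n s = 0"
proof (induction n arbitrary: s)
  case 0
  let ?a = bessel_coeff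
  have s0: "(\<lambda>k. ?a k * s ^ k) sums bessel_entire 0 s"
    unfolding bessel_entire_def using summable_bessel_entire[of 0 s] by (simp add: summable_sums)
  have s1: "(\<lambda>k. diffs ?a k * s ^ k) sums bessel_entire 1 s"
    unfolding bessel_entire_def using summable_bessel_entire[of 1 s] by (simp add: summable_sums)
  have "(\<lambda>k. s * (diffs (diffs ?a) k * s ^ k)) sums (s * bessel_entire 2 s)"
    unfolding bessel_entire_def using summable_bessel_entire[of 2 s]
    by (intro sums_mult) (simp add: summable_sums numeral_2_eq_2)
  then have "(\<lambda>k. real (Suc k) * diffs ?a (Suc k) * s ^ Suc k) sums (s * bessel_entire 2 s)"
    by (simp add: diffs_def mult_ac)
  then have s2: "(\<lambda>k. real k * diffs ?a k * s ^ k) sums (s * bessel_entire 2 s)"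
    by (subst (asm) sums_Suc_iff) simp
  have "(\<lambda>k. 4 * (real k * diffs ?a k * s ^ k) + 6 * (diffs ?a k * s ^ k) + ?a k * s ^ k)
      sums (4 * (s * bessel_entire 2 s) + 6 * bessel_entire 1 s + bessel_entire 0 s)"
    by (intro sums_add sums_mult s0 s1 s2)
  moreover have "4 * (real k * diffs ?a k * s ^ k) + 6 * (diffs ?a k * s ^ k) + ?a k * s ^ k = 0" for k
  proof -
    \<comment> \<open>The two new factors are (2k + 3) (2k + 2) = (4k + 6) (k + 1).\<close>
    have f: "(fact (2 * Suc k + 1) :: real) = (4 * real k + 6) * (real k + 1) * fact (2 * k + 1)"
      by (simp add: algebra_simps)
    have "(4 * real k + 6) * diffs ?a k + ?a k
        = (4 * real k + 6) * (real k + 1) * ((- 1) ^ Suc k / fact (2 * Suc k + 1)) + (- 1) ^ k / fact (2 * k + 1)"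
      by (simp add: diffs_def bessel_coeff_def)
    also have "\<dots> = 0"
    proof -
      have "(4 * real k + 6) * (real k + 1) \<noteq> 0" by simp
      then show ?thesis unfolding f by (simp add: divide_simps)
    qed
    finally show ?thesis by (simp add: distrib_right[symmetric] mult.assoc[symmetric])
  qed
  ultimately show ?case using sums_unique2[OF sums_zero] by (simp add: numeral_2_eq_2 mult.assoc)
next
  case (Suc n)
  have "((\<lambda>s. 4 * s * bessel_entire (n + 2) s + (6 + 4 * real n) * bessel_entire (n + 1) s + bessel_entire n s)
     has_real_derivative (4 * bessel_entire (n + 2) s + 4 * s * bessel_entire (n + 3) s
        + (6 + 4 * real n) * bessel_entire (n + 2) s + bessel_entire (n + 1) s)) (at s)"
    using DERIV_bessel_entire[of "n + 2" s] DERIV_bessel_entire[of "n + 1" s] DERIV_bessel_entire[of n s]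
    by (auto intro!: derivative_eq_intros simp: numeral_3_eq_3)
  moreover have "((\<lambda>s. 4 * s * bessel_entire (n + 2) s + (6 + 4 * real n) * bessel_entire (n + 1) s + bessel_entire n s)
     has_real_derivative 0) (at s)"
    unfolding Suc.IH by simp
  ultimately have "4 * bessel_entire (n + 2) s + 4 * s * bessel_entire (n + 3) s
        + (6 + 4 * real n) * bessel_entire (n + 2) s + bessel_entire (n + 1) s = 0"
    by (rule DERIV_unique)
  then show ?case by (simp add: algebra_simps numeral_3_eq_3)
qed

lemma iterated_radial_deriv:
  assumes "z \<noteq> 0"
  shows "((\<lambda>g t. deriv g t / t) ^^ n) (\<lambda>t. sin t / t) z = 2 ^ n * bessel_entire n (z\<^sup>2)"
  using assms
proof (induction n arbitrary: z)
  case 0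
  then show ?case using bessel_entire_sin[of z] by (simp add: field_simps)
next
  case (Suc n)
  define h :: "real \<Rightarrow> real" where "h = ((\<lambda>g t. deriv g t / t) ^^ n) (\<lambda>t. sin t / t)"
  have d: "((\<lambda>t. 2 ^ n * bessel_entire n (t\<^sup>2)) has_real_derivative 2 ^ n * (bessel_entire (Suc n) (z\<^sup>2) * (2 * z))) (at z)"
    by (rule DERIV_cmult[OF DERIV_bessel_entire_compose]) (auto intro!: derivative_eq_intros)
  \<comment> \<open>The derivative needs the formula on a neighbourhood of z; the induction
    hypothesis gives it wherever t \<noteq> 0, an open condition.\<close>
  have ev: "\<forall>\<^sub>F t in nhds z. 2 ^ n * bessel_entire n (t\<^sup>2) = h t"
    using t1_space_nhds[OF Suc.prems]
    by eventually_elim (simp add: h_def Suc.IH)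
  have "(h has_real_derivative 2 ^ n * (bessel_entire (Suc n) (z\<^sup>2) * (2 * z))) (at z)"
    by (rule iffD1[OF DERIV_cong_ev[OF refl ev refl] d])
  then have "deriv h z / z = 2 ^ Suc n * bessel_entire (Suc n) (z\<^sup>2)"
    using Suc.prems by (simp add: DERIV_imp_deriv)
  then show ?case by (simp add: h_def)
qed

text \<open>The right side is continuous at 0 and agrees with \<open>psi_raw n\<close> elsewhere, so
  its value at 0 is the limit by which \<open>psi\<close> is defined there.\<close>

lemma psi_eq: "psi n z = (- 2 * z) ^ n * bessel_entire n (z\<^sup>2)"
proof -
  have raw: "psi_raw n z = (- 2 * z) ^ n * bessel_entire n (z\<^sup>2)" if "z \<noteq> 0" for z
  proof -
    have "(- 2 * z) ^ n = (- z) ^ n * 2 ^ n" by (simp add: power_mult_distrib[symmetric] mult.commute)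
    then show ?thesis using that by (simp add: psi_raw_def iterated_radial_deriv)
  qed
  have "continuous_on UNIV (\<lambda>z::real. (- 2 * z) ^ n * bessel_entire n (z\<^sup>2))"
    by (intro continuous_intros continuous_on_compose2[OF continuous_on_bessel_entire[of UNIV]]) auto
  then have "isCont (\<lambda>z::real. (- 2 * z) ^ n * bessel_entire n (z\<^sup>2)) 0"
    by (simp add: continuous_on_eq_continuous_at)
  then have "((\<lambda>z::real. (- 2 * z) ^ n * bessel_entire n (z\<^sup>2)) \<longlongrightarrow> (- 2 * 0) ^ n * bessel_entire n (0\<^sup>2)) (at 0)"
    by (simp only: isCont_def)
  then have "(psi_raw n \<longlongrightarrow> (- 2 * 0) ^ n * bessel_entire n (0\<^sup>2)) (at 0)"
    by (rule Lim_transform_eventually) (auto simp: eventually_at_filter raw)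
  then have "Lim (at 0) (psi_raw n) = (- 2 * 0) ^ n * bessel_entire n (0\<^sup>2)"
    by (intro tendsto_Lim) auto
  then show ?thesis using raw by (simp add: psi_def)
qed

lemma DERIV_psi: "(psi n has_real_derivative
    real n * (- 2 * z) ^ (n - 1) * (- 2) * bessel_entire n (z\<^sup>2)
    + (- 2 * z) ^ n * (bessel_entire (Suc n) (z\<^sup>2) * (2 * z))) (at z)"
proof -
  have "((\<lambda>t. bessel_entire n (t\<^sup>2)) has_real_derivative bessel_entire (Suc n) (z\<^sup>2) * (2 * z)) (at z)"
    by (rule DERIV_bessel_entire_compose) (auto intro!: derivative_eq_intros)
  moreover have "psi n = (\<lambda>z. (- 2 * z) ^ n * bessel_entire n (z\<^sup>2))"
    by (simp add: fun_eq_iff psi_eq)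
  ultimately show ?thesis
    by (auto intro!: derivative_eq_intros simp: algebra_simps)
qed

text \<open>As psi_0 is even, nonresonance for n = 0 forces the frequency to be nonzero.\<close>

lemma deriv_psi_0_at_0: "deriv (psi 0) 0 = 0"
  using DERIV_imp_deriv[OF DERIV_psi[of 0 0]] by simp

text \<open>With z = \<nu> R and h(s) = \<open>bessel_entire n\<close> (\<nu>^2 s), the second
  factor on the right is n h(R^2) + 2 R^2 h'(R^2), the Neumann expression of the homogeneous radial
  solution.\<close>

lemma deriv_psi_mult: "z * deriv (psi n) z = (- 2 * z) ^ n * (real n * bessel_entire n (z\<^sup>2) + 2 * z\<^sup>2 * bessel_entire (Suc n) (z\<^sup>2))"
  unfolding DERIV_imp_deriv[OF DERIV_psi[of n z]]
  by (cases n) (simp_all add: algebra_simps power2_eq_square)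

text \<open>In the variable \<open>s = |x|\<^sup>2\<close>, the Helmholtz operator maps \<open>h(x) \<phi>(s)\<close>, with \<open>h\<close> a solid harmonic of
  degree \<open>n\<close>, to \<open>h(x) (4 s \<phi>''(s) + (6 + 4 n) \<phi>'(s) + \<lambda> \<phi>(s))\<close>.\<close>

definition radial_solution :: "nat \<Rightarrow> real \<Rightarrow> (real \<Rightarrow> real) \<Rightarrow> (real \<Rightarrow> real) \<Rightarrow> (real \<Rightarrow> real) \<Rightarrow> (real \<Rightarrow> real) \<Rightarrow> bool" where
  "radial_solution n lam r f f' f'' \<longleftrightarrow>
     (\<forall>s. (f has_real_derivative f' s) (at s)) \<and> (\<forall>s. (f' has_real_derivative f'' s) (at s)) \<and>
     continuous_on UNIV f'' \<and>
     (\<forall>s. 4 * s * f'' s + (6 + 4 * real n) * f' s + lam * f s = r s)"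

lemma radial_solution_homogeneous:
  "radial_solution n lam (\<lambda>s. 0) (\<lambda>s. bessel_entire n (lam * s))
     (\<lambda>s. lam * bessel_entire (n + 1) (lam * s)) (\<lambda>s. lam\<^sup>2 * bessel_entire (n + 2) (lam * s))"
proof -
  have D: "((\<lambda>s. bessel_entire n (lam * s)) has_real_derivative lam * bessel_entire (n + 1) (lam * s)) (at s)" for n s
    unfolding mult.commute[of lam "bessel_entire _ _"] Suc_eq_plus1[symmetric]
    by (rule DERIV_bessel_entire_compose) (auto intro!: derivative_eq_intros)
  have "4 * s * (lam\<^sup>2 * bessel_entire (n + 2) (lam * s)) + (6 + 4 * real n) * (lam * bessel_entire (n + 1) (lam * s))
      + lam * bessel_entire n (lam * s) = 0" for s
    using arg_cong[OF bessel_entire_ode[of "lam * s" n], of "\<lambda>u. lam * u"]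
    by (simp add: algebra_simps power2_eq_square)
  moreover have "continuous_on UNIV (\<lambda>s. lam\<^sup>2 * bessel_entire (n + 2) (lam * s))"
    by (intro continuous_intros continuous_on_compose2[OF continuous_on_bessel_entire[of UNIV]]) auto
  moreover have "((\<lambda>s. lam * bessel_entire (n + 1) (lam * s)) has_real_derivative lam\<^sup>2 * bessel_entire (n + 2) (lam * s)) (at s)" for s
    using DERIV_cmult[OF D[of "n + 1" s], of lam] by (simp add: power2_eq_square mult.assoc)
  ultimately show ?thesis
    unfolding radial_solution_def using D by blast
qed

lemma DERIV_power_twice:
  "((\<lambda>s::real. s ^ Suc j) has_real_derivative (real j + 1) * s ^ j) (at s)"
  "((\<lambda>s::real. (real j + 1) * s ^ j) has_real_derivative (real j + 1) * (real j * s ^ (j - 1))) (at s)"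
  using DERIV_pow[of "Suc j" s UNIV] DERIV_cmult[OF DERIV_pow[of j s UNIV], of "real j + 1"]
  by (simp_all add: add.commute)

text \<open>The operator maps s^(j+1) to lam s^(j+1) + k s^j. The solution already found for s^j
  removes the lower term, and division by lam finishes.\<close>

lemma radial_solution_particular:
  assumes "lam \<noteq> 0"
  shows "\<exists>f f' f''. radial_solution n lam (\<lambda>s. s ^ j) f f' f''"
proof (induction j)
  case 0
  have "radial_solution n lam (\<lambda>s. s ^ 0) (\<lambda>s. 1 / lam) (\<lambda>s. 0) (\<lambda>s. 0)"
    using assms by (auto simp: radial_solution_def intro!: derivative_eq_intros)
  then show ?case by blast
next
  case (Suc j)
  then obtain f f' f'' where f: "radial_solution n lam (\<lambda>s. s ^ j) f f' f''" by blast
  define k where "k = 4 * (real j + 1) * real j + (6 + 4 * real n) * (real j + 1)"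
  have "radial_solution n lam (\<lambda>s. s ^ Suc j) (\<lambda>s. (s ^ Suc j - k * f s) / lam)
     (\<lambda>s. ((real j + 1) * s ^ j - k * f' s) / lam) (\<lambda>s. ((real j + 1) * (real j * s ^ (j - 1)) - k * f'' s) / lam)"
    unfolding radial_solution_def
  proof (intro conjI allI)
    fix s
    have f12: "(f has_real_derivative f' s) (at s)" "(f' has_real_derivative f'' s) (at s)"
      using f by (auto simp: radial_solution_def)
    show "((\<lambda>s. (s ^ Suc j - k * f s) / lam) has_real_derivative ((real j + 1) * s ^ j - k * f' s) / lam) (at s)"
      by (intro DERIV_cdivide DERIV_diff DERIV_cmult DERIV_power_twice f12)
    show "((\<lambda>s. ((real j + 1) * s ^ j - k * f' s) / lam) has_real_derivative ((real j + 1) * (real j * s ^ (j - 1)) - k * f'' s) / lam) (at s)"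
      by (intro DERIV_cdivide DERIV_diff DERIV_cmult DERIV_power_twice f12)
    have e: "lam * f s = s ^ j - 4 * s * f'' s - (6 + 4 * real n) * f' s"
      using f unfolding radial_solution_def by (smt (verit))
    \<comment> \<open>The exponent j - 1 is truncated at j = 0, where the factor j vanishes.\<close>
    have s: "s * (real j * s ^ (j - 1)) = real j * s ^ j" by (cases j) auto
    have "4 * s * (((real j + 1) * (real j * s ^ (j - 1)) - k * f'' s) / lam)
        + (6 + 4 * real n) * (((real j + 1) * s ^ j - k * f' s) / lam) + lam * ((s ^ Suc j - k * f s) / lam)
       = (4 * (real j + 1) * (s * (real j * s ^ (j - 1))) + (6 + 4 * real n) * (real j + 1) * s ^ j
          - k * (4 * s * f'' s + (6 + 4 * real n) * f' s + lam * f s)) / lam + s ^ Suc j"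
      using assms by (simp add: divide_simps) (simp add: algebra_simps)
    also have "4 * s * f'' s + (6 + 4 * real n) * f' s + lam * f s = s ^ j" using e by simp
    also have "(4 * (real j + 1) * (s * (real j * s ^ (j - 1))) + (6 + 4 * real n) * (real j + 1) * s ^ j - k * s ^ j) = 0"
      unfolding s k_def by (simp add: algebra_simps)
    finally show "4 * s * (((real j + 1) * (real j * s ^ (j - 1)) - k * f'' s) / lam)
        + (6 + 4 * real n) * (((real j + 1) * s ^ j - k * f' s) / lam) + lam * ((s ^ Suc j - k * f s) / lam) = s ^ Suc j"
      by simp
  qed (use f assms in \<open>auto simp: radial_solution_def intro!: continuous_intros\<close>)
  then show ?case by blast
qed

text \<open>A multiple of the homogeneous solution is subtracted so that the Neumann expression
  vanishes at R^2; the divisor is nonzero because of psi_n'(\<nu> R) \<noteq> 0.\<close>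

lemma radial_solution_neumann:
  assumes R: "R > 0" and nu: "\<nu> \<noteq> 0" and nr: "deriv (psi n) (\<nu> * R) \<noteq> 0"
  shows "\<exists>f f' f''. radial_solution n (\<nu>\<^sup>2) (\<lambda>s. s ^ j) f f' f'' \<and> real n * f (R\<^sup>2) + 2 * R\<^sup>2 * f' (R\<^sup>2) = 0"
proof -
  obtain f f' f'' where f: "radial_solution n (\<nu>\<^sup>2) (\<lambda>s. s ^ j) f f' f''"
    using radial_solution_particular[of "\<nu>\<^sup>2"] nu by fastforce
  define h where "h = (\<lambda>s. bessel_entire n (\<nu>\<^sup>2 * s))"
  define h' where "h' = (\<lambda>s. \<nu>\<^sup>2 * bessel_entire (n + 1) (\<nu>\<^sup>2 * s))"
  define h'' where "h'' = (\<lambda>s. (\<nu>\<^sup>2)\<^sup>2 * bessel_entire (n + 2) (\<nu>\<^sup>2 * s))"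
  have h: "radial_solution n (\<nu>\<^sup>2) (\<lambda>s. 0) h h' h''"
    unfolding h_def h'_def h''_def by (rule radial_solution_homogeneous)
  have "real n * h (R\<^sup>2) + 2 * R\<^sup>2 * h' (R\<^sup>2) \<noteq> 0"
    using deriv_psi_mult[of "\<nu> * R" n] nr R nu
    by (auto simp: h_def h'_def power_mult_distrib mult_ac)
  moreover define a where "a = (real n * f (R\<^sup>2) + 2 * R\<^sup>2 * f' (R\<^sup>2)) / (real n * h (R\<^sup>2) + 2 * R\<^sup>2 * h' (R\<^sup>2))"
  ultimately have a: "real n * f (R\<^sup>2) + 2 * R\<^sup>2 * f' (R\<^sup>2) = a * (real n * h (R\<^sup>2) + 2 * R\<^sup>2 * h' (R\<^sup>2))"
    by simp
  have "radial_solution n (\<nu>\<^sup>2) (\<lambda>s. s ^ j) (\<lambda>s. f s - a * h s) (\<lambda>s. f' s - a * h' s) (\<lambda>s. f'' s - a * h'' s)"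
    unfolding radial_solution_def
  proof (intro conjI allI)
    fix s
    have "4 * s * f'' s + (6 + 4 * real n) * f' s + \<nu>\<^sup>2 * f s = s ^ j"
      "4 * s * h'' s + (6 + 4 * real n) * h' s + \<nu>\<^sup>2 * h s = 0"
      using f h by (auto simp: radial_solution_def)
    moreover have "4 * s * (f'' s - a * h'' s) + (6 + 4 * real n) * (f' s - a * h' s) + \<nu>\<^sup>2 * (f s - a * h s)
      = (4 * s * f'' s + (6 + 4 * real n) * f' s + \<nu>\<^sup>2 * f s) - a * (4 * s * h'' s + (6 + 4 * real n) * h' s + \<nu>\<^sup>2 * h s)"
      by (simp add: algebra_simps)
    ultimately show "4 * s * (f'' s - a * h'' s) + (6 + 4 * real n) * (f' s - a * h' s) + \<nu>\<^sup>2 * (f s - a * h s) = s ^ j"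
      by simp
  qed (use f h in \<open>auto simp: radial_solution_def intro!: continuous_intros DERIV_diff DERIV_cmult\<close>)
  moreover have "real n * (f (R\<^sup>2) - a * h (R\<^sup>2)) + 2 * R\<^sup>2 * (f' (R\<^sup>2) - a * h' (R\<^sup>2)) = 0"
    using a by (simp add: algebra_simps)
  ultimately show ?thesis by blast
qed

section \<open>Homogeneous polynomials\<close>

text \<open>\<open>H i\<close> is the gradient of the i-th component of the gradient G, so L is the
  Laplacian of v. G and L are arguments because the Neumann condition and the Helmholtz equation
  speak of them.\<close>

definition C2 :: "(real^3 \<Rightarrow> real) \<Rightarrow> (real^3 \<Rightarrow> real^3) \<Rightarrow> (real^3 \<Rightarrow> real) \<Rightarrow> bool" where
  "C2 v G L \<longleftrightarrow> (\<exists>H. (\<forall>x. (v has_derivative (\<lambda>h. G x \<bullet> h)) (at x)) \<and>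
     (\<forall>i x. ((\<lambda>x. G x $ i) has_derivative (\<lambda>h. H i x \<bullet> h)) (at x)) \<and>
     (\<forall>i. continuous_on UNIV (H i)) \<and> (\<forall>x. L x = (\<Sum>i\<in>UNIV. H i x $ i)))"

lemma has_derivative_inner_add:
  assumes "(f has_derivative (\<lambda>h. F \<bullet> h)) (at x)" "(g has_derivative (\<lambda>h. G \<bullet> h)) (at x)"
  shows "((\<lambda>x. f x + g x) has_derivative (\<lambda>h. (F + G) \<bullet> h)) (at x)"
  using has_derivative_add[OF assms] by (simp add: inner_add_left)

lemma has_derivative_inner_scale:
  assumes "(f has_derivative (\<lambda>h. F \<bullet> h)) (at x)"
  shows "((\<lambda>x. a * f x) has_derivative (\<lambda>h. (a *\<^sub>R F) \<bullet> h)) (at x)"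
  using has_derivative_mult_right[OF assms, of a] by simp

lemma C2_cong: "C2 v G L \<Longrightarrow> (\<And>x. L x = L' x) \<Longrightarrow> C2 v G L'"
  by (simp add: C2_def)

lemma C2_add:
  assumes "C2 v G L" "C2 w K M"
  shows "C2 (\<lambda>x. v x + w x) (\<lambda>x. G x + K x) (\<lambda>x. L x + M x)"
proof -
  obtain H J where "\<forall>i x. ((\<lambda>x. G x $ i) has_derivative (\<lambda>h. H i x \<bullet> h)) (at x)"
    "\<forall>i. continuous_on UNIV (H i)" "\<forall>x. L x = (\<Sum>i\<in>UNIV. H i x $ i)"
    "\<forall>i x. ((\<lambda>x. K x $ i) has_derivative (\<lambda>h. J i x \<bullet> h)) (at x)"
    "\<forall>i. continuous_on UNIV (J i)" "\<forall>x. M x = (\<Sum>i\<in>UNIV. J i x $ i)"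
    using assms by (auto simp: C2_def)
  then show ?thesis
    using assms unfolding C2_def
    by (intro exI[of _ "\<lambda>i x. H i x + J i x"])
       (auto intro!: has_derivative_inner_add continuous_intros simp: sum.distrib)
qed

lemma C2_scale:
  assumes "C2 v G L"
  shows "C2 (\<lambda>x. a * v x) (\<lambda>x. a *\<^sub>R G x) (\<lambda>x. a * L x)"
proof -
  obtain H where "\<forall>i x. ((\<lambda>x. G x $ i) has_derivative (\<lambda>h. H i x \<bullet> h)) (at x)"
    "\<forall>i. continuous_on UNIV (H i)" "\<forall>x. L x = (\<Sum>i\<in>UNIV. H i x $ i)"
    using assms by (auto simp: C2_def)
  then show ?thesis
    using assms unfolding C2_def
    by (intro exI[of _ "\<lambda>i x. a *\<^sub>R H i x"])
       (auto intro!: has_derivative_inner_scale continuous_intros simp: sum_distrib_left)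
qed

lemma C2_mult:
  assumes "C2 v G L" "C2 w K M"
  shows "C2 (\<lambda>x. v x * w x) (\<lambda>x. v x *\<^sub>R K x + w x *\<^sub>R G x) (\<lambda>x. v x * M x + w x * L x + 2 * (G x \<bullet> K x))"
proof -
  obtain H J where v: "\<forall>x. (v has_derivative (\<lambda>h. G x \<bullet> h)) (at x)"
    and w: "\<forall>x. (w has_derivative (\<lambda>h. K x \<bullet> h)) (at x)"
    and G: "\<forall>i x. ((\<lambda>x. G x $ i) has_derivative (\<lambda>h. H i x \<bullet> h)) (at x)"
    "\<forall>i. continuous_on UNIV (H i)" "\<forall>x. L x = (\<Sum>i\<in>UNIV. H i x $ i)"
    and K: "\<forall>i x. ((\<lambda>x. K x $ i) has_derivative (\<lambda>h. J i x \<bullet> h)) (at x)"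
    "\<forall>i. continuous_on UNIV (J i)" "\<forall>x. M x = (\<Sum>i\<in>UNIV. J i x $ i)"
    using assms unfolding C2_def by blast
  have cont: "continuous_on UNIV f" if "\<forall>x. (f has_derivative (\<lambda>h. F x \<bullet> h)) (at x)" for f :: "real^3 \<Rightarrow> real" and F
    using that by (meson continuous_at_imp_continuous_on has_derivative_continuous)
  have cG: "continuous_on UNIV G" and cK: "continuous_on UNIV K"
    by (subst continuous_on_componentwise;
        use cont[OF spec[OF G(1)]] cont[OF spec[OF K(1)]] in \<open>auto simp: Basis_vec_def inner_axis\<close>)+
  show ?thesis
    unfolding C2_def
  proof (intro exI[of _ "\<lambda>i x. v x *\<^sub>R J i x + K x $ i *\<^sub>R G x + w x *\<^sub>R H i x + G x $ i *\<^sub>R K x"] conjI allI)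
    fix x
    show "((\<lambda>x. v x * w x) has_derivative (\<lambda>h. (v x *\<^sub>R K x + w x *\<^sub>R G x) \<bullet> h)) (at x)"
      by (rule derivative_eq_intros v[rule_format] w[rule_format] refl)+ (simp add: inner_add_left mult.commute)
    fix i
    show "((\<lambda>x. (v x *\<^sub>R K x + w x *\<^sub>R G x) $ i) has_derivative
        (\<lambda>h. (v x *\<^sub>R J i x + K x $ i *\<^sub>R G x + w x *\<^sub>R H i x + G x $ i *\<^sub>R K x) \<bullet> h)) (at x)"
      unfolding vector_add_component vector_scaleR_component real_scaleR_def
      by (rule derivative_eq_intros v[rule_format] w[rule_format] G(1)[rule_format] K(1)[rule_format] refl)+
         (simp add: inner_add_left algebra_simps)
  next
    fix i
    show "continuous_on UNIV (\<lambda>x. v x *\<^sub>R J i x + K x $ i *\<^sub>R G x + w x *\<^sub>R H i x + G x $ i *\<^sub>R K x)"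
      by (intro continuous_intros cont[OF v] cont[OF w] cG cK G(2)[rule_format] K(2)[rule_format])
  next
    fix x
    show "v x * M x + w x * L x + 2 * (G x \<bullet> K x) =
        (\<Sum>i\<in>UNIV. (v x *\<^sub>R J i x + K x $ i *\<^sub>R G x + w x *\<^sub>R H i x + G x $ i *\<^sub>R K x) $ i)"
      by (simp add: G(3) K(3) sum.distrib sum_distrib_left inner_vec_def mult_ac)
  qed
qed

lemma C2_radial:
  assumes f: "\<And>s. (f has_real_derivative f' s) (at s)" and f': "\<And>s. (f' has_real_derivative f'' s) (at s)"
    and c: "continuous_on UNIV f''"
  shows "C2 (\<lambda>x. f (x \<bullet> x)) (\<lambda>x. (2 * f' (x \<bullet> x)) *\<^sub>R x) (\<lambda>x. 4 * (x \<bullet> x) * f'' (x \<bullet> x) + 6 * f' (x \<bullet> x))"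
proof -
  have D: "((\<lambda>x. g (x \<bullet> x)) has_derivative (\<lambda>h. (2 * g' (x \<bullet> x)) *\<^sub>R x \<bullet> h)) (at x)"
    if "\<And>s. (g has_real_derivative g' s) (at s)" for g g' :: "real \<Rightarrow> real" and x :: "real^3"
  proof -
    have "((\<lambda>x. x \<bullet> x) has_derivative (\<lambda>h. 2 * (x \<bullet> h))) (at x)"
      by (auto intro!: derivative_eq_intros simp: inner_commute)
    from has_derivative_compose[OF this that[unfolded has_field_derivative_def]]
    show ?thesis by (simp add: mult_ac)
  qed
  have cf': "continuous_on UNIV f'" using f' by (meson DERIV_isCont continuous_at_imp_continuous_on)
  show ?thesis
    unfolding C2_def
  proof (intro exI[of _ "\<lambda>i x. (4 * f'' (x \<bullet> x) * x $ i) *\<^sub>R x + (2 * f' (x \<bullet> x)) *\<^sub>R axis i 1"] conjI allI)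
    fix i and x :: "real^3"
    show "((\<lambda>x. f (x \<bullet> x)) has_derivative (\<lambda>h. (2 * f' (x \<bullet> x)) *\<^sub>R x \<bullet> h)) (at x)" by (rule D[OF f])
    have "((\<lambda>x. x $ i) has_derivative (\<lambda>h. h $ i)) (at x)"
      by (rule bounded_linear_imp_has_derivative[OF bounded_linear_vec_nth])
    from has_derivative_mult[OF has_derivative_mult_right[OF D[OF f', of x], of 2] this]
    show "((\<lambda>x. ((2 * f' (x \<bullet> x)) *\<^sub>R x) $ i) has_derivative
       (\<lambda>h. ((4 * f'' (x \<bullet> x) * x $ i) *\<^sub>R x + (2 * f' (x \<bullet> x)) *\<^sub>R axis i 1) \<bullet> h)) (at x)"
      by (simp add: inner_add_left inner_axis' algebra_simps)
  next
    fix i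
    show "continuous_on UNIV (\<lambda>x::real^3. (4 * f'' (x \<bullet> x) * x $ i) *\<^sub>R x + (2 * f' (x \<bullet> x)) *\<^sub>R axis i 1)"
      by (intro continuous_intros continuous_on_compose2[OF c] continuous_on_compose2[OF cf']) auto
  next
    fix x :: "real^3"
    have 1: "(\<Sum>i\<in>(UNIV::3 set). axis i 1 $ i) = (3::real)" by (simp add: axis_def)
    have "(\<Sum>i\<in>UNIV. ((4 * f'' (x \<bullet> x) * x $ i) *\<^sub>R x + (2 * f' (x \<bullet> x)) *\<^sub>R axis i 1) $ i)
      = 4 * f'' (x \<bullet> x) * (\<Sum>i\<in>UNIV. x $ i * x $ i) + 2 * f' (x \<bullet> x) * (\<Sum>i\<in>(UNIV::3 set). axis i 1 $ i)"
      by (simp only: vector_add_component vector_scaleR_component real_scaleR_def sum.distrib sum_distrib_left mult.assoc)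
    also have "\<dots> = 4 * (x \<bullet> x) * f'' (x \<bullet> x) + 6 * f' (x \<bullet> x)"
      unfolding 1 by (simp add: inner_vec_def mult_ac)
    finally show "4 * (x \<bullet> x) * f'' (x \<bullet> x) + 6 * f' (x \<bullet> x)
      = (\<Sum>i\<in>UNIV. ((4 * f'' (x \<bullet> x) * x $ i) *\<^sub>R x + (2 * f' (x \<bullet> x)) *\<^sub>R axis i 1) $ i)" ..
  qed
qed

section \<open>Homogeneous polynomials and Euler's identity\<close>

text \<open>Homogeneous polynomials are taken as functions, generated so that derivatives and
  products can be treated by rule induction; the zero function has every degree.\<close>

inductive hpoly :: "nat \<Rightarrow> (real^3 \<Rightarrow> real) \<Rightarrow> bool" where
  const: "hpoly 0 (\<lambda>x. a)"
| coord: "hpoly n p \<Longrightarrow> hpoly (Suc n) (\<lambda>x. x $ i * p x)"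
| add: "hpoly n p \<Longrightarrow> hpoly n q \<Longrightarrow> hpoly n (\<lambda>x. p x + q x)"

lemma hpoly_scale: "hpoly n p \<Longrightarrow> hpoly n (\<lambda>x. a * p x)"
proof (induction rule: hpoly.induct)
  case (const b)
  show ?case using hpoly.const[of "a * b"] by simp
next
  case (coord n p i)
  then show ?case using hpoly.coord[of n "\<lambda>x. a * p x" i] by (simp add: mult.left_commute)
next
  case (add n p q)
  then show ?case using hpoly.add[of n "\<lambda>x. a * p x" "\<lambda>x. a * q x"] by (simp add: distrib_left)
qed

lemma hpoly_zero: "hpoly n (\<lambda>x. 0)"
proof (induction n)
  case 0
  show ?case by (rule hpoly.const)
next
  case (Suc n)
  show ?case using hpoly.coord[OF Suc] by simp
qed

lemma hpoly_mult: "hpoly n p \<Longrightarrow> hpoly m q \<Longrightarrow> hpoly (n + m) (\<lambda>x. p x * q x)"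
proof (induction rule: hpoly.induct)
  case (const a)
  then show ?case using hpoly_scale by simp
next
  case (coord n p i)
  then show ?case using hpoly.coord[of "n + m" "\<lambda>x. p x * q x" i] by (simp add: mult.assoc)
next
  case (add n p r)
  then show ?case using hpoly.add[of "n + m" "\<lambda>x. p x * q x" "\<lambda>x. r x * q x"] by (simp add: distrib_right)
qed

lemma hpoly_sum: "(\<And>j. j \<in> I \<Longrightarrow> hpoly n (p j)) \<Longrightarrow> hpoly n (\<lambda>x. \<Sum>j\<in>I. p j x)"
  by (induction I rule: infinite_finite_induct) (auto intro: hpoly_zero hpoly.add)

lemma hpoly_norm_power: "hpoly (2 * j) (\<lambda>x. (x \<bullet> x) ^ j)"
proof (induction j)
  case 0
  show ?case using hpoly.const[of 1] by simp
next
  case (Suc j)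
  have x: "hpoly 1 (\<lambda>x. x $ i)" for i using hpoly.coord[OF hpoly.const[of 1], of i] by simp
  have "hpoly (1 + 1) (\<lambda>x. \<Sum>i\<in>UNIV. x $ i * x $ i)" by (rule hpoly_sum, rule hpoly_mult) (rule x)+
  then have "hpoly 2 (\<lambda>x. x \<bullet> x)" by (simp add: inner_vec_def numeral_2_eq_2)
  from hpoly_mult[OF this Suc] show ?case by simp
qed

text \<open>Euler's identity is carried through the product rule. For n = 0 the degree n - 1 is
  truncated to 0, and only the extra clause G = 0 keeps x_k times a component of G homogeneous of
  degree n in the coordinate step.\<close>

lemma hpoly_gradient:
  "hpoly n p \<Longrightarrow> \<exists>G. (\<forall>x. (p has_derivative (\<lambda>h. G x \<bullet> h)) (at x)) \<and>
     (\<forall>i. hpoly (n - 1) (\<lambda>x. G x $ i)) \<and> (n = 0 \<longrightarrow> G = (\<lambda>x. 0)) \<and> (\<forall>x. x \<bullet> G x = real n * p x)"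
proof (induction rule: hpoly.induct)
  case (const a)
  show ?case by (rule exI[of _ "\<lambda>x. 0"]) (auto intro: hpoly_zero)
next
  case (coord n p k)
  from coord.IH obtain G where "(\<forall>x. (p has_derivative (\<lambda>h. G x \<bullet> h)) (at x)) \<and>
     (\<forall>i. hpoly (n - 1) (\<lambda>x. G x $ i)) \<and> (n = 0 \<longrightarrow> G = (\<lambda>x. 0)) \<and> (\<forall>x. x \<bullet> G x = real n * p x)" ..
  then have G: "\<And>x. (p has_derivative (\<lambda>h. G x \<bullet> h)) (at x)" "\<And>i. hpoly (n - 1) (\<lambda>x. G x $ i)"
    "n = 0 \<Longrightarrow> G = (\<lambda>x. 0)" "\<And>x. x \<bullet> G x = real n * p x" by auto
  show ?case
  proof (intro exI[of _ "\<lambda>x. p x *\<^sub>R axis k 1 + x $ k *\<^sub>R G x"] conjI allI)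
    fix x :: "real^3"
    have "((\<lambda>x. x $ k) has_derivative (\<lambda>h. h $ k)) (at x)"
      by (rule bounded_linear_imp_has_derivative[OF bounded_linear_vec_nth])
    from has_derivative_mult[OF this G(1)[of x]]
    show "((\<lambda>x. x $ k * p x) has_derivative (\<lambda>h. (p x *\<^sub>R axis k 1 + x $ k *\<^sub>R G x) \<bullet> h)) (at x)"
      by (simp add: inner_add_left inner_axis' algebra_simps)
    show "x \<bullet> (p x *\<^sub>R axis k 1 + x $ k *\<^sub>R G x) = real (Suc n) * (x $ k * p x)"
      by (simp add: inner_add_right inner_axis G(4) algebra_simps)
  next
    fix i
    have "hpoly n (\<lambda>x. x $ k * G x $ i)"
    proof (cases n)
      case 0
      then show ?thesis using G(3) hpoly_zero by simp
    next
      case (Suc m)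
      then show ?thesis using hpoly.coord[OF G(2)[of i], of k] by simp
    qed
    moreover have "hpoly n (\<lambda>x. axis k 1 $ i * p x)" by (rule hpoly_scale[OF coord.hyps])
    ultimately have "hpoly n (\<lambda>x. axis k 1 $ i * p x + x $ k * G x $ i)" by (intro hpoly.add)
    then show "hpoly (Suc n - 1) (\<lambda>x. (p x *\<^sub>R axis k 1 + x $ k *\<^sub>R G x) $ i)"
      by (simp add: mult.commute)
  qed simp
next
  case (add n p q)
  from add.IH(1) obtain G where "(\<forall>x. (p has_derivative (\<lambda>h. G x \<bullet> h)) (at x)) \<and>
     (\<forall>i. hpoly (n - 1) (\<lambda>x. G x $ i)) \<and> (n = 0 \<longrightarrow> G = (\<lambda>x. 0)) \<and> (\<forall>x. x \<bullet> G x = real n * p x)" ..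
  then have G: "\<And>x. (p has_derivative (\<lambda>h. G x \<bullet> h)) (at x)" "\<And>i. hpoly (n - 1) (\<lambda>x. G x $ i)"
    "n = 0 \<Longrightarrow> G = (\<lambda>x. 0)" "\<And>x. x \<bullet> G x = real n * p x" by auto
  from add.IH(2) obtain K where "(\<forall>x. (q has_derivative (\<lambda>h. K x \<bullet> h)) (at x)) \<and>
     (\<forall>i. hpoly (n - 1) (\<lambda>x. K x $ i)) \<and> (n = 0 \<longrightarrow> K = (\<lambda>x. 0)) \<and> (\<forall>x. x \<bullet> K x = real n * q x)" ..
  then have K: "\<And>x. (q has_derivative (\<lambda>h. K x \<bullet> h)) (at x)" "\<And>i. hpoly (n - 1) (\<lambda>x. K x $ i)"
    "n = 0 \<Longrightarrow> K = (\<lambda>x. 0)" "\<And>x. x \<bullet> K x = real n * q x" by auto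
  show ?case
    by (intro exI[of _ "\<lambda>x. G x + K x"] conjI allI)
      (use G K in \<open>auto intro!: has_derivative_inner_add hpoly.add simp: inner_add_right distrib_left\<close>)
qed

text \<open>The gradient lemma is applied to p and to each component of its gradient. The clause for
  n < 2 compensates the truncated n - 2.\<close>

lemma hpoly_C2:
  assumes p: "hpoly n p"
  obtains G L where "C2 p G L" "hpoly (n - 2) L" "n < 2 \<Longrightarrow> L = (\<lambda>x. 0)" "\<And>x. x \<bullet> G x = real n * p x"
proof -
  obtain G where G: "\<And>x. (p has_derivative (\<lambda>h. G x \<bullet> h)) (at x)" "\<And>i. hpoly (n - 1) (\<lambda>x. G x $ i)"
    "\<And>x. x \<bullet> G x = real n * p x"
    using hpoly_gradient[OF p] by metis
  have "\<forall>i. \<exists>H. (\<forall>x. ((\<lambda>x. G x $ i) has_derivative (\<lambda>h. H x \<bullet> h)) (at x)) \<and>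
     (\<forall>k. hpoly (n - 1 - 1) (\<lambda>x. H x $ k)) \<and> (n - 1 = 0 \<longrightarrow> H = (\<lambda>x. 0))"
  proof
    fix i
    show "\<exists>H. (\<forall>x. ((\<lambda>x. G x $ i) has_derivative (\<lambda>h. H x \<bullet> h)) (at x)) \<and>
     (\<forall>k. hpoly (n - 1 - 1) (\<lambda>x. H x $ k)) \<and> (n - 1 = 0 \<longrightarrow> H = (\<lambda>x. 0))"
      using hpoly_gradient[OF G(2)[of i]] by (elim exE conjE) (intro exI conjI; assumption)
  qed
  from choice[OF this] obtain H where "\<forall>i. (\<forall>x. ((\<lambda>x. G x $ i) has_derivative (\<lambda>h. H i x \<bullet> h)) (at x)) \<and>
     (\<forall>k. hpoly (n - 1 - 1) (\<lambda>x. H i x $ k)) \<and> (n - 1 = 0 \<longrightarrow> H i = (\<lambda>x. 0))" ..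
  then have H: "\<And>i x. ((\<lambda>x. G x $ i) has_derivative (\<lambda>h. H i x \<bullet> h)) (at x)"
     "\<And>i k. hpoly (n - 1 - 1) (\<lambda>x. H i x $ k)" "\<And>i. n - 1 = 0 \<Longrightarrow> H i = (\<lambda>x. 0)"
    by blast+
  have cont: "continuous_on UNIV q" if "hpoly m q" for m q
    using hpoly_gradient[OF that] by (meson continuous_at_imp_continuous_on has_derivative_continuous)
  have cH: "continuous_on UNIV (H i)" for i
    by (subst continuous_on_componentwise) (use cont[OF H(2)] in \<open>auto simp: Basis_vec_def inner_axis\<close>)
  show thesis
  proof (rule that[of G "\<lambda>x. \<Sum>i\<in>UNIV. H i x $ i"])
    show "C2 p G (\<lambda>x. \<Sum>i\<in>UNIV. H i x $ i)" unfolding C2_def using G H cH by blast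
    show "hpoly (n - 2) (\<lambda>x. \<Sum>i\<in>UNIV. H i x $ i)"
      using H(2) by (intro hpoly_sum) (simp add: numeral_2_eq_2)
    show "(\<lambda>x. \<Sum>i\<in>UNIV. H i x $ i) = (\<lambda>x. 0)" if "n < 2" using H(3) that by simp
  qed (rule G(3))
qed

text \<open>By Euler's identity the cross term 2 grad p . grad f(|x|^2) equals 4 n p f', which
  raises the coefficient 6 of the radial Laplacian to 6 + 4 n.\<close>

lemma hpoly_C2_radial:
  assumes f: "\<And>s. (f has_real_derivative f' s) (at s)" "\<And>s. (f' has_real_derivative f'' s) (at s)"
    "continuous_on UNIV f''" and p: "hpoly n p" "C2 p G (\<lambda>x. 0)" "\<And>x. x \<bullet> G x = real n * p x"
  shows "C2 (\<lambda>x. p x * f (x \<bullet> x)) (\<lambda>x. p x *\<^sub>R ((2 * f' (x \<bullet> x)) *\<^sub>R x) + f (x \<bullet> x) *\<^sub>R G x)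
    (\<lambda>x. p x * (4 * (x \<bullet> x) * f'' (x \<bullet> x) + (6 + 4 * real n) * f' (x \<bullet> x)))"
    and "x \<bullet> (p x *\<^sub>R ((2 * f' (x \<bullet> x)) *\<^sub>R x) + f (x \<bullet> x) *\<^sub>R G x)
      = p x * (real n * f (x \<bullet> x) + 2 * (x \<bullet> x) * f' (x \<bullet> x))"
   apply (rule C2_cong[OF C2_mult[OF p(2) C2_radial[OF f]]])
   apply (simp add: inner_commute[of "G _"] p(3) algebra_simps)
  apply (simp add: inner_add_right p(3) algebra_simps)
  done

section \<open>Decomposition into solid harmonics\<close>

text \<open>Sums of terms p(x) |x|^(2j) of total degree n with p a solid harmonic: the form in which
  the radial equations apply term by term.\<close>

inductive hdecomp :: "nat \<Rightarrow> (real^3 \<Rightarrow> real) \<Rightarrow> bool" where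
  harmonic: "hpoly n p \<Longrightarrow> C2 p G (\<lambda>x. 0) \<Longrightarrow> (\<And>x. x \<bullet> G x = real n * p x) \<Longrightarrow>
    hdecomp (n + 2 * j) (\<lambda>x. p x * (x \<bullet> x) ^ j)"
| add: "hdecomp n p \<Longrightarrow> hdecomp n q \<Longrightarrow> hdecomp n (\<lambda>x. p x + q x)"

text \<open>For p harmonic of degree n, the Laplacian of p |x|^(2j+2) is k p |x|^(2j) with k = 2 (j
  + 1) (2j + 2n + 3) > 0, so division by k inverts it within decomposed polynomials.\<close>

lemma hdecomp_inverse_laplacian:
  "hdecomp n f \<Longrightarrow> \<exists>u G. hdecomp (n + 2) u \<and> hpoly (n + 2) u \<and> C2 u G f"
proof (induction rule: hdecomp.induct)
  case (harmonic n p G j)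
  define k where "k = 4 * (real j + 1) * real j + (6 + 4 * real n) * (real j + 1)"
  have k: "k > 0" unfolding k_def by (rule add_nonneg_pos) (auto intro!: mult_pos_pos add_pos_nonneg)
  define q where "q = (\<lambda>x. (1 / k) * p x)"
  have q: "hpoly n q" "C2 q (\<lambda>x. (1 / k) *\<^sub>R G x) (\<lambda>x. 0)" "\<And>x. x \<bullet> ((1 / k) *\<^sub>R G x) = real n * q x"
    using hpoly_scale[OF harmonic(1), of "1 / k"] C2_scale[OF harmonic(2), of "1 / k"] harmonic(3)
    by (simp_all add: q_def)
  have "hdecomp (n + 2 * Suc j) (\<lambda>x. q x * (x \<bullet> x) ^ Suc j)" by (rule hdecomp.harmonic[OF q])
  moreover have "hpoly (n + 2 * Suc j) (\<lambda>x. q x * (x \<bullet> x) ^ Suc j)"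
    by (intro hpoly_mult q(1) hpoly_norm_power)
  moreover have "C2 (\<lambda>x. q x * (x \<bullet> x) ^ Suc j)
     (\<lambda>x. q x *\<^sub>R ((2 * ((real j + 1) * (x \<bullet> x) ^ j)) *\<^sub>R x) + (x \<bullet> x) ^ Suc j *\<^sub>R ((1 / k) *\<^sub>R G x)) (\<lambda>x. p x * (x \<bullet> x) ^ j)"
  proof (rule C2_cong[OF hpoly_C2_radial(1)[OF DERIV_power_twice _ q]])
    fix x :: "real^3"
    have s: "(x \<bullet> x) * (real j * (x \<bullet> x) ^ (j - 1)) = real j * (x \<bullet> x) ^ j" by (cases j) auto
    have "q x * (4 * (x \<bullet> x) * ((real j + 1) * (real j * (x \<bullet> x) ^ (j - 1))) + (6 + 4 * real n) * ((real j + 1) * (x \<bullet> x) ^ j))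
      = q x * (4 * (real j + 1) * ((x \<bullet> x) * (real j * (x \<bullet> x) ^ (j - 1))) + (6 + 4 * real n) * (real j + 1) * (x \<bullet> x) ^ j)"
      by (simp add: mult_ac)
    also have "\<dots> = q x * (k * (x \<bullet> x) ^ j)" unfolding s k_def by (simp add: algebra_simps)
    finally show "q x * (4 * (x \<bullet> x) * ((real j + 1) * (real j * (x \<bullet> x) ^ (j - 1))) + (6 + 4 * real n) * ((real j + 1) * (x \<bullet> x) ^ j))
      = p x * (x \<bullet> x) ^ j" using k by (simp add: q_def)
  qed (intro continuous_intros)
  moreover have "n + 2 * Suc j = n + 2 * j + 2" by simp
  ultimately show ?case by (intro exI conjI) auto
next
  case (add n p q)
  then obtain u G v K where "hdecomp (n + 2) u" "hpoly (n + 2) u" "C2 u G p" "hdecomp (n + 2) v" "hpoly (n + 2) v" "C2 v K q"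
    by blast
  then show ?case
    by (intro exI[of _ "\<lambda>x. u x + v x"] exI[of _ "\<lambda>x. G x + K x"]) (auto intro: hdecomp.add hpoly.add C2_add)
qed

text \<open>The Laplacian of p has degree n - 2 and is decomposed by induction. A decomposed u with
  the same Laplacian exists, and p - u is harmonic.\<close>

lemma hpoly_hdecomp: "hpoly n p \<Longrightarrow> hdecomp n p"
proof (induction n arbitrary: p rule: less_induct)
  case (less n)
  have harm: "hdecomp n q" if q: "hpoly n q" "C2 q K (\<lambda>x. 0)" for q K
  proof -
    obtain G L where "C2 q G L" and G: "\<And>x. x \<bullet> G x = real n * q x" using hpoly_C2[OF q(1)] by metis
    \<comment> \<open>Euler's identity is known for the gradient G from \<open>hpoly_C2\<close>;
      uniqueness of the derivative transfers it to the given K.\<close>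
    moreover have "G = K"
    proof
      fix x
      have "(\<lambda>h. G x \<bullet> h) = (\<lambda>h. K x \<bullet> h)"
        using \<open>C2 q G L\<close> q(2) has_derivative_unique unfolding C2_def by blast
      then show "G x = K x" by (metis vector_eq_ldot inner_commute)
    qed
    ultimately show ?thesis using hdecomp.harmonic[OF q, of 0] by simp
  qed
  obtain G L where GL: "C2 p G L" "hpoly (n - 2) L" "n < 2 \<Longrightarrow> L = (\<lambda>x. 0)" using hpoly_C2[OF less.prems] by metis
  show ?case
  proof (cases "n < 2")
    case True
    then show ?thesis using harm[OF less.prems] GL by simp
  next
    case False
    then have "hdecomp (n - 2) L" using less.IH GL(2) by simp
    then obtain u K where u: "hdecomp n u" "hpoly n u" "C2 u K L"
    proof -
      have "n - 2 + 2 = n" using False by simp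
      then show thesis
        using hdecomp_inverse_laplacian[OF \<open>hdecomp (n - 2) L\<close>] that by metis
    qed
    have "hpoly n (\<lambda>x. p x + (- 1) * u x)" by (intro hpoly.add less.prems hpoly_scale u)
    moreover have "C2 (\<lambda>x. p x + (- 1) * u x) (\<lambda>x. G x + (- 1) *\<^sub>R K x) (\<lambda>x. 0)"
      by (rule C2_cong[OF C2_add[OF GL(1) C2_scale[OF u(3)]]]) simp
    ultimately have "hdecomp n (\<lambda>x. p x + (- 1) * u x)" by (rule harm)
    from hdecomp.add[OF this u(1)] show ?thesis by simp
  qed
qed

theorem helmholtz_neumann_polynomial:
  assumes R: "R > 0" and nu: "\<nu> \<noteq> 0" and nr: "\<And>n. deriv (psi n) (\<nu> * R) \<noteq> 0" and p: "hpoly n p"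
  shows "\<exists>v G L. C2 v G L \<and> (\<forall>x. L x + \<nu>\<^sup>2 * v x = p x) \<and> (\<forall>x. norm x = R \<longrightarrow> x \<bullet> G x = 0)"
  using hpoly_hdecomp[OF p]
proof (induction rule: hdecomp.induct)
  case (harmonic n p G j)
  \<comment> \<open>On |x| = R the radial derivative x . grad of p f(|x|^2) is p (n f(R^2) + 2 R^2
    f'(R^2)), hence this condition on f.\<close>
  obtain f f' f'' where f: "radial_solution n (\<nu>\<^sup>2) (\<lambda>s. s ^ j) f f' f''"
    "real n * f (R\<^sup>2) + 2 * R\<^sup>2 * f' (R\<^sup>2) = 0"
    using radial_solution_neumann[OF R nu nr] by blast
  have f1: "\<And>s. (f has_real_derivative f' s) (at s)" "\<And>s. (f' has_real_derivative f'' s) (at s)"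
    "continuous_on UNIV f''" and ode: "\<And>s. 4 * s * f'' s + (6 + 4 * real n) * f' s + \<nu>\<^sup>2 * f s = s ^ j"
    using f(1) by (auto simp: radial_solution_def)
  note r = hpoly_C2_radial[OF f1 harmonic]
  show ?case
  proof (intro exI conjI allI impI, rule r(1))
    fix x :: "real^3"
    show "p x * (4 * (x \<bullet> x) * f'' (x \<bullet> x) + (6 + 4 * real n) * f' (x \<bullet> x)) + \<nu>\<^sup>2 * (p x * f (x \<bullet> x)) = p x * (x \<bullet> x) ^ j"
      unfolding ode[of "x \<bullet> x", symmetric] by (simp add: algebra_simps)
    assume "norm x = R"
    then have "x \<bullet> x = R\<^sup>2" by (simp add: dot_square_norm)
    then show "x \<bullet> (p x *\<^sub>R ((2 * f' (x \<bullet> x)) *\<^sub>R x) + f (x \<bullet> x) *\<^sub>R G x) = 0"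
      unfolding r(2) using f(2) by simp
  qed
next
  case (add n p q)
  then obtain v G L w K M where v: "C2 v G L" "\<And>x. L x + \<nu>\<^sup>2 * v x = p x" "\<And>x. norm x = R \<Longrightarrow> x \<bullet> G x = 0"
    and w: "C2 w K M" "\<And>x. M x + \<nu>\<^sup>2 * w x = q x" "\<And>x. norm x = R \<Longrightarrow> x \<bullet> K x = 0" by blast
  show ?case
  proof (intro exI conjI allI impI, rule C2_add[OF v(1) w(1)])
    show "L x + M x + \<nu>\<^sup>2 * (v x + w x) = p x + q x" for x
      using v(2)[of x] w(2)[of x] by (simp add: algebra_simps)
    show "x \<bullet> (G x + K x) = 0" if "norm x = R" for x
      using v(3)[OF that] w(3)[OF that] by (simp add: inner_add_right)
  qed
qed

section \<open>Polynomials are dense\<close>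

text \<open>All polynomials, as sums of homogeneous ones: the link between the Helmholtz problem,
  solved by degree, and the Stone-Weierstrass theorem.\<close>

inductive poly_sum :: "(real^3 \<Rightarrow> real) \<Rightarrow> bool" where
  homogeneous: "hpoly n p \<Longrightarrow> poly_sum p"
| add: "poly_sum p \<Longrightarrow> poly_sum q \<Longrightarrow> poly_sum (\<lambda>x. p x + q x)"

lemma poly_sum_mult_hpoly: "poly_sum q \<Longrightarrow> hpoly n p \<Longrightarrow> poly_sum (\<lambda>x. p x * q x)"
proof (induction rule: poly_sum.induct)
  case (homogeneous m q)
  then show ?case using hpoly_mult poly_sum.homogeneous by blast
next
  case (add q r)
  then show ?case using poly_sum.add[of "\<lambda>x. p x * q x" "\<lambda>x. p x * r x"] by (simp add: distrib_left)
qed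

lemma poly_sum_mult: "poly_sum p \<Longrightarrow> poly_sum q \<Longrightarrow> poly_sum (\<lambda>x. p x * q x)"
proof (induction rule: poly_sum.induct)
  case (homogeneous n p)
  then show ?case using poly_sum_mult_hpoly by blast
next
  case (add p r)
  then show ?case using poly_sum.add[of "\<lambda>x. p x * q x" "\<lambda>x. r x * q x"] by (simp add: distrib_right)
qed

lemma linear_axis_expansion:
  fixes D :: "real^3 \<Rightarrow> 'b::real_vector"
  assumes "linear D"
  shows "D h = (\<Sum>k\<in>UNIV. h $ k *\<^sub>R D (axis k 1))"
proof -
  have "h = (\<Sum>k\<in>UNIV. h $ k *\<^sub>R axis k 1)"
    using basis_expansion[of h] by (simp add: scalar_mult_eq_scaleR)
  then have "D h = D (\<Sum>k\<in>UNIV. h $ k *\<^sub>R axis k 1)" by simp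
  also have "\<dots> = (\<Sum>k\<in>UNIV. h $ k *\<^sub>R D (axis k 1))"
    using assms by (simp add: linear_sum linear_scale)
  finally show ?thesis .
qed

lemma real_polynomial_function_poly_sum:
  fixes f :: "real^3 \<Rightarrow> real"
  shows "real_polynomial_function f \<Longrightarrow> poly_sum f"
proof (induction rule: real_polynomial_function.induct)
  case (linear f)
  have "hpoly 1 (\<lambda>x. x $ k * f (axis k 1))" for k
    using hpoly.coord[OF hpoly.const[of "f (axis k 1)"], of k] by simp
  then have p: "hpoly 1 (\<lambda>x. \<Sum>k\<in>UNIV. x $ k * f (axis k 1))" by (intro hpoly_sum)
  have f: "f = (\<lambda>x. \<Sum>k\<in>UNIV. x $ k * f (axis k 1))"
    by (rule ext) (rule linear_axis_expansion[OF bounded_linear.linear[OF linear], unfolded real_scaleR_def])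
  show ?case by (subst f) (rule poly_sum.homogeneous[OF p])
next
  case (const a)
  show ?case by (rule poly_sum.homogeneous[OF hpoly.const])
qed (auto intro: poly_sum.add poly_sum_mult)

lemma hpoly_continuous: "hpoly n p \<Longrightarrow> continuous_on S p"
  by (induction rule: hpoly.induct) (auto intro!: continuous_intros)

lemma poly_sum_continuous: "poly_sum p \<Longrightarrow> continuous_on S p"
  by (induction rule: poly_sum.induct) (auto intro: continuous_on_add hpoly_continuous)

text \<open>For a polynomial f uniformly close to g, the integral of g^2 equals that of g (g - f),
  hence is at most sup |g - f| times the integral of |g|. The polynomials are centred at c to match
  the Helmholtz solutions.\<close>

lemma orthogonal_to_polynomials_zero:
  assumes g: "continuous_on (cball c R) g"
    and orth: "\<And>n p. hpoly n p \<Longrightarrow> (LINT x|lebesgue_on (ball c R). g x * p (x - c)) = 0"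
  shows "ip (ball c R) g g = 0"
proof -
  let ?M = "lebesgue_on (ball c R)"
  have cp: "continuous_on S (\<lambda>x. p (x - c))" if "poly_sum p" for p and S :: "(real^3) set"
    by (rule continuous_on_compose2[OF poly_sum_continuous[OF that, of UNIV]]) (auto intro!: continuous_intros)
  have orth': "(LINT x|?M. g x * p (x - c)) = 0" if "poly_sum p" for p
    using that
  proof (induction rule: poly_sum.induct)
    case (homogeneous n p)
    then show ?case by (rule orth)
  next
    case (add p q)
    have "integrable ?M (\<lambda>x. g x * p (x - c))" "integrable ?M (\<lambda>x. g x * q (x - c))"
      using add by (auto intro!: integrable_ball_continuous continuous_intros g cp)
    then show ?case using add.IH by (simp add: distrib_left)
  qed
  define A where "A = (LINT x|?M. \<bar>g x\<bar>)"
  have "ip (ball c R) g g \<le> 0"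
  proof (rule field_le_epsilon)
    fix e :: real assume e: "e > 0"
    have A: "A \<ge> 0" by (simp add: A_def)
    have "continuous_on (cball 0 R) (\<lambda>y. g (c + y))"
      by (rule continuous_on_compose2[OF g]) (auto intro!: continuous_intros simp: dist_norm)
    then obtain f where f: "real_polynomial_function f" "\<And>y. y \<in> cball 0 R \<Longrightarrow> \<bar>g (c + y) - f y\<bar> < e / (A + 1)"
      using Stone_Weierstrass_real_polynomial_function[OF compact_cball, of 0 R "\<lambda>y. g (c + y)" "e / (A + 1)"] e A
      by (auto simp: add_nonneg_pos)
    have fp: "poly_sum f" using f(1) by (rule real_polynomial_function_poly_sum)
    have "ip (ball c R) g g = (LINT x|?M. g x * (g x - f (x - c)))"
    proof -
      have "integrable ?M (\<lambda>x. g x * g x)" "integrable ?M (\<lambda>x. g x * f (x - c))"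
        by (auto intro!: integrable_ball_continuous continuous_intros g cp fp)
      then show ?thesis using orth'[OF fp] by (simp add: ip_def right_diff_distrib)
    qed
    also have "\<dots> \<le> (LINT x|?M. \<bar>g x\<bar> * (e / (A + 1)))"
    proof (intro integral_mono integrable_ball_continuous continuous_intros g cp fp)
      fix x assume "x \<in> space ?M"
      then have "x - c \<in> cball 0 R" by (simp add: dist_norm norm_minus_commute)
      from f(2)[OF this] have "\<bar>g x - f (x - c)\<bar> \<le> e / (A + 1)" by simp
      then have "\<bar>g x\<bar> * \<bar>g x - f (x - c)\<bar> \<le> \<bar>g x\<bar> * (e / (A + 1))" by (intro mult_left_mono) auto
      then show "g x * (g x - f (x - c)) \<le> \<bar>g x\<bar> * (e / (A + 1))"
        by (metis abs_ge_self abs_mult order_trans)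
    qed
    also have "\<dots> = A * (e / (A + 1))" by (simp add: A_def)
    also have "\<dots> \<le> e" using e A by (simp add: field_simps)
    finally show "ip (ball c R) g g \<le> 0 + e" by simp
  qed
  then show ?thesis using ip_nonneg[of "ball c R" g] by simp
qed

section \<open>Eigenfields\<close>

text \<open>Smoothness on the closed ball makes the partial derivatives agree inside with functions
  P continuous up to the sphere. Q and g are built from P, so that they have boundary values even
  where \<open>divergence q\<close> is not controlled.\<close>

lemma eigenfield_C1:
  assumes R: "R > 0" and q: "smooth_closure (ball c R) q"
    and eig: "\<And>x. x \<in> ball c R \<Longrightarrow> - grad (divergence q) x = mu *\<^sub>R q x"
  obtains Q g where "\<And>i. C1 c R (\<lambda>x. q x $ i) (Q i)" "\<And>x. g x = (\<Sum>i\<in>UNIV. Q i x $ i)"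
    "C1 c R g (\<lambda>x. - mu *\<^sub>R q x)"
proof -
  let ?U = "ball c R"
  have cl: "closure ?U = cball c R" using R by simp
  have cq: "continuous_on (cball c R) q" using q cl by (simp add: smooth_closure_def)
  \<comment> \<open>Order two is what is used: the first derivatives must extend to the closed ball
    and be differentiable inside, so that div q is.\<close>
  have "Ck_closure (Suc (Suc 0)) ?U q" using q unfolding smooth_closure_def by blast
  then have dq: "q differentiable_on ?U"
    and extend: "\<And>i. \<exists>P. continuous_on (cball c R) P \<and> (\<forall>x\<in>?U. P x = pderiv_at i q x)"
    and dp: "\<And>i. pderiv_at i q differentiable_on ?U"
    using cl by auto
  have "\<forall>i. \<exists>P. continuous_on (cball c R) P \<and> (\<forall>x\<in>?U. P x = pderiv_at i q x)" using extend by blast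
  from choice[OF this] obtain P where "\<forall>i. continuous_on (cball c R) (P i) \<and> (\<forall>x\<in>?U. P i x = pderiv_at i q x)" ..
  then have P: "\<And>i. continuous_on (cball c R) (P i)" "\<And>i x. x \<in> ?U \<Longrightarrow> P i x = pderiv_at i q x" by blast+
  define Q where "Q = (\<lambda>i x. \<chi> k. P k x $ i)"
  define g where "g = (\<lambda>x. \<Sum>i\<in>UNIV. Q i x $ i)"
  have "C1 c R (\<lambda>x. q x $ i) (Q i)" for i
    unfolding C1_def
  proof (intro conjI ballI)
    show "continuous_on (cball c R) (\<lambda>x. q x $ i)" by (intro continuous_intros cq)
    show "continuous_on (cball c R) (Q i)" unfolding Q_def by (intro continuous_intros P)
    fix x assume x: "x \<in> ?U"
    define D where "D = frechet_derivative q (at x)"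
    have D: "(q has_derivative D) (at x)"
      using dq x unfolding D_def by (simp add: frechet_derivative_works[symmetric] differentiable_on_eq_differentiable_at)
    have "D h $ i = Q i x \<bullet> h" for h
    proof -
      have "D h = (\<Sum>k\<in>UNIV. h $ k *\<^sub>R pderiv_at k q x)"
        unfolding pderiv_at_def D_def[symmetric]
        by (rule linear_axis_expansion[OF has_derivative_linear[OF D]])
      then show ?thesis using P(2)[OF x] by (simp add: Q_def inner_vec_def mult.commute)
    qed
    then show "((\<lambda>x. q x $ i) has_derivative (\<lambda>h. Q i x \<bullet> h)) (at x)"
      using bounded_linear.has_derivative[OF bounded_linear_vec_nth D, of i] by simp
  qed
  moreover have "C1 c R g (\<lambda>x. - mu *\<^sub>R q x)"
    unfolding C1_def
  proof (intro conjI ballI)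
    show "continuous_on (cball c R) g" unfolding g_def Q_def by (auto intro!: continuous_intros P)
    show "continuous_on (cball c R) (\<lambda>x. - mu *\<^sub>R q x)" by (intro continuous_intros cq)
    fix x assume x: "x \<in> ?U"
    define D where "D = frechet_derivative (divergence q) (at x)"
    have dpx: "pderiv_at i q differentiable at x" for i
      using dp[of i] x by (simp add: differentiable_on_eq_differentiable_at)
    have "(\<lambda>x. pderiv_at i q x $ i) differentiable at x" for i
      using bounded_linear.has_derivative[OF bounded_linear_vec_nth] dpx[of i] unfolding differentiable_def by blast
    then have "divergence q differentiable at x"
      unfolding divergence_def by (intro differentiable_sum) auto
    then have D: "(divergence q has_derivative D) (at x)"
      by (simp add: D_def frechet_derivative_works[symmetric])
    have "D h = - mu *\<^sub>R q x \<bullet> h" for h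
    proof -
      have "D h = (\<Sum>k\<in>UNIV. h $ k *\<^sub>R pderiv_at k (divergence q) x)"
        unfolding pderiv_at_def D_def[symmetric]
        by (rule linear_axis_expansion[OF has_derivative_linear[OF D]])
      also have "\<dots> = grad (divergence q) x \<bullet> h" by (simp add: grad_def inner_vec_def mult.commute)
      also have "grad (divergence q) x = - mu *\<^sub>R q x" by (simp add: eig[OF x, symmetric])
      finally show ?thesis .
    qed
    then have "D = (\<lambda>h. - mu *\<^sub>R q x \<bullet> h)" by (rule ext)
    with D have "(divergence q has_derivative (\<lambda>h. - mu *\<^sub>R q x \<bullet> h)) (at x)" by simp
    then show "(g has_derivative (\<lambda>h. - mu *\<^sub>R q x \<bullet> h)) (at x)"
      by (rule has_derivative_transform_within_open[OF _ open_ball x])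
         (simp add: g_def Q_def divergence_def P(2))
  qed
  ultimately show thesis using that[of Q g] g_def by simp
qed

lemma C2_shift_C1:
  assumes "C2 v G L"
  obtains H where "C1 c R (\<lambda>x. v (x - c)) (\<lambda>x. G (x - c))" "\<And>i. C1 c R (\<lambda>x. G (x - c) $ i) (H i)"
    "\<And>x. L (x - c) = (\<Sum>i\<in>UNIV. H i x $ i)"
proof -
  obtain H where v: "\<And>x. (v has_derivative (\<lambda>h. G x \<bullet> h)) (at x)"
    and G: "\<And>i x. ((\<lambda>x. G x $ i) has_derivative (\<lambda>h. H i x \<bullet> h)) (at x)"
    and H: "\<And>i. continuous_on UNIV (H i)" "\<And>x. L x = (\<Sum>i\<in>UNIV. H i x $ i)"
    using assms unfolding C2_def by blast
  have shift: "((\<lambda>x. f (x - c)) has_derivative (\<lambda>h. F (x - c) \<bullet> h)) (at x)"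
    if "\<And>x. (f has_derivative (\<lambda>h. F x \<bullet> h)) (at x)" for f and F :: "real^3 \<Rightarrow> real^3" and x
  proof -
    have "((\<lambda>x. x - c) has_derivative (\<lambda>h. h)) (at x)" by (auto intro!: derivative_eq_intros)
    from has_derivative_compose[OF this that] show ?thesis .
  qed
  have cont: "continuous_on S (\<lambda>x. f (x - c))" if "continuous_on UNIV f" for f :: "real^3 \<Rightarrow> 'c::real_normed_vector" and S
    by (rule continuous_on_compose2[OF that]) (auto intro!: continuous_intros)
  have c1: "continuous_on UNIV f" if "\<And>x. (f has_derivative (\<lambda>h. F x \<bullet> h)) (at x)" for f :: "real^3 \<Rightarrow> real" and F
    using that by (meson continuous_at_imp_continuous_on has_derivative_continuous)
  have cG: "continuous_on UNIV G"
    by (subst continuous_on_componentwise) (use c1[OF G] in \<open>auto simp: Basis_vec_def inner_axis\<close>)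
  show thesis
  proof (rule that[of "\<lambda>i x. H i (x - c)"])
    show "C1 c R (\<lambda>x. v (x - c)) (\<lambda>x. G (x - c))"
      unfolding C1_def using shift[OF v] cont[OF c1[OF v]] cont[OF cG] by blast
    show "C1 c R (\<lambda>x. G (x - c) $ i) (\<lambda>x. H i (x - c))" for i
      unfolding C1_def using shift[OF G] cont[OF c1[OF G]] cont[OF H(1)] by blast
  qed (rule H(2))
qed

text \<open>Testing with \<open>v\<close> such that \<open>(\<Delta> + \<nu>\<^sup>2) v = p\<close> and \<open>\<partial>v/\<partial>n = 0\<close> shows that \<open>div q\<close> is orthogonal
  to every polynomial \<open>p\<close>.\<close>

theorem nonresonant_eigenfield_zero:
  assumes R: "R > 0" and nr: "\<And>n. deriv (psi n) (\<nu> * R) \<noteq> 0"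
    and q: "\<And>i. C1 c R (\<lambda>x. q x $ i) (Q i)" and g: "\<And>x. g x = (\<Sum>i\<in>UNIV. Q i x $ i)"
    and gq: "C1 c R g (\<lambda>x. - (\<nu>\<^sup>2) *\<^sub>R q x)"
    and tang: "\<And>x. x \<in> sphere c R \<Longrightarrow> (x - c) \<bullet> q x = 0"
  shows "ip (ball c R) q q = 0"
proof -
  let ?M = "lebesgue_on (ball c R)"
  have nu: "\<nu> \<noteq> 0" using nr[of 0] deriv_psi_0_at_0 by auto
  have cg: "continuous_on (cball c R) g" using gq by (simp add: C1_def)
  have "ip (ball c R) g g = 0"
  proof (rule orthogonal_to_polynomials_zero[OF cg])
    fix n p assume "hpoly n p"
    then obtain v G L where v: "C2 v G L" "\<And>x. L x + \<nu>\<^sup>2 * v x = p x" "\<And>x. norm x = R \<Longrightarrow> x \<bullet> G x = 0"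
      using helmholtz_neumann_polynomial[OF R nu nr] by blast
    obtain H where H: "C1 c R (\<lambda>x. v (x - c)) (\<lambda>x. G (x - c))" "\<And>i. C1 c R (\<lambda>x. G (x - c) $ i) (H i)"
      "\<And>x. L (x - c) = (\<Sum>i\<in>UNIV. H i x $ i)" using C2_shift_C1[OF v(1)] by blast
    \<comment> \<open>Green's formula is used for g against grad v and for v against q; both fields
      are tangential, the first by the Neumann condition.\<close>
    have "(LINT x|?M. (- (\<nu>\<^sup>2) *\<^sub>R q x) \<bullet> G (x - c)) = - (LINT x|?M. g x * L (x - c))"
      unfolding H(3)
      by (rule green[OF R gq H(2)]) (use v(3) in \<open>simp add: dist_norm norm_minus_commute\<close>)
    moreover have "(LINT x|?M. G (x - c) \<bullet> q x) = - (LINT x|?M. v (x - c) * g x)"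
      unfolding g by (rule green[OF R H(1) q tang])
    ultimately have "(LINT x|?M. g x * L (x - c)) + \<nu>\<^sup>2 * (LINT x|?M. v (x - c) * g x) = 0"
      by (simp add: inner_commute)
    moreover have "(LINT x|?M. g x * p (x - c)) = (LINT x|?M. g x * L (x - c)) + \<nu>\<^sup>2 * (LINT x|?M. v (x - c) * g x)"
    proof -
      have "continuous_on (cball c R) (\<lambda>x. L (x - c))"
        unfolding H(3) using H(2) by (intro continuous_intros) (simp add: C1_def)
      then have 1: "integrable ?M (\<lambda>x. g x * L (x - c))"
        by (intro integrable_ball_continuous continuous_intros cg)
      have 2: "integrable ?M (\<lambda>x. \<nu>\<^sup>2 * (v (x - c) * g x))"
        by (intro integrable_ball_continuous continuous_intros cg) (use H(1) in \<open>simp add: C1_def\<close>)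
      have "(LINT x|?M. g x * p (x - c)) = (LINT x|?M. g x * L (x - c) + \<nu>\<^sup>2 * (v (x - c) * g x))"
        by (simp add: v(2)[symmetric] algebra_simps)
      also have "\<dots> = (LINT x|?M. g x * L (x - c)) + (LINT x|?M. \<nu>\<^sup>2 * (v (x - c) * g x))"
        by (rule Bochner_Integration.integral_add[OF 1 2])
      finally show ?thesis by simp
    qed
    ultimately show "(LINT x|?M. g x * p (x - c)) = 0" by simp
  qed
  \<comment> \<open>Green's formula for g against q: \<nu>^2 times the square norm of q is that of
    g, which vanishes.\<close>
  moreover have "(LINT x|?M. (- (\<nu>\<^sup>2) *\<^sub>R q x) \<bullet> q x) = - (LINT x|?M. g x * g x)"
    unfolding g[of "_"] using green[OF R gq q tang] by (simp add: g)
  ultimately show ?thesis using nu by (simp add: ip_def)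
qed

section \<open>Test functions and weak gradients\<close>

lemma test_function_C1:
  fixes \<phi> :: "real^3 \<Rightarrow> real"
  assumes "\<phi> \<in> test_functions (ball c R)"
  shows "C1 c R \<phi> (\<lambda>x. \<chi> i. pderiv_at i \<phi> x)" "\<And>x. x \<in> sphere c R \<Longrightarrow> \<phi> x = 0"
proof -
  have "Ck_on (Suc 0) UNIV \<phi>" using assms unfolding test_functions_def by blast
  then have c: "continuous_on UNIV \<phi>" "\<And>i. continuous_on UNIV (pderiv_at i \<phi>)" and d: "\<phi> differentiable_on UNIV" by auto
  show "C1 c R \<phi> (\<lambda>x. \<chi> i. pderiv_at i \<phi> x)"
    unfolding C1_def
  proof (intro conjI ballI)
    show "continuous_on (cball c R) \<phi>" using c(1) continuous_on_subset by blast
    show "continuous_on (cball c R) (\<lambda>x. \<chi> i. pderiv_at i \<phi> x)"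
      using c(2) by (intro continuous_on_vec_lambda) (meson continuous_on_subset subset_UNIV)
    fix x
    define D where "D = frechet_derivative \<phi> (at x)"
    have D: "(\<phi> has_derivative D) (at x)"
      using d by (simp add: D_def frechet_derivative_works[symmetric] differentiable_on_def)
    have "D h = (\<chi> i. pderiv_at i \<phi> x) \<bullet> h" for h
      using linear_axis_expansion[OF has_derivative_linear[OF D], of h]
      by (simp add: pderiv_at_def D_def[symmetric] inner_vec_def mult.commute)
    then have "D = (\<lambda>h. (\<chi> i. pderiv_at i \<phi> x) \<bullet> h)" by (rule ext)
    with D show "(\<phi> has_derivative (\<lambda>h. (\<chi> i. pderiv_at i \<phi> x) \<bullet> h)) (at x)" by simp
  qed
  show "\<phi> x = 0" if "x \<in> sphere c R" for x
    using assms that unfolding test_functions_def by fastforce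
qed

text \<open>Green's formula for h against the field \<phi> e_i, which vanishes on the sphere and has
  the i-th partial derivative of \<phi> as divergence.\<close>

lemma weak_grad_C1:
  assumes R: "R > 0" and h: "C1 c R h H"
  shows "weak_grad (ball c R) h H"
  unfolding weak_grad_def
proof (intro ballI allI)
  fix \<phi> :: sfield and i :: 3
  assume "\<phi> \<in> test_functions (ball c R)"
  note \<phi> = test_function_C1[OF this]
  let ?P = "\<lambda>x. \<chi> i. pderiv_at i \<phi> x"
  have "(LINT x|lebesgue_on (ball c R). H x \<bullet> (\<phi> x *\<^sub>R axis i 1))
      = - (LINT x|lebesgue_on (ball c R). h x * (\<Sum>k\<in>UNIV. (axis i 1 $ k *\<^sub>R ?P x) $ k))"
  proof (rule green[OF R h])
    show "C1 c R (\<lambda>x. (\<phi> x *\<^sub>R axis i 1) $ k) (\<lambda>x. axis i 1 $ k *\<^sub>R ?P x)" for k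
      using C1_scale[OF \<phi>(1), of "axis i 1 $ k"] by (simp add: mult.commute)
  qed (simp add: \<phi>(2))
  moreover have "(\<Sum>k\<in>UNIV. (axis i 1 $ k *\<^sub>R ?P x) $ k) = pderiv_at i \<phi> x" for x
    by (simp add: axis_def if_distrib[of "\<lambda>a. a * _"] cong: if_cong)
  ultimately show "(LINT x|lebesgue_on (ball c R). h x * pderiv_at i \<phi> x) = - (LINT x|lebesgue_on (ball c R). H x $ i * \<phi> x)"
    by (simp add: inner_axis mult.commute)
qed

text \<open>For a fixed test function both sides of the defining identity are L^2 pairings with
  fixed functions, hence continuous under convergence in norm.\<close>

lemma weak_grad_limit:
  fixes h :: "nat \<Rightarrow> sfield"
  assumes R: "R > 0" and h: "\<And>n. h n \<in> L2 (ball c R)" "h' \<in> L2 (ball c R)"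
    and u: "\<And>n. u n \<in> L2 (ball c R)" "u' \<in> L2 (ball c R)"
    and w: "\<And>n. weak_grad (ball c R) (h n) (u n)"
    and lh: "(\<lambda>n. ip (ball c R) (\<lambda>x. h' x - h n x) (\<lambda>x. h' x - h n x)) \<longlonglongrightarrow> 0"
    and lu: "(\<lambda>n. ip (ball c R) (\<lambda>x. u' x - u n x) (\<lambda>x. u' x - u n x)) \<longlonglongrightarrow> 0"
  shows "weak_grad (ball c R) h' u'"
  unfolding weak_grad_def
proof (intro ballI allI)
  fix \<phi> :: sfield and i :: 3
  assume \<phi>': "\<phi> \<in> test_functions (ball c R)"
  note \<phi> = test_function_C1[OF this]
  have "continuous_on (cball c R) (\<lambda>x. (\<chi> i. pderiv_at i \<phi> x) $ i)"
    by (rule continuous_on_component) (use \<phi>(1) in \<open>simp add: C1_def\<close>)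
  then have p: "(\<lambda>x. pderiv_at i \<phi> x) \<in> L2 (ball c R)" by (intro L2_ball_continuous) simp
  have f: "(\<lambda>x. \<phi> x *\<^sub>R axis i 1 :: real^3) \<in> L2 (ball c R)"
    by (intro L2_ball_continuous continuous_intros) (use \<phi>(1) in \<open>simp add: C1_def\<close>)
  have eq: "ip (ball c R) (h n) (\<lambda>x. pderiv_at i \<phi> x) = - ip (ball c R) (u n) (\<lambda>x. \<phi> x *\<^sub>R axis i 1)" for n
    using w[of n] \<phi>' by (simp add: weak_grad_def ip_def inner_axis mult.commute)
  have "(\<lambda>n. ip (ball c R) (h n) (\<lambda>x. pderiv_at i \<phi> x)) \<longlonglongrightarrow> ip (ball c R) h' (\<lambda>x. pderiv_at i \<phi> x)"
    by (rule ip_tendsto[OF h p lh])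
  moreover have "(\<lambda>n. ip (ball c R) (h n) (\<lambda>x. pderiv_at i \<phi> x)) \<longlonglongrightarrow> - ip (ball c R) u' (\<lambda>x. \<phi> x *\<^sub>R axis i 1)"
    unfolding eq by (intro tendsto_minus ip_tendsto[OF u f lu])
  ultimately have "ip (ball c R) h' (\<lambda>x. pderiv_at i \<phi> x) = - ip (ball c R) u' (\<lambda>x. \<phi> x *\<^sub>R axis i 1)"
    by (rule LIMSEQ_unique)
  then show "(LINT x|lebesgue_on (ball c R). h' x * pderiv_at i \<phi> x) = - (LINT x|lebesgue_on (ball c R). u' x $ i * \<phi> x)"
    by (simp add: ip_def inner_axis mult.commute)
qed

section \<open>The orthonormal basis of eigenfields\<close>

lemma L2_sums_ip: "L2_sums B F g \<longleftrightarrow> g \<in> L2 B \<and>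
    (\<lambda>n. ip B (\<lambda>x. g x - (\<Sum>j<n. F j x)) (\<lambda>x. g x - (\<Sum>j<n. F j x))) \<longlonglongrightarrow> 0"
proof -
  let ?s = "\<lambda>n. ip B (\<lambda>x. g x - (\<Sum>j<n. F j x)) (\<lambda>x. g x - (\<Sum>j<n. F j x))"
  have "(\<lambda>n. sqrt (?s n)) \<longlonglongrightarrow> 0 \<longleftrightarrow> ?s \<longlonglongrightarrow> 0"
  proof
    assume "(\<lambda>n. sqrt (?s n)) \<longlonglongrightarrow> 0"
    then have "(\<lambda>n. (sqrt (?s n))\<^sup>2) \<longlonglongrightarrow> 0\<^sup>2" by (rule tendsto_power)
    then show "?s \<longlonglongrightarrow> 0" by (simp add: ip_nonneg)
  next
    assume "?s \<longlonglongrightarrow> 0"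
    then show "(\<lambda>n. sqrt (?s n)) \<longlonglongrightarrow> 0" using tendsto_real_sqrt by fastforce
  qed
  then show ?thesis by (simp add: L2_sums_def L2_norm_def L2_inner_eq_ip)
qed

lemma eq_aeI:
  assumes "u \<in> L2 B" "v \<in> L2 B" "ip B (\<lambda>x. u x - v x) (\<lambda>x. u x - v x) = 0"
  shows "eq_ae B u v"
  using ip_eq_0_AE[OF L2_diff[OF assms(1,2)] assms(3)] by (simp add: eq_ae_def)

lemma eq_ae_sym: "eq_ae B u v \<Longrightarrow> eq_ae B v u"
  unfolding eq_ae_def by (auto elim: AE_mp)

lemma eq_ae_trans: "eq_ae B u v \<Longrightarrow> eq_ae B v w \<Longrightarrow> eq_ae B u w"
  unfolding eq_ae_def by (auto elim: AE_mp)

lemma ip_cong_eq_ae: "eq_ae B u v \<Longrightarrow> u \<in> L2 B \<Longrightarrow> v \<in> L2 B \<Longrightarrow> z \<in> L2 B \<Longrightarrow> ip B u z = ip B v z"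
  using ip_cong_AE[of u B v z] by (simp add: eq_ae_def)

lemma V0_iff: "v \<in> V0 B \<longleftrightarrow> v \<in> L2 B \<and> (\<forall>u\<in>A_space B. ip B v u = 0)"
  by (simp add: V0_def L2_inner_eq_ip)

lemma A_space_L2: "u \<in> A_space B \<Longrightarrow> u \<in> L2 B"
  by (simp add: A_space_def)

lemma V0_diff: "u \<in> V0 B \<Longrightarrow> v \<in> V0 B \<Longrightarrow> (\<lambda>x. u x - v x) \<in> V0 B"
  by (auto simp: V0_iff L2_diff ip_diff_left A_space_L2)

lemma V0_scale: "v \<in> V0 B \<Longrightarrow> (\<lambda>x. a *\<^sub>R v x) \<in> V0 B"
  by (auto simp: V0_iff L2_scale ip_scale_left)

lemma W_space_V0: "v \<in> W_space B m \<Longrightarrow> v \<in> V0 B"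
  by (cases m) auto

lemma W_space_scale: "v \<in> W_space B m \<Longrightarrow> (\<lambda>x. a *\<^sub>R v x) \<in> W_space B m"
proof (induction m arbitrary: v)
  case 0
  then show ?case by (simp add: V0_scale)
next
  case (Suc m)
  then obtain g where g: "v \<in> V0 B" "g \<in> W_space B m" "weak_rot B v g" by auto
  have "weak_rot B (\<lambda>x. a *\<^sub>R v x) (\<lambda>x. a *\<^sub>R g x)"
    using g(3) by (simp add: weak_rot_def L2_inner_eq_ip ip_scale_left)
  then show ?case using V0_scale[OF g(1)] Suc.IH[OF g(2)] by auto
qed

locale graddiv_basis =
  fixes c :: "real^3" and R :: real and q :: "nat \<Rightarrow> vfield" and \<nu>s :: "nat \<Rightarrow> real"
  assumes R: "R > 0" and basis: "graddiv_eigenbasis c R q \<nu>s"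
begin

abbreviation "B \<equiv> ball c R"

lemma q_A: "q j \<in> A_space B"
  and q_orth: "ip B (q i) (q j) = (if i = j then 1 else 0)"
  and q_complete: "u \<in> A_space B \<Longrightarrow> L2_sums B (\<lambda>j x. ip B u (q j) *\<^sub>R q j x) u"
  and q_smooth: "smooth_closure B (q j)"
  and q_eigen: "x \<in> B \<Longrightarrow> - grad (divergence (q j)) x = (\<nu>s j)\<^sup>2 *\<^sub>R q j x"
  using basis unfolding graddiv_eigenbasis_def L2_inner_eq_ip by blast+

lemma q_tangential: "x \<in> sphere c R \<Longrightarrow> (x - c) \<bullet> q j x = 0"
  using basis R unfolding graddiv_eigenbasis_def by fastforce

lemma q_L2: "q j \<in> L2 B"
  using q_A A_space_L2 by blast

lemma eigenvalue_pos: "(\<nu>s j)\<^sup>2 > 0" and eigenvalue_ge: "(\<nu>s 0)\<^sup>2 \<le> (\<nu>s j)\<^sup>2"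
proof -
  have "0 < (\<nu>s 0)\<^sup>2" and "\<And>j. (\<nu>s j)\<^sup>2 \<le> (\<nu>s (Suc j))\<^sup>2"
    using basis unfolding graddiv_eigenbasis_def by blast+
  then show "(\<nu>s 0)\<^sup>2 \<le> (\<nu>s j)\<^sup>2" by (induction j) (auto intro: order_trans)
  with \<open>0 < (\<nu>s 0)\<^sup>2\<close> show "(\<nu>s j)\<^sup>2 > 0" by linarith
qed

section \<open>Divergences of the eigenfields and the spectral gap\<close>

text \<open>The divergence of \<open>q j\<close> inside the ball, extended continuously to the
  sphere as in \<open>eigenfield_C1\<close>. The trace clause keeps it tied to the gradients of the
  components of \<open>q j\<close>, as Green's formula needs.\<close>

definition eigen_div :: "nat \<Rightarrow> sfield" where
  "eigen_div j = (SOME g. C1 c R g (\<lambda>x. - ((\<nu>s j)\<^sup>2) *\<^sub>R q j x) \<and>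
     (\<exists>Q. (\<forall>i. C1 c R (\<lambda>x. q j x $ i) (Q i)) \<and> (\<forall>x. g x = (\<Sum>i\<in>UNIV. Q i x $ i))))"

lemma eigen_div_C1: "C1 c R (eigen_div j) (\<lambda>x. - ((\<nu>s j)\<^sup>2) *\<^sub>R q j x)"
  and eigen_div_trace: "\<exists>Q. (\<forall>i. C1 c R (\<lambda>x. q j x $ i) (Q i)) \<and> (\<forall>x. eigen_div j x = (\<Sum>i\<in>UNIV. Q i x $ i))"
proof -
  have "\<exists>g. C1 c R g (\<lambda>x. - ((\<nu>s j)\<^sup>2) *\<^sub>R q j x) \<and>
     (\<exists>Q. (\<forall>i. C1 c R (\<lambda>x. q j x $ i) (Q i)) \<and> (\<forall>x. g x = (\<Sum>i\<in>UNIV. Q i x $ i)))"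
  proof (rule eigenfield_C1[OF R q_smooth[of j] q_eigen[of _ j]])
    fix Q g
    assume "\<And>i. C1 c R (\<lambda>x. q j x $ i) (Q i)" "\<And>x. g x = (\<Sum>i\<in>UNIV. Q i x $ i)"
      "C1 c R g (\<lambda>x. - ((\<nu>s j)\<^sup>2) *\<^sub>R q j x)"
    then show ?thesis by blast
  qed
  from someI_ex[OF this]
  show "C1 c R (eigen_div j) (\<lambda>x. - ((\<nu>s j)\<^sup>2) *\<^sub>R q j x)"
    "\<exists>Q. (\<forall>i. C1 c R (\<lambda>x. q j x $ i) (Q i)) \<and> (\<forall>x. eigen_div j x = (\<Sum>i\<in>UNIV. Q i x $ i))"
    unfolding eigen_div_def by blast+
qed

text \<open>Green's formula for \<open>eigen_div i\<close>, with gradient -nu_i^2 q_i, against the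
  tangential field \<open>q j\<close> transfers the orthogonality of the fields to their
  divergences.\<close>

lemma ip_eigen_div: "ip B (eigen_div i) (eigen_div j) = (if i = j then (\<nu>s i)\<^sup>2 else 0)"
proof -
  obtain Q where "(\<forall>i. C1 c R (\<lambda>x. q j x $ i) (Q i)) \<and> (\<forall>x. eigen_div j x = (\<Sum>i\<in>UNIV. Q i x $ i))"
    using eigen_div_trace ..
  then have Q: "\<And>i. C1 c R (\<lambda>x. q j x $ i) (Q i)" and g: "\<And>x. eigen_div j x = (\<Sum>i\<in>UNIV. Q i x $ i)"
    by blast+
  have "(LINT x|lebesgue_on B. (- ((\<nu>s i)\<^sup>2) *\<^sub>R q i x) \<bullet> q j x) = - (LINT x|lebesgue_on B. eigen_div i x * eigen_div j x)"
    unfolding g by (rule green[OF R eigen_div_C1 Q q_tangential])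
  then have "ip B (eigen_div i) (eigen_div j) = (\<nu>s i)\<^sup>2 * ip B (q i) (q j)" by (simp add: ip_def)
  then show ?thesis by (simp add: q_orth)
qed

lemma eigenvalue_nonresonant:
  assumes "\<And>n. deriv (psi n) (\<nu> * R) \<noteq> 0"
  shows "(\<nu>s j)\<^sup>2 \<noteq> \<nu>\<^sup>2"
proof
  assume e: "(\<nu>s j)\<^sup>2 = \<nu>\<^sup>2"
  obtain Q where "(\<forall>i. C1 c R (\<lambda>x. q j x $ i) (Q i)) \<and> (\<forall>x. eigen_div j x = (\<Sum>i\<in>UNIV. Q i x $ i))"
    using eigen_div_trace ..
  then have Q: "\<And>i. C1 c R (\<lambda>x. q j x $ i) (Q i)" "\<And>x. eigen_div j x = (\<Sum>i\<in>UNIV. Q i x $ i)"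
    by blast+
  have "ip B (q j) (q j) = 0"
    by (rule nonresonant_eigenfield_zero[OF R assms Q eigen_div_C1[of j, unfolded e] q_tangential])
  then show False by (simp add: q_orth)
qed

text \<open>The functions div q_j / nu_j are orthonormal and their gradients -nu_j q_j have square
  norm nu_j^2 \<le> L, so the cardinality bound holds for every finite set of such indices.\<close>

lemma finite_eigenvalues_below: "finite {j. (\<nu>s j)\<^sup>2 \<le> L}"
proof -
  \<comment> \<open>For t = 1 / K the smallness condition reads 128 R^2 L \<le> K^2. The summand 4
    gives t \<le> 1/2 and K \<le> K^2, so the bound by K suffices.\<close>
  define K where "K = 128 * R\<^sup>2 * \<bar>L\<bar> + 4"
  define t where "t = 1 / K"
  have K: "K \<ge> 4" by (simp add: K_def)
  then have t: "0 < t" "t \<le> 1 / 2" by (auto simp: t_def field_simps)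
  have "32 * R\<^sup>2 * L * 4 \<le> K" using R by (simp add: K_def abs_ge_self mult_left_mono add_increasing2)
  also have "K \<le> K\<^sup>2" using K by (simp add: power2_eq_square)
  finally have t2: "32 * R\<^sup>2 * t\<^sup>2 * L \<le> 1 / 4" using K by (simp add: t_def field_simps)
  define e where "e = (\<lambda>j x. (1 / \<nu>s j) * eigen_div j x)"
  define E where "E = (\<lambda>j x. (1 / \<nu>s j) *\<^sub>R (- ((\<nu>s j)\<^sup>2) *\<^sub>R q j x))"
  have n0: "\<nu>s j \<noteq> 0" for j using eigenvalue_pos[of j] by auto
  have eC: "C1 c R (e j) (E j)" for j unfolding e_def E_def by (rule C1_scale[OF eigen_div_C1])
  have ee: "ip B (e i) (e j) = (if i = j then 1 else 0)" for i j
  proof -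
    have "ip B (e i) (e j) = (1 / \<nu>s i) * ((1 / \<nu>s j) * ip B (eigen_div i) (eigen_div j))"
      using ip_scale_left[of B "1 / \<nu>s i" "eigen_div i"] ip_scale_right[of B _ "1 / \<nu>s j" "eigen_div j"]
      unfolding e_def by simp
    then show ?thesis using n0[of i] n0[of j] by (simp add: ip_eigen_div power2_eq_square)
  qed
  have EE: "ip B (E j) (E j) = (\<nu>s j)\<^sup>2" for j
    unfolding E_def scaleR_scaleR ip_scale_left ip_scale_right
    using n0[of j] by (simp add: q_orth power2_eq_square)
  have card: "real (card I) \<le> 8 / t ^ 3" if "finite I" "I \<subseteq> {j. (\<nu>s j)\<^sup>2 \<le> L}" for I
    by (rule orthonormal_bounded_gradient_card[OF R that(1) eC ee _ t t2]) (use that(2) EE in auto)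
  show ?thesis
  proof (rule ccontr)
    assume "infinite {j. (\<nu>s j)\<^sup>2 \<le> L}"
    then obtain I where I: "finite I" "card I = Suc (nat \<lceil>8 / t ^ 3\<rceil>)" "I \<subseteq> {j. (\<nu>s j)\<^sup>2 \<le> L}"
      using infinite_arbitrarily_large by blast
    from card[OF I(1,3)] I(2) show False by linarith
  qed
qed

text \<open>Beyond nu_j^2 > 2 |lam| + 1 one has |lam - nu_j^2| \<ge> nu_j^2 / 2, so the constant 4
  serves. The finitely many other indices have nonzero divisors; the sum of their quotients F is
  added to 4.\<close>

lemma spectral_gap:
  assumes "\<And>j. (\<nu>s j)\<^sup>2 \<noteq> lam"
  obtains K where "\<And>j. 1 \<le> K * (lam - (\<nu>s j)\<^sup>2)\<^sup>2" "\<And>j. \<nu>s j ^ 4 \<le> K * (lam - (\<nu>s j)\<^sup>2)\<^sup>2"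
proof -
  define S where "S = {j. (\<nu>s j)\<^sup>2 \<le> 2 * \<bar>lam\<bar> + 1}"
  define F where "F = (\<lambda>j. (1 + \<nu>s j ^ 4) / (lam - (\<nu>s j)\<^sup>2)\<^sup>2)"
  define K where "K = sum F S + 4"
  have S: "finite S" unfolding S_def by (rule finite_eigenvalues_below)
  have F0: "F j \<ge> 0" for j by (simp add: F_def)
  have K4: "K \<ge> 4" using sum_nonneg[of S F] F0 by (simp add: K_def)
  have "1 \<le> K * (lam - (\<nu>s j)\<^sup>2)\<^sup>2 \<and> \<nu>s j ^ 4 \<le> K * (lam - (\<nu>s j)\<^sup>2)\<^sup>2" for j
  proof (cases "j \<in> S")
    case True
    have p: "(lam - (\<nu>s j)\<^sup>2)\<^sup>2 > 0" using assms[of j] by simp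
    have "F j \<le> K" using member_le_sum[OF True, of F] F0 S by (simp add: K_def)
    then have "F j * (lam - (\<nu>s j)\<^sup>2)\<^sup>2 \<le> K * (lam - (\<nu>s j)\<^sup>2)\<^sup>2" by (intro mult_right_mono) auto
    then have 1: "1 + \<nu>s j ^ 4 \<le> K * (lam - (\<nu>s j)\<^sup>2)\<^sup>2" using p by (simp add: F_def)
    have "\<nu>s j ^ 4 \<ge> 0" by simp
    with 1 show ?thesis by linarith
  next
    case False
    define a where "a = (\<nu>s j)\<^sup>2"
    have a: "a > 2 * \<bar>lam\<bar> + 1" using False by (simp add: S_def a_def)
    have "(a / 2)\<^sup>2 \<le> (a - lam)\<^sup>2" using a by (intro power_mono) auto
    then have "a\<^sup>2 \<le> 4 * (lam - a)\<^sup>2" by (simp add: power2_commute power_divide)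
    also have "\<dots> \<le> K * (lam - a)\<^sup>2" using K4 by (intro mult_right_mono) auto
    finally have "a\<^sup>2 \<le> K * (lam - a)\<^sup>2" .
    moreover have "1 \<le> a\<^sup>2" using a by (intro one_le_power) simp
    moreover have "\<nu>s j ^ 4 = a\<^sup>2" by (simp add: a_def power_mult[symmetric])
    ultimately show ?thesis unfolding a_def[symmetric] by linarith
  qed
  then show thesis using that by blast
qed

text \<open>Up to equality almost everywhere, this is the closed linear span of the basis.\<close>

definition cspan :: "vfield \<Rightarrow> bool" where
  "cspan u \<longleftrightarrow> u \<in> L2 B \<and> (\<forall>z\<in>L2 B. (\<forall>j. ip B z (q j) = 0) \<longrightarrow> ip B u z = 0)"

text \<open>Pairing with a fixed field passes to the limit of the partial sums. Against
  \<open>q i\<close> these pairings are constant from n = i + 1 on.\<close>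

lemma L2_sums_cspan:
  assumes "L2_sums B (\<lambda>j x. a j *\<^sub>R q j x) u"
  shows "cspan u" "ip B u (q i) = a i"
proof -
  let ?S = "\<lambda>n x. \<Sum>j<n. a j *\<^sub>R q j x"
  have u: "u \<in> L2 B" and lim: "(\<lambda>n. ip B (\<lambda>x. u x - ?S n x) (\<lambda>x. u x - ?S n x)) \<longlonglongrightarrow> 0"
    using assms by (auto simp: L2_sums_ip)
  have S: "?S n \<in> L2 B" for n by (intro L2_sum L2_scale q_L2)
  have ipS: "ip B (?S n) z = (\<Sum>j<n. a j * ip B (q j) z)" if "z \<in> L2 B" for n z
    using that by (subst ip_sum_left) (auto intro: L2_scale q_L2 simp: ip_scale_left)
  have "ip B u z = 0" if z: "z \<in> L2 B" "\<forall>j. ip B z (q j) = 0" for z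
    using ip_tendsto[OF S u z(1) lim] z
    by (simp add: ipS ip_commute[of B "q _"] LIMSEQ_const_iff)
  then show "cspan u" using u by (simp add: cspan_def)
  have "(\<lambda>n. ip B (?S n) (q i)) \<longlonglongrightarrow> ip B u (q i)" by (rule ip_tendsto[OF S u q_L2 lim])
  moreover have "\<forall>\<^sub>F n in sequentially. ip B (?S n) (q i) = a i"
  proof (rule eventually_sequentiallyI)
    fix n assume "Suc i \<le> n"
    then show "ip B (?S n) (q i) = a i"
      by (simp add: ipS[OF q_L2] q_orth if_distrib[of "\<lambda>t. _ * t"] cong: if_cong)
  qed
  then have "(\<lambda>n. ip B (?S n) (q i)) \<longlonglongrightarrow> a i" by (rule tendsto_eventually)
  ultimately show "ip B u (q i) = a i" by (rule LIMSEQ_unique)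
qed

lemma A_space_cspan: "u \<in> A_space B \<Longrightarrow> cspan u"
  by (rule L2_sums_cspan(1)[OF q_complete])

lemma cspan_L2: "cspan u \<Longrightarrow> u \<in> L2 B"
  by (simp add: cspan_def)

lemma cspan_add: "cspan u \<Longrightarrow> cspan v \<Longrightarrow> cspan (\<lambda>x. u x + v x)"
  by (simp add: cspan_def L2_add ip_add_left)

lemma cspan_scale: "cspan u \<Longrightarrow> cspan (\<lambda>x. a *\<^sub>R u x)"
  by (simp add: cspan_def L2_scale ip_scale_left)

text \<open>The difference of u and v has zero coefficients, so it is one of the fields to which
  both are orthogonal by \<open>cspan\<close>, hence it is orthogonal to itself.\<close>

lemma cspan_eqI:
  assumes u: "cspan u" and v: "cspan v" and "\<And>j. ip B u (q j) = ip B v (q j)"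
  shows "eq_ae B u v"
proof (rule eq_aeI)
  let ?d = "\<lambda>x. u x - v x"
  show uL: "u \<in> L2 B" and vL: "v \<in> L2 B" using u v by (auto simp: cspan_def)
  have d: "?d \<in> L2 B" using uL vL by (rule L2_diff)
  have "\<forall>j. ip B ?d (q j) = 0" using assms(3) uL vL q_L2 by (simp add: ip_diff_left)
  then have "ip B u ?d = 0" "ip B v ?d = 0" using u v d by (auto simp: cspan_def)
  then show "ip B ?d ?d = 0" using uL vL d by (simp add: ip_diff_left)
qed

lemma summable_coefficients:
  assumes "u \<in> L2 B"
  shows "summable (\<lambda>j. (ip B u (q j))\<^sup>2)"
proof (rule bounded_imp_summable)
  show "(\<Sum>k\<le>n. (ip B u (q k))\<^sup>2) \<le> ip B u u" for n
    by (rule Bessel) (use assms q_L2 q_orth in auto)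
qed simp

text \<open>The potentials \<open>- div q j / (\<nu>s j)\<^sup>2\<close> of the eigenfields are orthogonal as well, so the potentials of
  the partial sums converge.\<close>

lemma A_space_sum:
  assumes a: "summable (\<lambda>j. (a j)\<^sup>2)"
  obtains u where "u \<in> A_space B" "L2_sums B (\<lambda>j x. a j *\<^sub>R q j x) u"
proof -
  have n0: "\<nu>s j \<noteq> 0" for j using eigenvalue_pos[of j] by auto
  \<comment> \<open>As div q_j has gradient -nu_j^2 q_j, this factor makes \<open>q j\<close> the
    gradient of \<open>h j\<close>.\<close>
  define h where "h = (\<lambda>j x. (- 1 / (\<nu>s j)\<^sup>2) * eigen_div j x)"
  have hC: "C1 c R (h j) (q j)" for j
    using C1_scale[OF eigen_div_C1[of j], of "- 1 / (\<nu>s j)\<^sup>2"] n0[of j] by (simp add: h_def)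
  have hL: "h j \<in> L2 B" for j using hC[of j] by (intro L2_ball_continuous) (simp add: C1_def)
  have hh: "ip B (h i) (h j) = (- 1 / (\<nu>s i)\<^sup>2) * ((- 1 / (\<nu>s j)\<^sup>2) * ip B (eigen_div i) (eigen_div j))" for i j
    using ip_scale_left[of B "- 1 / (\<nu>s i)\<^sup>2" "eigen_div i"] ip_scale_right[of B _ "- 1 / (\<nu>s j)\<^sup>2" "eigen_div j"]
    unfolding h_def by simp
  have B: "B \<in> lmeasurable" by simp
  obtain u where u: "u \<in> L2 B"
    "(\<lambda>n. ip B (\<lambda>x. u x - (\<Sum>j<n. a j *\<^sub>R q j x)) (\<lambda>x. u x - (\<Sum>j<n. a j *\<^sub>R q j x))) \<longlonglongrightarrow> 0"
    by (rule Riesz_Fischer[where K=1, OF B q_L2 _ _ a]) (auto simp: q_orth)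
  \<comment> \<open>The square norm of \<open>h j\<close> is 1 / nu_j^2; the first eigenvalue being
    the smallest, one bound serves all j.\<close>
  have hb: "ip B (h j) (h j) \<le> 1 / (\<nu>s 0)\<^sup>2" for j
  proof -
    have "ip B (h j) (h j) = 1 / (\<nu>s j)\<^sup>2" using n0[of j] by (simp add: hh ip_eigen_div)
    then show ?thesis using eigenvalue_ge[of j] eigenvalue_pos[of 0] by (simp add: frac_le)
  qed
  obtain p where p: "p \<in> L2 B"
    "(\<lambda>n. ip B (\<lambda>x. p x - (\<Sum>j<n. a j *\<^sub>R h j x)) (\<lambda>x. p x - (\<Sum>j<n. a j *\<^sub>R h j x))) \<longlonglongrightarrow> 0"
    by (rule Riesz_Fischer[OF B hL _ hb a]) (auto simp: hh ip_eigen_div)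
  have "C1 c R (\<lambda>x. \<Sum>j<n. a j *\<^sub>R h j x) (\<lambda>x. \<Sum>j<n. a j *\<^sub>R q j x)" for n
    unfolding C1_def
  proof (intro conjI ballI)
    fix x assume "x \<in> B"
    then have "((\<lambda>x. \<Sum>j<n. a j *\<^sub>R h j x) has_derivative (\<lambda>d. \<Sum>j<n. a j *\<^sub>R (q j x \<bullet> d))) (at x)"
      using hC by (intro has_derivative_sum has_derivative_scaleR_right) (simp add: C1_def)
    then show "((\<lambda>x. \<Sum>j<n. a j *\<^sub>R h j x) has_derivative (\<lambda>d. (\<Sum>j<n. a j *\<^sub>R q j x) \<bullet> d)) (at x)"
      by (simp add: inner_sum_left)
  qed (use hC in \<open>auto intro!: continuous_intros simp: C1_def\<close>)
  then have "weak_grad B (\<lambda>x. \<Sum>j<n. a j *\<^sub>R h j x) (\<lambda>x. \<Sum>j<n. a j *\<^sub>R q j x)" for n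
    by (rule weak_grad_C1[OF R])
  then have "weak_grad B p u"
    by (intro weak_grad_limit[OF R _ p(1) _ u(1) _ p(2) u(2)] L2_sum L2_scale hL q_L2)
  then have "u \<in> A_space B" using p(1) u(1) by (auto simp: A_space_def H1_def)
  then show thesis using that u by (auto simp: L2_sums_ip)
qed

section \<open>Orthogonal projections\<close>

text \<open>The Fourier series of w sums to some u in A. The remainder w - u has zero coefficients,
  so it is orthogonal to A because A lies in the closed span of the basis. This u shows that the
  choice in \<open>orth_proj\<close> succeeds.\<close>

lemma orth_proj_A:
  assumes w: "w \<in> L2 B"
  shows "orth_proj B (A_space B) w \<in> A_space B" "(\<lambda>x. w x - orth_proj B (A_space B) w x) \<in> V0 B"
proof -
  obtain u where u: "u \<in> A_space B" "L2_sums B (\<lambda>j x. ip B w (q j) *\<^sub>R q j x) u"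
    using A_space_sum[OF summable_coefficients[OF w]] by blast
  have uL: "u \<in> L2 B" using u(1) by (rule A_space_L2)
  have d: "(\<lambda>x. w x - u x) \<in> L2 B" using w uL by (rule L2_diff)
  have "\<forall>j. ip B (\<lambda>x. w x - u x) (q j) = 0"
    using L2_sums_cspan(2)[OF u(2)] w uL q_L2 by (simp add: ip_diff_left)
  then have "ip B (\<lambda>x. w x - u x) z = 0" if "z \<in> A_space B" for z
    using A_space_cspan[OF that] d by (subst ip_commute) (simp add: cspan_def)
  then have "\<exists>g. g \<in> A_space B \<and> (\<forall>u\<in>A_space B. L2_inner B (\<lambda>x. w x - g x) u = 0)"
    using u(1) by (auto simp: L2_inner_eq_ip)
  from someI_ex[OF this]
  have *: "orth_proj B (A_space B) w \<in> A_space B"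
    "\<forall>u\<in>A_space B. ip B (\<lambda>x. w x - orth_proj B (A_space B) w x) u = 0"
    unfolding orth_proj_def L2_inner_eq_ip by blast+
  then show "orth_proj B (A_space B) w \<in> A_space B" "(\<lambda>x. w x - orth_proj B (A_space B) w x) \<in> V0 B"
    using w by (auto simp: V0_iff A_space_L2 L2_diff)
qed

lemma ip_V0_A: "v \<in> V0 B \<Longrightarrow> u \<in> A_space B \<Longrightarrow> ip B u v = 0"
  by (metis V0_iff ip_commute)

text \<open>The remainder of w after projection to A is a candidate, because what it omits lies in A
  and is orthogonal to \<open>V0\<close>.\<close>

lemma orth_proj_V0:
  assumes w: "w \<in> L2 B"
  shows "orth_proj B (V0 B) w \<in> V0 B"
    "\<And>z. z \<in> V0 B \<Longrightarrow> ip B (\<lambda>x. w x - orth_proj B (V0 B) w x) z = 0"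
proof -
  let ?a = "orth_proj B (A_space B) w"
  have "L2_inner B (\<lambda>x. w x - (w x - ?a x)) z = 0" if "z \<in> V0 B" for z
    using ip_V0_A[OF that orth_proj_A(1)[OF w]] by (simp add: L2_inner_eq_ip)
  then have "\<exists>g. g \<in> V0 B \<and> (\<forall>u\<in>V0 B. L2_inner B (\<lambda>x. w x - g x) u = 0)"
    using orth_proj_A(2)[OF w] by (intro exI[of _ "\<lambda>x. w x - ?a x"]) blast
  from someI_ex[OF this]
  show "orth_proj B (V0 B) w \<in> V0 B" "\<And>z. z \<in> V0 B \<Longrightarrow> ip B (\<lambda>x. w x - orth_proj B (V0 B) w x) z = 0"
    unfolding orth_proj_def L2_inner_eq_ip by blast+
qed

lemma orth_proj_A_coeff: "w \<in> L2 B \<Longrightarrow> ip B (orth_proj B (A_space B) w) (q j) = ip B w (q j)"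
  using orth_proj_A[of w] q_A[of j] q_L2[of j] by (auto simp: V0_iff ip_diff_left A_space_L2)

text \<open>This replaces the chosen projections by explicit components: the parts in A have equal
  coefficients, and the difference of the parts in \<open>V0\<close> is orthogonal to
  itself.\<close>

lemma orth_proj_unique:
  assumes w: "w \<in> L2 B" and a: "a \<in> A_space B" and v: "v \<in> V0 B" and eq: "eq_ae B w (\<lambda>x. a x + v x)"
  shows "eq_ae B (orth_proj B (A_space B) w) a" "eq_ae B (orth_proj B (V0 B) w) v"
proof -
  have aL: "a \<in> L2 B" and vL: "v \<in> L2 B" using a v by (auto simp: A_space_L2 V0_iff)
  have ipw: "ip B w z = ip B a z + ip B v z" if "z \<in> L2 B" for z
    using ip_cong_eq_ae[OF eq w L2_add[OF aL vL] that] aL vL that by (simp add: ip_add_left)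
  show "eq_ae B (orth_proj B (A_space B) w) a"
  proof (rule cspan_eqI)
    fix j
    have "ip B v (q j) = 0" using v q_A by (simp add: V0_iff)
    then show "ip B (orth_proj B (A_space B) w) (q j) = ip B a (q j)"
      using orth_proj_A_coeff[OF w] ipw[OF q_L2] by simp
  qed (use A_space_cspan a orth_proj_A(1)[OF w] in auto)
  let ?p = "orth_proj B (V0 B) w" let ?d = "\<lambda>x. orth_proj B (V0 B) w x - v x"
  have pL: "?p \<in> L2 B" using orth_proj_V0(1)[OF w] by (simp add: V0_iff)
  have d: "?d \<in> V0 B" by (intro V0_diff orth_proj_V0(1) w v)
  then have dL: "?d \<in> L2 B" by (simp add: V0_iff)
  have "ip B w ?d - ip B ?p ?d = 0"
    using orth_proj_V0(2)[OF w d] w pL dL by (simp add: ip_diff_left)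
  moreover have "ip B w ?d = ip B v ?d" using ipw[OF dL] ip_V0_A[OF d a] by simp
  ultimately have "ip B ?d ?d = 0" using pL vL dL by (simp add: ip_diff_left)
  then show "eq_ae B ?p v" by (rule eq_aeI[OF pL vL])
qed

lemma orth_proj_sum:
  assumes w: "w \<in> L2 B"
  shows "eq_ae B w (\<lambda>x. orth_proj B (A_space B) w x + orth_proj B (V0 B) w x)"
proof -
  have "eq_ae B (orth_proj B (V0 B) w) (\<lambda>x. w x - orth_proj B (A_space B) w x)"
    by (rule orth_proj_unique(2)[OF w orth_proj_A[OF w]]) (simp add: eq_ae_def)
  then show ?thesis unfolding eq_ae_def by (rule AE_mp) (intro AE_I2, simp)
qed

section \<open>The operator N_d and its resolvent\<close>

text \<open>The condition defining the domain is square summability of the coefficients nu_j^2 (u,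
  q_j), which makes the series converge and the choice in \<open>N_d\<close> succeed.\<close>

lemma N_d_sums:
  assumes "u \<in> A_pow B q \<nu>s 1"
  shows "L2_sums B (\<lambda>j x. - ((\<nu>s j)\<^sup>2 * ip B u (q j)) *\<^sub>R q j x) (N_d B q \<nu>s u)"
proof -
  have "summable (\<lambda>j. \<nu>s j ^ 4 * (ip B u (q j))\<^sup>2)"
    using assms by (simp add: A_pow_def L2_inner_eq_ip)
  moreover have "\<nu>s j ^ 4 * (ip B u (q j))\<^sup>2 = (- ((\<nu>s j)\<^sup>2 * ip B u (q j)))\<^sup>2" for j
    by (simp add: power_mult_distrib power_mult[symmetric])
  ultimately have "summable (\<lambda>j. (- ((\<nu>s j)\<^sup>2 * ip B u (q j)))\<^sup>2)" by simp
  from A_space_sum[OF this]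
  have "\<exists>g. L2_sums B (\<lambda>j x. - ((\<nu>s j)\<^sup>2 * ip B u (q j)) *\<^sub>R q j x) g" by blast
  from someI_ex[OF this] show ?thesis unfolding N_d_def L2_inner_eq_ip .
qed

text \<open>Passing from k to k + 1 multiplies the terms by nu_j^4, and division of the coefficients
  multiplies them by 1 / (lam - nu_j^2)^2; together these factors are at most K.\<close>

lemma A_pow_resolvent:
  assumes K: "\<And>j. \<nu>s j ^ 4 \<le> K * (lam - (\<nu>s j)\<^sup>2)\<^sup>2" and ne: "\<And>j. (\<nu>s j)\<^sup>2 \<noteq> lam"
    and a: "a \<in> A_pow B q \<nu>s k" and b: "b \<in> A_space B"
    and ab: "\<And>j. ip B b (q j) = ip B a (q j) / (lam - (\<nu>s j)\<^sup>2)"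
  shows "b \<in> A_pow B q \<nu>s (k + 1)"
proof -
  have "summable (\<lambda>j. \<nu>s j ^ (4 * (k + 1)) * (ip B b (q j))\<^sup>2)"
  proof (rule summable_comparison_test'[where N=0])
    show "summable (\<lambda>j. K * (\<nu>s j ^ (4 * k) * (ip B a (q j))\<^sup>2))"
      using a by (intro summable_mult) (simp add: A_pow_def L2_inner_eq_ip)
    fix j :: nat
    have p: "(lam - (\<nu>s j)\<^sup>2)\<^sup>2 > 0" using ne[of j] by simp
    have e: "\<nu>s j ^ (4 * k) \<ge> 0" by (simp add: power_mult)
    have "\<nu>s j ^ (4 * (k + 1)) * (ip B b (q j))\<^sup>2 = \<nu>s j ^ (4 * k) * (ip B a (q j))\<^sup>2 * (\<nu>s j ^ 4 / (lam - (\<nu>s j)\<^sup>2)\<^sup>2)"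
      by (simp add: ab power_divide power_add distrib_left mult_ac)
    also have "\<dots> \<le> \<nu>s j ^ (4 * k) * (ip B a (q j))\<^sup>2 * K"
      using K[of j] p e by (intro mult_left_mono) (auto simp: divide_le_eq)
    finally have "\<nu>s j ^ (4 * (k + 1)) * (ip B b (q j))\<^sup>2 \<le> K * (\<nu>s j ^ (4 * k) * (ip B a (q j))\<^sup>2)"
      by (simp add: mult_ac)
    moreover have "\<nu>s j ^ (4 * (k + 1)) \<ge> 0" by (simp only: power_mult) simp
    ultimately show "norm (\<nu>s j ^ (4 * (k + 1)) * (ip B b (q j))\<^sup>2) \<le> K * (\<nu>s j ^ (4 * k) * (ip B a (q j))\<^sup>2)"
      by (simp only: real_norm_def abs_of_nonneg mult_nonneg_nonneg zero_le_power2)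
  qed
  then show ?thesis using b by (simp add: A_pow_def L2_inner_eq_ip)
qed

theorem graddiv_solvable:
  assumes nr: "\<And>n. deriv (psi n) (\<nu> * R) \<noteq> 0" and lam: "lam = \<nu>\<^sup>2"
    and f: "f \<in> direct_sum B (A_pow B q \<nu>s k) (W_space B m)"
  shows "\<exists>w. graddiv_solution B q \<nu>s lam f w \<and>
             (\<forall>w'. graddiv_solution B q \<nu>s lam f w' \<longrightarrow> eq_ae B w' w) \<and>
             w \<in> direct_sum B (A_pow B q \<nu>s (k + 1)) (W_space B m)"
proof -
  have lam0: "lam \<noteq> 0" using nr[of 0] deriv_psi_0_at_0 lam by auto
  have ne: "(\<nu>s j)\<^sup>2 \<noteq> lam" for j using eigenvalue_nonresonant[OF nr] lam by simp
  obtain K where K: "\<And>j. 1 \<le> K * (lam - (\<nu>s j)\<^sup>2)\<^sup>2" "\<And>j. \<nu>s j ^ 4 \<le> K * (lam - (\<nu>s j)\<^sup>2)\<^sup>2"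
    using spectral_gap[OF ne] by blast
  obtain a v where fL: "f \<in> L2 B" and a: "a \<in> A_pow B q \<nu>s k" and v: "v \<in> W_space B m"
    and fav: "eq_ae B f (\<lambda>x. a x + v x)"
    using f by (auto simp: direct_sum_def)
  have aA: "a \<in> A_space B" using a by (simp add: A_pow_def)
  have vV: "v \<in> V0 B" using v by (rule W_space_V0)
  have aL: "a \<in> L2 B" and vL: "v \<in> L2 B" using aA vV by (auto simp: A_space_L2 V0_iff)
  let ?PA = "orth_proj B (A_space B)" and ?PV = "orth_proj B (V0 B)"
  note fA = orth_proj_unique(1)[OF fL aA vV fav] and fV = orth_proj_unique(2)[OF fL aA vV fav]
  define \<beta> where "\<beta> = (\<lambda>j. ip B a (q j) / (lam - (\<nu>s j)\<^sup>2))"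
  have "summable (\<lambda>j. (\<beta> j)\<^sup>2)"
  proof (rule summable_comparison_test'[where N=0])
    show "summable (\<lambda>j. K * (ip B a (q j))\<^sup>2)" by (intro summable_mult summable_coefficients aL)
    fix j :: nat
    have p: "(lam - (\<nu>s j)\<^sup>2)\<^sup>2 > 0" using ne[of j] by simp
    have "(\<beta> j)\<^sup>2 = (ip B a (q j))\<^sup>2 * (1 / (lam - (\<nu>s j)\<^sup>2)\<^sup>2)" by (simp add: \<beta>_def power_divide)
    also have "\<dots> \<le> (ip B a (q j))\<^sup>2 * K" using K(1)[of j] p by (intro mult_left_mono) (auto simp: divide_le_eq)
    finally show "norm ((\<beta> j)\<^sup>2) \<le> K * (ip B a (q j))\<^sup>2" by (simp add: mult.commute)
  qed
  then obtain b where b: "b \<in> A_space B" "L2_sums B (\<lambda>j x. \<beta> j *\<^sub>R q j x) b" by (rule A_space_sum)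
  have bq: "ip B b (q j) = \<beta> j" for j by (rule L2_sums_cspan(2)[OF b(2)])
  have bL: "b \<in> L2 B" using b(1) by (rule A_space_L2)
  define w where "w = (\<lambda>x. b x + (1 / lam) *\<^sub>R v x)"
  have vs: "(\<lambda>x. (1 / lam) *\<^sub>R v x) \<in> V0 B" using vV by (rule V0_scale)
  have wL: "w \<in> L2 B" unfolding w_def by (intro L2_add bL L2_scale vL)
  have wae: "eq_ae B w (\<lambda>x. b x + (1 / lam) *\<^sub>R v x)" by (simp add: w_def eq_ae_def)
  note wA = orth_proj_unique(1)[OF wL b(1) vs wae] and wV = orth_proj_unique(2)[OF wL b(1) vs wae]
  have PAw: "?PA w \<in> A_space B" by (rule orth_proj_A(1)[OF wL])
  have PAq: "ip B (?PA w) (q j) = \<beta> j" for j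
    using ip_cong_eq_ae[OF wA A_space_L2[OF PAw] bL q_L2] bq by simp
  \<comment> \<open>By Bessel's inequality every field in A lies in A^0, so the resolvent bound for
    exponent 0 places the solution in the domain A^2 whatever k is.\<close>
  have a0: "a \<in> A_pow B q \<nu>s 0" using aA summable_coefficients[OF aL] by (simp add: A_pow_def L2_inner_eq_ip)
  have PA1: "?PA w \<in> A_pow B q \<nu>s 1"
    using A_pow_resolvent[OF K(2) ne a0 PAw] PAq by (simp add: \<beta>_def)
  have Nd: "cspan (N_d B q \<nu>s u)" "ip B (N_d B q \<nu>s u) (q j) = - ((\<nu>s j)\<^sup>2 * ip B u (q j))"
    if "u \<in> A_pow B q \<nu>s 1" for u j
    using L2_sums_cspan[OF N_d_sums[OF that]] by auto
  have "graddiv_solution B q \<nu>s lam f w"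
    unfolding graddiv_solution_def
  proof (intro conjI wL PA1)
    show "eq_ae B (\<lambda>x. N_d B q \<nu>s (?PA w) x + lam *\<^sub>R ?PA w x) (?PA f)"
    \<comment> \<open>Both sides lie in the closed span of the basis, so the equation may be checked
      on coefficients.\<close>
    proof (rule cspan_eqI)
      show "cspan (\<lambda>x. N_d B q \<nu>s (?PA w) x + lam *\<^sub>R ?PA w x)"
        by (intro cspan_add cspan_scale Nd PA1 A_space_cspan PAw)
      show "cspan (?PA f)" by (intro A_space_cspan orth_proj_A fL)
      fix j
      have "ip B (\<lambda>x. N_d B q \<nu>s (?PA w) x + lam *\<^sub>R ?PA w x) (q j) = - ((\<nu>s j)\<^sup>2 * \<beta> j) + lam * \<beta> j"
        using cspan_L2[OF Nd(1)[OF PA1]] A_space_L2[OF PAw]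
        by (simp add: ip_add_left L2_scale q_L2 ip_scale_left Nd(2)[OF PA1] PAq)
      also have "\<dots> = (lam - (\<nu>s j)\<^sup>2) * \<beta> j" by (simp add: algebra_simps)
      also have "\<dots> = ip B a (q j)" using ne[of j] by (simp add: \<beta>_def)
      also have "\<dots> = ip B (?PA f) (q j)"
        using ip_cong_eq_ae[OF fA A_space_L2[OF orth_proj_A(1)[OF fL]] aL q_L2] by simp
      finally show "ip B (\<lambda>x. N_d B q \<nu>s (?PA w) x + lam *\<^sub>R ?PA w x) (q j) = ip B (?PA f) (q j)" .
    qed
    have "eq_ae B (\<lambda>x. lam *\<^sub>R ?PV w x) v"
      using wV unfolding eq_ae_def by (rule AE_mp) (intro AE_I2, use lam0 in simp)
    then show "eq_ae B (\<lambda>x. lam *\<^sub>R ?PV w x) (?PV f)"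
      using fV eq_ae_sym eq_ae_trans by blast
  qed
  moreover have "eq_ae B w' w" if "graddiv_solution B q \<nu>s lam f w'" for w'
  proof -
    have w': "w' \<in> L2 B" "?PA w' \<in> A_pow B q \<nu>s 1"
      "eq_ae B (\<lambda>x. N_d B q \<nu>s (?PA w') x + lam *\<^sub>R ?PA w' x) (?PA f)"
      "eq_ae B (\<lambda>x. lam *\<^sub>R ?PV w' x) (?PV f)"
      using that by (auto simp: graddiv_solution_def)
    have PAw': "?PA w' \<in> A_space B" by (rule orth_proj_A(1)[OF w'(1)])
    \<comment> \<open>The equation determines each coefficient of the potential part up to the
      nonzero factor lam - nu_j^2, and the coefficients determine the field.\<close>
    have "eq_ae B (?PA w') b"
    proof (rule cspan_eqI)
      fix j
      have NL: "N_d B q \<nu>s (?PA w') \<in> L2 B" by (rule cspan_L2[OF Nd(1)[OF w'(2)]])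
      have "ip B a (q j) = ip B (?PA f) (q j)"
        using ip_cong_eq_ae[OF fA A_space_L2[OF orth_proj_A(1)[OF fL]] aL q_L2] by simp
      also have "\<dots> = ip B (\<lambda>x. N_d B q \<nu>s (?PA w') x + lam *\<^sub>R ?PA w' x) (q j)"
        using ip_cong_eq_ae[OF w'(3) L2_add[OF NL L2_scale[OF A_space_L2[OF PAw']]]
            A_space_L2[OF orth_proj_A(1)[OF fL]] q_L2] by simp
      also have "\<dots> = (lam - (\<nu>s j)\<^sup>2) * ip B (?PA w') (q j)"
        using NL A_space_L2[OF PAw']
        by (simp add: ip_add_left L2_scale q_L2 ip_scale_left Nd(2)[OF w'(2)] algebra_simps)
      finally show "ip B (?PA w') (q j) = ip B b (q j)"
        using ne[of j] by (simp add: bq \<beta>_def)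
    qed (use A_space_cspan PAw' b(1) in auto)
    moreover have "eq_ae B (\<lambda>x. lam *\<^sub>R ?PV w' x) v" using w'(4) fV by (rule eq_ae_trans)
    moreover note orth_proj_sum[OF w'(1)]
    ultimately show ?thesis
      unfolding eq_ae_def w_def
    proof eventually_elim
      case (elim x)
      have "?PV w' x = (1 / lam) *\<^sub>R (lam *\<^sub>R ?PV w' x)" using lam0 by simp
      then show ?case using elim by simp
    qed
  qed
  moreover have "w \<in> direct_sum B (A_pow B q \<nu>s (k + 1)) (W_space B m)"
  proof -
    have "b \<in> A_pow B q \<nu>s (k + 1)"
      using A_pow_resolvent[OF K(2) ne a b(1)] bq by (simp add: \<beta>_def)
    moreover have "(\<lambda>x. (1 / lam) *\<^sub>R v x) \<in> W_space B m" using v by (rule W_space_scale)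
    ultimately show ?thesis using wL wae unfolding direct_sum_def by (intro CollectI conjI bexI)
  qed
  ultimately show ?thesis by blast
qed

end

theorem mainTheorem12:
  fixes c :: "real^3" and R :: real
    and q :: "nat \<Rightarrow> vfield" and \<nu>s :: "nat \<Rightarrow> real"
    and \<nu> lam :: real and k m :: nat and f :: vfield
  assumes "R > 0"
    and "graddiv_eigenbasis c R q \<nu>s"
    and "\<forall>n. deriv (psi n) (\<nu> * R) \<noteq> 0"
    and "lam = \<nu>\<^sup>2"
    and "f \<in> direct_sum (ball c R) (A_pow (ball c R) q \<nu>s k) (W_space (ball c R) m)"
  shows "\<exists>w. graddiv_solution (ball c R) q \<nu>s lam f w \<and>
             (\<forall>w'. graddiv_solution (ball c R) q \<nu>s lam f w' \<longrightarrow> eq_ae (ball c R) w' w) \<and>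
             w \<in> direct_sum (ball c R) (A_pow (ball c R) q \<nu>s (k + 1)) (W_space (ball c R) m)"
proof -
  interpret graddiv_basis c R q \<nu>s using assms(1,2) by unfold_locales
  show ?thesis using graddiv_solvable[OF _ assms(4,5)] assms(3) by blast
qed

end
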